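(* Let $G$ be a compact Lie group and let $0<r\le 1$. Let $A:L^{2}(G)\to L^{2}(G)$ be a linear continuous operator whose matrix-valued symbol $\sigma_A(\xi)$ depends only on $\xi$ (and not on $x\in G$). If $$\sum_{[\xi]\in\widehat{G}}d_{\xi}\,\|\sigma_A(\xi)\|_{S_r}^r<\infty,$$ then $A$ is $r$-nuclear on $L^2(G)$.
   Context: $G$ carries its normalised Haar measure. $\widehat G$ is the set of equivalence classes of continuous irreducible unitary representations of $G$; for each $[\xi]\in\widehat G$ one fixes a representative viewed, via an orthonormal basis of its representation space, as a unitary-matrix-valued function $\xi:G\to\mathbb C^{d_\xi\times d_\xi}$, where $d_\xi$ is its dimension. The matrix-valued symbol of a linear continuous operator $A$ from $C^\infty(G)$ to $\mathcal D'(G)$ (in particular of a bounded operator on $L^2(G)$) is $\sigma_A(x,\xi):=\xi(x)^*(A\xi)(x)\in\mathbb C^{d_\xi\times d_\xi}$, where $(A\xi)_{ij}=A(\xi_{ij})$; then $Af(x)=\sum_{[\xi]\in\widehat G}d_\xi\operatorname{Tr}(\xi(x)\sigma_A(x,\xi)\widehat f(\xi))$ with $\widehat f(\xi)=\int_G f(x)\xi(x)^*dx$. The symbol is independent of $x$ exactly when $A$ is left-invariant. For a matrix $M$, $|M|=(M^*M)^{1/2}$ and $\|M\|_{S_r}=(\operatorname{Tr}(|M|^r))^{1/r}$. For $0<r\le1$ and Banach spaces $E,F$, a linear operator $T:E\to F$ is $r$-nuclear if there are sequences $(x_n')$ in $E'$ and $(y_n)$ in $F$ with $Tx=\sum_{n=1}^\infty\langle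 x,x_n'\rangle y_n$ for all $x\in E$ and $\sum_{n=1}^\infty\|x_n'\|_{E'}^r\|y_n\|_F^r<\infty$. *)

theory Defs
  imports
    "HOL-Analysis.Analysis"
    "HOL-Library.Function_Algebras"
    "Jordan_Normal_Form.Schur_Decomposition"
begin

section \<open>Lie groups\<close>

text \<open>
  The dimension \<open>n\<close> of a Lie group may be \<open>0\<close> (finite groups) and the product manifold has
  dimension \<open>n + n\<close>, so the model spaces are the topologies \<^const>\<open>Euclidean_space\<close>, whose
  points are functions \<open>nat \<Rightarrow> real\<close> vanishing from index \<open>n\<close> on.
\<close>

definition partial_deriv :: "nat \<Rightarrow> ((nat \<Rightarrow> real) \<Rightarrow> real) \<Rightarrow> (nat \<Rightarrow> real) \<Rightarrow> real" where
  "partial_deriv i f z = deriv (\<lambda>t. f (z(i := t))) (z i)"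

primrec Ck_fun :: "nat \<Rightarrow> nat \<Rightarrow> (nat \<Rightarrow> real) set \<Rightarrow> ((nat \<Rightarrow> real) \<Rightarrow> real) \<Rightarrow> bool" where
  "Ck_fun 0 n D f \<longleftrightarrow> continuous_map (subtopology (Euclidean_space n) D) euclideanreal f"
| "Ck_fun (Suc k) n D f \<longleftrightarrow>
     continuous_map (subtopology (Euclidean_space n) D) euclideanreal f \<and>
     (\<forall>i<n. (\<forall>z\<in>D. (\<lambda>t. f (z(i := t))) differentiable (at (z i))) \<and>
            Ck_fun k n D (partial_deriv i f))"

text \<open>Only meaningful for \<open>D\<close> open in \<^term>\<open>Euclidean_space n\<close>.\<close>

definition smooth_fun :: "nat \<Rightarrow> (nat \<Rightarrow> real) set \<Rightarrow> ((nat \<Rightarrow> real) \<Rightarrow> real) \<Rightarrow> bool" where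
  "smooth_fun n D f \<longleftrightarrow> (\<forall>k. Ck_fun k n D f)"

type_synonym 'a chart = "'a set \<times> ('a \<Rightarrow> nat \<Rightarrow> real)"

definition is_chart :: "nat \<Rightarrow> 'a topology \<Rightarrow> 'a chart \<Rightarrow> bool" where
  "is_chart n T c \<longleftrightarrow> (case c of (U, \<phi>) \<Rightarrow>
     openin T U \<and> openin (Euclidean_space n) (\<phi> ` U) \<and>
     homeomorphic_map (subtopology T U) (subtopology (Euclidean_space n) (\<phi> ` U)) \<phi>)"

definition smooth_map ::
  "nat \<Rightarrow> 'a topology \<Rightarrow> 'a chart set \<Rightarrow> nat \<Rightarrow> 'b topology \<Rightarrow> 'b chart set \<Rightarrow> ('a \<Rightarrow> 'b) \<Rightarrow> bool" where
  "smooth_map n S \<A> m T \<B> f \<longleftrightarrow> continuous_map S T f \<and>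
     (\<forall>(U, \<phi>)\<in>\<A>. \<forall>(V, \<psi>)\<in>\<B>. \<forall>k<m.
        smooth_fun n (\<phi> ` (U \<inter> f -` V)) (\<lambda>z. \<psi> (f (inv_into U \<phi> z)) k))"

text \<open>The atlas need not be maximal. Smoothness of the identity is smoothness of all transition
  maps.\<close>

definition smooth_manifold :: "nat \<Rightarrow> 'a topology \<Rightarrow> 'a chart set \<Rightarrow> bool" where
  "smooth_manifold n T \<A> \<longleftrightarrow>
     Hausdorff_space T \<and> second_countable T \<and>
     (\<forall>c\<in>\<A>. is_chart n T c) \<and> (\<Union>(U, \<phi>)\<in>\<A>. U) = topspace T \<and>
     smooth_map n T \<A> n T \<A> (\<lambda>x. x)"

definition prod_atlas :: "nat \<Rightarrow> 'a chart set \<Rightarrow> 'b chart set \<Rightarrow> ('a \<times> 'b) chart set" where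
  "prod_atlas n \<A> \<B> =
     {(U \<times> V, \<lambda>(x, y) i. if i < n then \<phi> x i else \<psi> y (i - n)) | U \<phi> V \<psi>.
        (U, \<phi>) \<in> \<A> \<and> (V, \<psi>) \<in> \<B>}"

definition lie_group ::
  "('a, 'b) monoid_scheme \<Rightarrow> 'a topology \<Rightarrow> nat \<Rightarrow> 'a chart set \<Rightarrow> bool" where
  "lie_group G T n \<A> \<longleftrightarrow>
     group G \<and> topspace T = carrier G \<and> smooth_manifold n T \<A> \<and>
     smooth_map (n + n) (prod_topology T T) (prod_atlas n \<A> \<A>) n T \<A> (\<lambda>(x, y). x \<otimes>\<^bsub>G\<^esub> y) \<and>
     smooth_map n T \<A> n T \<A> (\<lambda>x. inv\<^bsub>G\<^esub> x)"

definition compact_lie_group ::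
  "('a, 'b) monoid_scheme \<Rightarrow> 'a topology \<Rightarrow> nat \<Rightarrow> 'a chart set \<Rightarrow> bool" where
  "compact_lie_group G T n \<A> \<longleftrightarrow> lie_group G T n \<A> \<and> compact_space T"

text \<open>Regularity is not demanded: on a compact second countable Hausdorff space every finite Borel
  measure is regular. Right invariance is likewise automatic.\<close>

definition normalised_haar ::
  "('a, 'b) monoid_scheme \<Rightarrow> 'a topology \<Rightarrow> 'a measure \<Rightarrow> bool" where
  "normalised_haar G T M \<longleftrightarrow>
     space M = carrier G \<and> sets M = sigma_sets (topspace T) {U. openin T U} \<and>
     emeasure M (space M) = 1 \<and>
     (\<forall>x\<in>carrier G. \<forall>S\<in>sets M. emeasure M (x <#\<^bsub>G\<^esub> S) = emeasure M S)"


section \<open>Normed spaces and \<open>r\<close>-nuclear operators\<close>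

text \<open>
  A complex normed space is represented by a space of vectors with a seminorm; vectors at distance
  \<open>0\<close> stand for the same element, so linearity of an operator is required up to null vectors.
  An operator or functional that is bounded for the seminorms then respects this identification.
\<close>

record 'v sn_space =
  sn_vecs :: "'v set"
  sn_scale :: "complex \<Rightarrow> 'v \<Rightarrow> 'v"
  sn_norm :: "'v \<Rightarrow> real"

definition linear_operator ::
  "'v::ab_group_add sn_space \<Rightarrow> 'w::ab_group_add sn_space \<Rightarrow> ('v \<Rightarrow> 'w) \<Rightarrow> bool" where
  "linear_operator E F A \<longleftrightarrow>
     (\<forall>x\<in>sn_vecs E. A x \<in> sn_vecs F) \<and>
     (\<forall>x\<in>sn_vecs E. \<forall>y\<in>sn_vecs E. sn_norm F (A (x + y) - (A x + A y)) = 0) \<and>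
     (\<forall>c. \<forall>x\<in>sn_vecs E. sn_norm F (A (sn_scale E c x) - sn_scale F c (A x)) = 0)"

definition bounded_operator ::
  "'v::ab_group_add sn_space \<Rightarrow> 'w::ab_group_add sn_space \<Rightarrow> ('v \<Rightarrow> 'w) \<Rightarrow> bool" where
  "bounded_operator E F A \<longleftrightarrow>
     linear_operator E F A \<and> (\<exists>C. \<forall>x\<in>sn_vecs E. sn_norm F (A x) \<le> C * sn_norm E x)"

definition sn_dual :: "'v::ab_group_add sn_space \<Rightarrow> ('v \<Rightarrow> complex) set" where
  "sn_dual E = {\<phi>.
     (\<forall>x\<in>sn_vecs E. \<forall>y\<in>sn_vecs E. \<phi> (x + y) = \<phi> x + \<phi> y) \<and>
     (\<forall>c. \<forall>x\<in>sn_vecs E. \<phi> (sn_scale E c x) = c * \<phi> x) \<and>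
     (\<exists>C. \<forall>x\<in>sn_vecs E. cmod (\<phi> x) \<le> C * sn_norm E x)}"

definition dual_norm :: "'v sn_space \<Rightarrow> ('v \<Rightarrow> complex) \<Rightarrow> real" where
  "dual_norm E \<phi> = (SUP x\<in>{x \<in> sn_vecs E. sn_norm E x \<le> 1}. cmod (\<phi> x))"

definition r_nuclear ::
  "real \<Rightarrow> 'v::ab_group_add sn_space \<Rightarrow> 'w::ab_group_add sn_space \<Rightarrow> ('v \<Rightarrow> 'w) \<Rightarrow> bool" where
  "r_nuclear r E F A \<longleftrightarrow> linear_operator E F A \<and>
     (\<exists>\<phi> y. (\<forall>k. \<phi> k \<in> sn_dual E) \<and> (\<forall>k. y k \<in> sn_vecs F) \<and>
        (\<forall>x\<in>sn_vecs E.
           (\<lambda>N. sn_norm F (A x - (\<Sum>k<N. sn_scale F (\<phi> k x) (y k)))) \<longlonglongrightarrow> 0) \<and>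
        summable (\<lambda>k::nat. dual_norm E (\<phi> k) powr r * sn_norm F (y k) powr r))"

definition L2 :: "'a measure \<Rightarrow> ('a \<Rightarrow> complex) sn_space" where
  "L2 M = \<lparr>
     sn_vecs = {f \<in> borel_measurable M. integrable M (\<lambda>x. (cmod (f x))\<^sup>2)},
     sn_scale = (\<lambda>c f x. c * f x),
     sn_norm = (\<lambda>f. sqrt (LINT x|M. (cmod (f x))\<^sup>2)) \<rparr>"


section \<open>Schatten quasi-norms of matrices\<close>

definition unitary_mat :: "nat \<Rightarrow> complex mat \<Rightarrow> bool" where
  "unitary_mat d U \<longleftrightarrow> U \<in> carrier_mat d d \<and> mat_adjoint U * U = 1\<^sub>m d"

definition mat_trace :: "complex mat \<Rightarrow> complex" where
  "mat_trace M = (\<Sum>i<dim_row M. M $$ (i, i))"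

text \<open>\<open>P\<^sup>s\<close> for a positive semidefinite matrix \<open>P\<close> and \<open>s > 0\<close>, by functional calculus: the result
  does not depend on the unitary diagonalisation \<open>P = U diag(l) U\<^sup>*\<close>.\<close>

definition psd_powr :: "complex mat \<Rightarrow> real \<Rightarrow> complex mat" where
  "psd_powr P s = (THE Q. \<exists>U l. unitary_mat (dim_row P) U \<and> (\<forall>i<dim_row P. 0 \<le> l i) \<and>
     P = U * mat_diag (dim_row P) (\<lambda>i. complex_of_real (l i)) * mat_adjoint U \<and>
     Q = U * mat_diag (dim_row P) (\<lambda>i. complex_of_real (l i powr s)) * mat_adjoint U)"

definition mat_abs :: "complex mat \<Rightarrow> complex mat" where
  "mat_abs M = psd_powr (mat_adjoint M * M) (1 / 2)"

definition schatten_norm :: "real \<Rightarrow> complex mat \<Rightarrow> real" where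
  "schatten_norm r M = Re (mat_trace (psd_powr (mat_abs M) r)) powr (1 / r)"


section \<open>The unitary dual and matrix-valued symbols\<close>

text \<open>Irreducible unitary representations of a compact group are finite-dimensional, so, after the
  choice of an orthonormal basis, they are matrix representations. Values off \<^term>\<open>carrier G\<close> are
  irrelevant.\<close>

definition rep_dim :: "('a, 'b) monoid_scheme \<Rightarrow> ('a \<Rightarrow> complex mat) \<Rightarrow> nat" where
  "rep_dim G \<xi> = dim_row (\<xi> \<one>\<^bsub>G\<^esub>)"

definition unitary_rep ::
  "('a, 'b) monoid_scheme \<Rightarrow> 'a topology \<Rightarrow> ('a \<Rightarrow> complex mat) \<Rightarrow> bool" where
  "unitary_rep G T \<xi> \<longleftrightarrow>
     (\<forall>x\<in>carrier G. unitary_mat (rep_dim G \<xi>) (\<xi> x)) \<and>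
     (\<forall>x\<in>carrier G. \<forall>y\<in>carrier G. \<xi> (x \<otimes>\<^bsub>G\<^esub> y) = \<xi> x * \<xi> y) \<and>
     (\<forall>i<rep_dim G \<xi>. \<forall>j<rep_dim G \<xi>. continuous_map T euclidean (\<lambda>x. \<xi> x $$ (i, j)))"

definition irreducible_rep :: "('a, 'b) monoid_scheme \<Rightarrow> ('a \<Rightarrow> complex mat) \<Rightarrow> bool" where
  "irreducible_rep G \<xi> \<longleftrightarrow> rep_dim G \<xi> > 0 \<and>
     (\<forall>W. subspace class_ring W (module_vec TYPE(complex) (rep_dim G \<xi>)) \<longrightarrow>
          (\<forall>x\<in>carrier G. \<forall>w\<in>W. \<xi> x *\<^sub>v w \<in> W) \<longrightarrow>
          W = {0\<^sub>v (rep_dim G \<xi>)} \<or> W = carrier_vec (rep_dim G \<xi>))"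

definition rep_equiv ::
  "('a, 'b) monoid_scheme \<Rightarrow> ('a \<Rightarrow> complex mat) \<Rightarrow> ('a \<Rightarrow> complex mat) \<Rightarrow> bool" where
  "rep_equiv G \<xi> \<eta> \<longleftrightarrow> rep_dim G \<xi> = rep_dim G \<eta> \<and>
     (\<exists>U. unitary_mat (rep_dim G \<xi>) U \<and> (\<forall>x\<in>carrier G. U * \<xi> x = \<eta> x * U))"

definition unitary_irreps ::
  "('a, 'b) monoid_scheme \<Rightarrow> 'a topology \<Rightarrow> ('a \<Rightarrow> complex mat) set" where
  "unitary_irreps G T = {\<xi>. unitary_rep G T \<xi> \<and> irreducible_rep G \<xi>}"

definition unitary_dual ::
  "('a, 'b) monoid_scheme \<Rightarrow> 'a topology \<Rightarrow> ('a \<Rightarrow> complex mat) set set" where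
  "unitary_dual G T = unitary_irreps G T //
     {(\<xi>, \<eta>) \<in> unitary_irreps G T \<times> unitary_irreps G T. rep_equiv G \<xi> \<eta>}"

text \<open>\<open>\<sigma>\<^sub>A(x,\<xi>) = \<xi>(x)\<^sup>* (A\<xi>)(x)\<close>. Since \<open>A\<xi>\<^sub>i\<^sub>j\<close> is an element of \<open>L\<^sup>2\<close>, the symbol of an operator on
  \<open>L\<^sup>2\<close> is determined for almost every \<open>x\<close> only.\<close>

definition symbol ::
  "('a, 'b) monoid_scheme \<Rightarrow> (('a \<Rightarrow> complex) \<Rightarrow> 'a \<Rightarrow> complex) \<Rightarrow> 'a \<Rightarrow> ('a \<Rightarrow> complex mat) \<Rightarrow> complex mat" where
  "symbol G A x \<xi> = mat_adjoint (\<xi> x) *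
     mat (rep_dim G \<xi>) (rep_dim G \<xi>) (\<lambda>(i, j). A (\<lambda>y. \<xi> y $$ (i, j)) x)"

end

theory Submission
  imports Defs "HOL-Complex_Analysis.Great_Picard" "Jordan_Normal_Form.Spectral_Radius"
begin

text \<open>
  The operator acts on the matrix coefficients of an irreducible representation \<open>\<xi>\<close> of dimension \<open>d\<close> by
  \<open>A \<xi> = \<xi> \<sigma>\<close>.  Let \<open>v\<^sub>1, \<dots>, v\<^sub>d\<close> be an orthonormal basis of eigenvectors of \<open>\<sigma>\<^sup>* \<sigma>\<close>; then \<open>s\<^sub>j = |\<sigma> v\<^sub>j|\<close> are the
  singular values of \<open>\<sigma>\<close>.  By Schur orthogonality the contribution of \<open>\<xi>\<close> to \<open>A f\<close> is the sum over \<open>i\<close> and \<open>j\<close> of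
  \<open>d \<langle>f, (\<xi> v\<^sub>j)\<^sub>i\<rangle> (\<xi> \<sigma> v\<^sub>j)\<^sub>i\<close>, and the norms of the two functions are \<open>d\<^sup>-\<^sup>1\<^sup>/\<^sup>2\<close> and \<open>d\<^sup>-\<^sup>1\<^sup>/\<^sup>2 s\<^sub>j\<close>.  Each of these
  rank one terms therefore has size \<open>s\<^sub>j\<close>, and since every \<open>j\<close> occurs with \<open>d\<close> rows \<open>i\<close>, their \<open>r\<close>-th powers add up to
  \<open>d \<Sum>\<^sub>j s\<^sub>j\<^sup>r\<close>, which is \<open>d\<close> times the \<open>r\<close>-th power of the Schatten quasi-norm of \<open>\<sigma>\<close>
  (\<open>r_nuclear_of_summable_symbol\<close>).

  The series so obtained represents \<open>A\<close> on all matrix coefficients.  As \<open>r \<le> 1\<close>, it converges absolutely in operator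
  norm, so it represents \<open>A\<close> on the closed span of the coefficients (\<open>r_nuclear_criterion\<close>).  This closed span is the
  whole space by the Peter--Weyl theorem (\<open>Peter_Weyl_density\<close>) and by the density of the continuous functions
  (\<open>continuous_functions_total\<close>).

  The Peter--Weyl theorem rests on convolution with a symmetric kernel, a compact self-adjoint operator that
  commutes with left translations and preserves the span \<open>E\<close> of all coefficients.  If some
  nonzero continuous function were orthogonal to \<open>E\<close>, the operator would have an eigenvector among these functions
  (\<open>compact_selfadjoint_eigenvector\<close>), with a finite-dimensional left-invariant eigenspace.  An invariant subspace of
  minimal dimension carries an irreducible unitary representation, and evaluation at the unit element shows that it
  consists of matrix coefficients, a contradiction (\<open>coeff_perp_trivial\<close>).  Now let \<open>e\<^sub>n\<close> be a minimising
  sequence for the distance of \<open>f\<close> to \<open>E\<close>.  The convolutions of \<open>f - e\<^sub>n\<close> converge uniformly to a continuous function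
  orthogonal to \<open>E\<close>, that is, to \<open>0\<close>; hence \<open>E\<close> approximates the convolutions of \<open>f\<close>, and these approximate \<open>f\<close>.
\<close>

section \<open>Square-integrable functions\<close>

abbreviation l2 :: "'a measure \<Rightarrow> ('a \<Rightarrow> complex) set" where
  "l2 M \<equiv> sn_vecs (L2 M)"

abbreviation l2_norm :: "'a measure \<Rightarrow> ('a \<Rightarrow> complex) \<Rightarrow> real" where
  "l2_norm M \<equiv> sn_norm (L2 M)"

definition l2_inner :: "'a measure \<Rightarrow> ('a \<Rightarrow> complex) \<Rightarrow> ('a \<Rightarrow> complex) \<Rightarrow> complex" where
  "l2_inner M f g = (LINT x|M. f x * cnj (g x))"

lemma l2_iff: "f \<in> l2 M \<longleftrightarrow> f \<in> borel_measurable M \<and> integrable M (\<lambda>x. (cmod (f x))\<^sup>2)"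
  by (simp add: L2_def)

lemma l2_norm_eq: "l2_norm M f = sqrt (LINT x|M. (cmod (f x))\<^sup>2)"
  by (simp add: L2_def)

lemma l2_measurable [measurable_dest]: "f \<in> l2 M \<Longrightarrow> f \<in> borel_measurable M"
  by (simp add: l2_iff)

lemma l2_norm_nonneg [simp]: "0 \<le> l2_norm M f"
  by (simp add: l2_norm_eq)

lemma l2_norm_sq: "(l2_norm M f)\<^sup>2 = (LINT x|M. (cmod (f x))\<^sup>2)"
  by (simp add: l2_norm_eq)

lemma l2_norm_minus_commute: "l2_norm M (\<lambda>x. f x - g x) = l2_norm M (\<lambda>x. g x - f x)"
  by (simp add: l2_norm_eq norm_minus_commute)

lemma l2_integrable_mult:
  assumes "f \<in> l2 M" "g \<in> l2 M"
  shows "integrable M (\<lambda>x. f x * cnj (g x))"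
proof (rule Bochner_Integration.integrable_bound)
  show "integrable M (\<lambda>x. (cmod (f x))\<^sup>2 + (cmod (g x))\<^sup>2)"
    using assms by (auto simp: l2_iff)
  show "(\<lambda>x. f x * cnj (g x)) \<in> borel_measurable M"
    using assms by (auto simp: l2_iff intro!: borel_measurable_times borel_measurable_continuous_on [of cnj] continuous_intros)
  show "AE x in M. cmod (f x * cnj (g x)) \<le> norm ((cmod (f x))\<^sup>2 + (cmod (g x))\<^sup>2)"
  proof (rule AE_I2)
    fix x
    have "2 * (cmod (f x) * cmod (g x)) \<le> (cmod (f x))\<^sup>2 + (cmod (g x))\<^sup>2"
      using sum_squares_bound[of "cmod (f x)" "cmod (g x)"] by (simp add: mult.assoc)
    moreover have "0 \<le> cmod (f x) * cmod (g x)" by simp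
    ultimately have "cmod (f x) * cmod (g x) \<le> (cmod (f x))\<^sup>2 + (cmod (g x))\<^sup>2" by linarith
    then show "cmod (f x * cnj (g x)) \<le> norm ((cmod (f x))\<^sup>2 + (cmod (g x))\<^sup>2)"
      by (simp add: norm_mult)
  qed
qed

lemma l2_lincomb:
  assumes f: "f \<in> l2 M" and g: "g \<in> l2 M"
  shows "(\<lambda>x. a * f x + b * g x) \<in> l2 M"
proof -
  have meas: "(\<lambda>x. a * f x + b * g x) \<in> borel_measurable M"
    using f g by (auto simp: l2_iff)
  have "integrable M (\<lambda>x. (cmod (a * f x + b * g x))\<^sup>2)"
  proof (rule Bochner_Integration.integrable_bound)
    show "integrable M (\<lambda>x. 2 * (cmod a)\<^sup>2 * (cmod (f x))\<^sup>2 + 2 * (cmod b)\<^sup>2 * (cmod (g x))\<^sup>2)"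
      using f g by (auto simp: l2_iff)
    show "(\<lambda>x. (cmod (a * f x + b * g x))\<^sup>2) \<in> borel_measurable M"
      using meas by measurable
    show "AE x in M. norm ((cmod (a * f x + b * g x))\<^sup>2)
        \<le> norm (2 * (cmod a)\<^sup>2 * (cmod (f x))\<^sup>2 + 2 * (cmod b)\<^sup>2 * (cmod (g x))\<^sup>2)"
    proof (rule AE_I2)
      fix x
      have "(cmod (a * f x + b * g x))\<^sup>2 \<le> (cmod (a * f x) + cmod (b * g x))\<^sup>2"
        by (intro power_mono norm_triangle_ineq) auto
      also have "\<dots> \<le> 2 * (cmod (a * f x))\<^sup>2 + 2 * (cmod (b * g x))\<^sup>2"
        using sum_squares_bound[of "cmod (a * f x)" "cmod (b * g x)"] by (simp add: power2_sum)
      also have "\<dots> = 2 * (cmod a)\<^sup>2 * (cmod (f x))\<^sup>2 + 2 * (cmod b)\<^sup>2 * (cmod (g x))\<^sup>2"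
        by (simp add: norm_mult power_mult_distrib)
      finally show "norm ((cmod (a * f x + b * g x))\<^sup>2)
        \<le> norm (2 * (cmod a)\<^sup>2 * (cmod (f x))\<^sup>2 + 2 * (cmod b)\<^sup>2 * (cmod (g x))\<^sup>2)"
        by simp
    qed
  qed
  with meas show ?thesis by (simp add: l2_iff)
qed

lemma l2_zero [simp]: "(\<lambda>x. 0) \<in> l2 M"
  by (simp add: l2_iff)

lemma l2_add: "f \<in> l2 M \<Longrightarrow> g \<in> l2 M \<Longrightarrow> (\<lambda>x. f x + g x) \<in> l2 M"
  using l2_lincomb[of f M g 1 1] by simp

lemma l2_diff: "f \<in> l2 M \<Longrightarrow> g \<in> l2 M \<Longrightarrow> (\<lambda>x. f x - g x) \<in> l2 M"
  using l2_lincomb[of f M g 1 "-1"] by simp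

lemma l2_scale: "f \<in> l2 M \<Longrightarrow> (\<lambda>x. c * f x) \<in> l2 M"
  using l2_lincomb[of f M f c 0] by simp

lemma l2_sum: "(\<And>i. i \<in> I \<Longrightarrow> f i \<in> l2 M) \<Longrightarrow> (\<lambda>x. \<Sum>i\<in>I. f i x) \<in> l2 M"
  by (induction I rule: infinite_finite_induct) (auto intro: l2_add)

lemma l2_inner_commute: "l2_inner M g f = cnj (l2_inner M f g)"
  unfolding l2_inner_def Bochner_Integration.integral_cnj[symmetric] by (simp add: mult.commute)

lemma l2_inner_self: "l2_inner M f f = of_real ((l2_norm M f)\<^sup>2)"
  unfolding l2_inner_def l2_norm_sq integral_complex_of_real[symmetric] complex_norm_square[symmetric]
  by simp

lemma l2_inner_lincomb_left:
  assumes "f \<in> l2 M" "g \<in> l2 M" "h \<in> l2 M"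
  shows "l2_inner M (\<lambda>x. a * f x + b * g x) h = a * l2_inner M f h + b * l2_inner M g h"
proof -
  have "l2_inner M (\<lambda>x. a * f x + b * g x) h = (LINT x|M. a * (f x * cnj (h x)) + b * (g x * cnj (h x)))"
    by (simp add: l2_inner_def algebra_simps)
  also have "\<dots> = a * l2_inner M f h + b * l2_inner M g h"
    using assms by (simp add: l2_inner_def l2_integrable_mult)
  finally show ?thesis .
qed

lemma l2_inner_add_left:
  "f \<in> l2 M \<Longrightarrow> g \<in> l2 M \<Longrightarrow> h \<in> l2 M \<Longrightarrow>
   l2_inner M (\<lambda>x. f x + g x) h = l2_inner M f h + l2_inner M g h"
  using l2_inner_lincomb_left[of f M g h 1 1] by simp

lemma l2_inner_diff_left:
  "f \<in> l2 M \<Longrightarrow> g \<in> l2 M \<Longrightarrow> h \<in> l2 M \<Longrightarrow>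
   l2_inner M (\<lambda>x. f x - g x) h = l2_inner M f h - l2_inner M g h"
  using l2_inner_lincomb_left[of f M g h 1 "-1"] by simp

lemma l2_inner_scale_left [simp]: "l2_inner M (\<lambda>x. c * f x) h = c * l2_inner M f h"
  by (simp add: l2_inner_def mult.assoc)

lemma l2_inner_scale_right [simp]: "l2_inner M h (\<lambda>x. c * f x) = cnj c * l2_inner M h f"
  by (subst (1 2) l2_inner_commute) simp

lemma l2_inner_diff_right:
  "f \<in> l2 M \<Longrightarrow> g \<in> l2 M \<Longrightarrow> h \<in> l2 M \<Longrightarrow>
   l2_inner M h (\<lambda>x. f x - g x) = l2_inner M h f - l2_inner M h g"
  by (subst (1 2 3) l2_inner_commute) (simp add: l2_inner_diff_left)

lemma l2_inner_zero_left [simp]: "l2_inner M (\<lambda>x. 0) h = 0"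
  by (simp add: l2_inner_def)

lemma l2_inner_zero_right [simp]: "l2_inner M h (\<lambda>x. 0) = 0"
  by (simp add: l2_inner_def)

lemma l2_inner_sum_left:
  assumes "\<And>i. i \<in> I \<Longrightarrow> f i \<in> l2 M" "h \<in> l2 M"
  shows "l2_inner M (\<lambda>x. \<Sum>i\<in>I. f i x) h = (\<Sum>i\<in>I. l2_inner M (f i) h)"
  using assms
  by (induction I rule: infinite_finite_induct) (auto simp: l2_inner_add_left l2_sum)

lemma l2_inner_sum_right:
  assumes "\<And>i. i \<in> I \<Longrightarrow> f i \<in> l2 M" "h \<in> l2 M"
  shows "l2_inner M h (\<lambda>x. \<Sum>i\<in>I. f i x) = (\<Sum>i\<in>I. l2_inner M h (f i))"
  by (subst l2_inner_commute)
     (simp add: l2_inner_sum_left assms flip: l2_inner_commute[of M h])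

lemma l2_norm_scale: "l2_norm M (\<lambda>x. c * f x) = cmod c * l2_norm M f"
  by (simp add: l2_norm_eq norm_mult power_mult_distrib real_sqrt_mult)

lemma l2_norm_zero [simp]: "l2_norm M (\<lambda>x. 0) = 0"
  by (simp add: l2_norm_eq)

lemma l2_norm_diff_sq:
  assumes "f \<in> l2 M" "g \<in> l2 M"
  shows "(l2_norm M (\<lambda>x. f x - g x))\<^sup>2 = (l2_norm M f)\<^sup>2 + (l2_norm M g)\<^sup>2 - 2 * Re (l2_inner M f g)"
proof -
  have "of_real ((l2_norm M (\<lambda>x. f x - g x))\<^sup>2) =
      l2_inner M f f - l2_inner M f g - (l2_inner M g f - l2_inner M g g)"
    unfolding l2_inner_self[symmetric] using assms
    by (simp add: l2_inner_diff_left l2_inner_diff_right l2_diff)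
  also have "\<dots> = of_real ((l2_norm M f)\<^sup>2 + (l2_norm M g)\<^sup>2 - 2 * Re (l2_inner M f g))"
    by (simp add: l2_inner_commute[of M g f] l2_inner_self complex_eq_iff)
  finally show ?thesis using of_real_eq_iff by blast
qed

lemma l2_Cauchy_Schwarz:
  assumes f: "f \<in> l2 M" and g: "g \<in> l2 M"
  shows "cmod (l2_inner M f g) \<le> l2_norm M f * l2_norm M g"
proof -
  let ?a = "(l2_norm M f)\<^sup>2" and ?b = "(l2_norm M g)\<^sup>2" and ?c = "l2_inner M f g"
  have ineq: "0 \<le> ?a + t\<^sup>2 * (cmod ?c)\<^sup>2 * ?b - 2 * t * (cmod ?c)\<^sup>2" for t :: real
  proof -
    have "0 \<le> (l2_norm M (\<lambda>x. f x - (of_real t * ?c) * g x))\<^sup>2" by simp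
    also have "\<dots> = ?a + (l2_norm M (\<lambda>x. (of_real t * ?c) * g x))\<^sup>2
        - 2 * Re (cnj (of_real t * ?c) * ?c)"
      using l2_norm_diff_sq[OF f l2_scale[OF g]] by simp
    also have "cnj (of_real t * ?c) * ?c = of_real (t * (cmod ?c)\<^sup>2)"
      unfolding of_real_mult complex_norm_square by simp
    finally show ?thesis
      by (simp add: l2_norm_scale norm_mult power_mult_distrib)
  qed
  have "(cmod ?c)\<^sup>2 \<le> ?a * ?b"
  proof (cases "?b = 0")
    case True
    have "(cmod ?c)\<^sup>2 = 0"
    proof (rule ccontr)
      assume nz: "(cmod ?c)\<^sup>2 \<noteq> 0"
      have "0 \<le> ?a - 2 * ((?a + 1) / (cmod ?c)\<^sup>2) * (cmod ?c)\<^sup>2"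
        using ineq[of "(?a + 1) / (cmod ?c)\<^sup>2"] True by simp
      also have "2 * ((?a + 1) / (cmod ?c)\<^sup>2) * (cmod ?c)\<^sup>2 = 2 * (?a + 1)" using nz by simp
      finally have "0 \<le> - ?a - 2" by simp
      then show False using zero_le_power2[of "l2_norm M f"] by linarith
    qed
    then show ?thesis by simp
  next
    case False
    then have b: "?b > 0" by simp
    have "0 \<le> ?b * (?a + (1 / ?b)\<^sup>2 * (cmod ?c)\<^sup>2 * ?b - 2 * (1 / ?b) * (cmod ?c)\<^sup>2)"
      by (intro mult_nonneg_nonneg ineq order_less_imp_le[OF b])
    also have "\<dots> = ?a * ?b - (cmod ?c)\<^sup>2"
      using False by (simp add: field_simps power2_eq_square)
    finally show ?thesis by simp
  qed
  then have "(cmod ?c)\<^sup>2 \<le> (l2_norm M f * l2_norm M g)\<^sup>2"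
    by (simp add: power_mult_distrib)
  then show ?thesis by (rule power2_le_imp_le) simp
qed

lemma l2_norm_diff_triangle:
  assumes f: "f \<in> l2 M" and g: "g \<in> l2 M"
  shows "l2_norm M (\<lambda>x. f x - g x) \<le> l2_norm M f + l2_norm M g"
proof (rule power2_le_imp_le)
  have "\<bar>Re (l2_inner M f g)\<bar> \<le> l2_norm M f * l2_norm M g"
    using l2_Cauchy_Schwarz[OF f g] abs_Re_le_cmod order_trans by blast
  then show "(l2_norm M (\<lambda>x. f x - g x))\<^sup>2 \<le> (l2_norm M f + l2_norm M g)\<^sup>2"
    by (simp add: l2_norm_diff_sq[OF f g] power2_sum)
qed simp

lemma l2_norm_triangle:
  assumes f: "f \<in> l2 M" and g: "g \<in> l2 M"
  shows "l2_norm M (\<lambda>x. f x + g x) \<le> l2_norm M f + l2_norm M g"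
  using l2_norm_diff_triangle[OF f l2_scale[OF g, of "-1"]] l2_norm_scale[of M "-1" g] by simp

lemma l2_dist_triangle:
  assumes f: "f \<in> l2 M" and g: "g \<in> l2 M" and h: "h \<in> l2 M"
  shows "l2_norm M (\<lambda>x. f x - h x) \<le> l2_norm M (\<lambda>x. f x - g x) + l2_norm M (\<lambda>x. g x - h x)"
  using l2_norm_triangle[OF l2_diff[OF f g] l2_diff[OF g h]] by simp

lemma l2_norm_diff_abs:
  assumes f: "f \<in> l2 M" and g: "g \<in> l2 M"
  shows "\<bar>l2_norm M f - l2_norm M g\<bar> \<le> l2_norm M (\<lambda>x. f x - g x)"
  using l2_dist_triangle[OF f g l2_zero] l2_dist_triangle[OF g f l2_zero] l2_norm_minus_commute[of M f g]
  by simp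

lemma l2_norm_sum:
  assumes "\<And>i. i \<in> I \<Longrightarrow> f i \<in> l2 M"
  shows "l2_norm M (\<lambda>x. \<Sum>i\<in>I. f i x) \<le> (\<Sum>i\<in>I. l2_norm M (f i))"
  using assms
proof (induction I rule: infinite_finite_induct)
  case (insert a I)
  have "l2_norm M (\<lambda>x. f a x + (\<Sum>i\<in>I. f i x)) \<le> l2_norm M (f a) + l2_norm M (\<lambda>x. \<Sum>i\<in>I. f i x)"
    using insert by (intro l2_norm_triangle l2_sum) auto
  then show ?case using insert by simp
qed auto

lemma l2_norm_eq_0_iff:
  assumes "f \<in> l2 M"
  shows "l2_norm M f = 0 \<longleftrightarrow> (AE x in M. f x = 0)"
  using assms integral_nonneg_eq_0_iff_AE[of M "\<lambda>x. (cmod (f x))\<^sup>2"] by (simp add: l2_iff l2_norm_eq)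

lemma l2_inner_tendsto_left:
  assumes f: "\<And>n::nat. f n \<in> l2 M" and g: "g \<in> l2 M" and h: "h \<in> l2 M"
    and lim: "(\<lambda>n. l2_norm M (\<lambda>x. f n x - g x)) \<longlonglongrightarrow> 0"
  shows "(\<lambda>n. l2_inner M (f n) h) \<longlonglongrightarrow> l2_inner M g h"
proof (rule Lim_transform2[of "\<lambda>n. l2_inner M g h"])
  show "(\<lambda>n. l2_inner M g h - l2_inner M (f n) h) \<longlonglongrightarrow> 0"
  proof (rule Lim_null_comparison)
    show "\<forall>\<^sub>F n in sequentially. cmod (l2_inner M g h - l2_inner M (f n) h)
        \<le> l2_norm M (\<lambda>x. f n x - g x) * l2_norm M h"
      using l2_Cauchy_Schwarz[OF l2_diff[OF f g] h]
      by (intro always_eventually) (simp add: l2_inner_diff_left f g h norm_minus_commute)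
    show "(\<lambda>n. l2_norm M (\<lambda>x. f n x - g x) * l2_norm M h) \<longlonglongrightarrow> 0"
      using tendsto_mult_right[OF lim] by simp
  qed
qed simp

lemma l2_norm_tendsto:
  assumes f: "\<And>n::nat. f n \<in> l2 M" and g: "g \<in> l2 M"
    and lim: "(\<lambda>n. l2_norm M (\<lambda>x. f n x - g x)) \<longlonglongrightarrow> 0"
  shows "(\<lambda>n. l2_norm M (f n)) \<longlonglongrightarrow> l2_norm M g"
proof (rule Lim_transform2[of "\<lambda>n. l2_norm M g"])
  show "(\<lambda>n. l2_norm M g - l2_norm M (f n)) \<longlonglongrightarrow> 0"
    by (rule Lim_null_comparison[OF _ lim])
       (use l2_norm_diff_abs[OF f g] in \<open>auto simp: abs_minus_commute intro!: always_eventually\<close>)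
qed simp

lemma (in finite_measure) bounded_imp_l2:
  assumes f: "f \<in> borel_measurable M" and B: "\<And>x. x \<in> space M \<Longrightarrow> cmod (f x) \<le> B"
  shows "f \<in> l2 M" "(l2_norm M f)\<^sup>2 \<le> B\<^sup>2 * measure M (space M)"
proof -
  have b: "(cmod (f x))\<^sup>2 \<le> B\<^sup>2" if "x \<in> space M" for x
    using B[OF that] by (intro power_mono) auto
  have int: "integrable M (\<lambda>x. (cmod (f x))\<^sup>2)"
    using f b by (intro integrable_const_bound[of _ "B\<^sup>2"]) auto
  then show "f \<in> l2 M" using f by (simp add: l2_iff)
  have "(l2_norm M f)\<^sup>2 \<le> (LINT x|M. B\<^sup>2)"
    unfolding l2_norm_sq using int b by (intro integral_mono) auto
  then show "(l2_norm M f)\<^sup>2 \<le> B\<^sup>2 * measure M (space M)" by (simp add: mult.commute)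
qed

section \<open>Orthonormal families\<close>

definition orthonormal :: "'a measure \<Rightarrow> nat \<Rightarrow> (nat \<Rightarrow> 'a \<Rightarrow> complex) \<Rightarrow> bool" where
  "orthonormal M d e \<longleftrightarrow> (\<forall>i<d. e i \<in> l2 M) \<and>
     (\<forall>i<d. \<forall>j<d. l2_inner M (e i) (e j) = (if i = j then 1 else 0))"

definition l2_proj :: "'a measure \<Rightarrow> nat \<Rightarrow> (nat \<Rightarrow> 'a \<Rightarrow> complex) \<Rightarrow> ('a \<Rightarrow> complex) \<Rightarrow> 'a \<Rightarrow> complex" where
  "l2_proj M d e f x = (\<Sum>i<d. l2_inner M f (e i) * e i x)"

lemma orthonormal_l2: "orthonormal M d e \<Longrightarrow> i < d \<Longrightarrow> e i \<in> l2 M"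
  by (simp add: orthonormal_def)

lemma orthonormal_inner:
  "orthonormal M d e \<Longrightarrow> i < d \<Longrightarrow> j < d \<Longrightarrow> l2_inner M (e i) (e j) = (if i = j then 1 else 0)"
  by (simp add: orthonormal_def)

lemma orthonormal_inner_sum_left:
  assumes e: "orthonormal M d e" and j: "j < d"
  shows "l2_inner M (\<lambda>x. \<Sum>i<d. a i * e i x) (e j) = a j"
proof -
  have "l2_inner M (\<lambda>x. \<Sum>i<d. a i * e i x) (e j) = (\<Sum>i<d. a i * l2_inner M (e i) (e j))"
    using e j by (subst l2_inner_sum_left) (auto intro: l2_scale orthonormal_l2)
  also have "\<dots> = (\<Sum>i<d. if i = j then a i else 0)"
    using e j by (intro sum.cong) (auto simp: orthonormal_inner)
  finally show ?thesis using j by simp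
qed

lemma orthonormal_inner_sums:
  assumes e: "orthonormal M d e"
  shows "l2_inner M (\<lambda>x. \<Sum>i<d. a i * e i x) (\<lambda>x. \<Sum>i<d. b i * e i x) = (\<Sum>i<d. a i * cnj (b i))"
proof -
  have l: "(\<lambda>x. \<Sum>i<d. a i * e i x) \<in> l2 M"
    using e by (intro l2_sum l2_scale) (auto intro: orthonormal_l2)
  have "l2_inner M (\<lambda>x. \<Sum>i<d. a i * e i x) (\<lambda>x. \<Sum>i<d. b i * e i x) =
      (\<Sum>j<d. cnj (b j) * l2_inner M (\<lambda>x. \<Sum>i<d. a i * e i x) (e j))"
    using e by (subst l2_inner_sum_right) (auto intro: l2_scale orthonormal_l2 l)
  also have "\<dots> = (\<Sum>i<d. a i * cnj (b i))"
    using e by (intro sum.cong) (auto simp: orthonormal_inner_sum_left)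
  finally show ?thesis .
qed

lemma l2_proj_l2: "orthonormal M d e \<Longrightarrow> l2_proj M d e f \<in> l2 M"
  unfolding l2_proj_def by (intro l2_sum l2_scale) (auto intro: orthonormal_l2)

lemma l2_proj_residual_orthogonal:
  assumes e: "orthonormal M d e" and f: "f \<in> l2 M" and j: "j < d"
  shows "l2_inner M (\<lambda>x. f x - l2_proj M d e f x) (e j) = 0"
proof -
  have "l2_inner M (l2_proj M d e f) (e j) = l2_inner M f (e j)"
    unfolding l2_proj_def using orthonormal_inner_sum_left[OF e j] by simp
  then show ?thesis
    using l2_inner_diff_left[OF f l2_proj_l2[OF e] orthonormal_l2[OF e j]] by simp
qed

lemma l2_proj_residual_norm:
  assumes e: "orthonormal M d e" and f: "f \<in> l2 M"
  shows "(l2_norm M (\<lambda>x. f x - l2_proj M d e f x))\<^sup>2 =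
    (l2_norm M f)\<^sup>2 - (\<Sum>i<d. (cmod (l2_inner M f (e i)))\<^sup>2)"
proof -
  let ?s = "\<Sum>i<d. (cmod (l2_inner M f (e i)))\<^sup>2"
  have "l2_inner M f (l2_proj M d e f) = (\<Sum>i<d. cnj (l2_inner M f (e i)) * l2_inner M f (e i))"
    unfolding l2_proj_def using e f
    by (subst l2_inner_sum_right) (auto intro: l2_scale orthonormal_l2)
  also have "\<dots> = of_real ?s"
    unfolding of_real_sum complex_norm_square by (simp add: mult.commute)
  finally have 1: "Re (l2_inner M f (l2_proj M d e f)) = ?s" by simp
  have "of_real ((l2_norm M (l2_proj M d e f))\<^sup>2) = (\<Sum>i<d. l2_inner M f (e i) * cnj (l2_inner M f (e i)))"
    unfolding l2_inner_self[symmetric] l2_proj_def using orthonormal_inner_sums[OF e] by simp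
  also have "\<dots> = of_real ?s"
    unfolding of_real_sum complex_norm_square by simp
  finally have 2: "(l2_norm M (l2_proj M d e f))\<^sup>2 = ?s" using of_real_eq_iff by blast
  show ?thesis
    using l2_norm_diff_sq[OF f l2_proj_l2[OF e]] 1 2 by simp
qed

lemma Bessel_inequality:
  assumes "orthonormal M d e" "f \<in> l2 M"
  shows "(\<Sum>i<d. (cmod (l2_inner M f (e i)))\<^sup>2) \<le> (l2_norm M f)\<^sup>2"
  using l2_proj_residual_norm[OF assms] zero_le_power2[of "l2_norm M (\<lambda>x. f x - l2_proj M d e f x)"]
  by linarith

lemma orthonormal_norm: "orthonormal M d e \<Longrightarrow> i < d \<Longrightarrow> (l2_norm M (e i))\<^sup>2 = 1"
  using orthonormal_inner[of M d e i i] l2_inner_self[of M "e i"] by (metis of_real_eq_1_iff)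

definition l2_subspace :: "'a measure \<Rightarrow> ('a \<Rightarrow> complex) set \<Rightarrow> bool" where
  "l2_subspace M S \<longleftrightarrow> S \<subseteq> l2 M \<and> (\<lambda>x. 0) \<in> S \<and>
     (\<forall>f\<in>S. \<forall>g\<in>S. \<forall>a b. (\<lambda>x. a * f x + b * g x) \<in> S)"

lemma l2_subspace_lincomb: "l2_subspace M S \<Longrightarrow> f \<in> S \<Longrightarrow> g \<in> S \<Longrightarrow> (\<lambda>x. a * f x + b * g x) \<in> S"
  by (simp add: l2_subspace_def)

lemma l2_subspace_l2: "l2_subspace M S \<Longrightarrow> f \<in> S \<Longrightarrow> f \<in> l2 M"
  by (auto simp: l2_subspace_def)

lemma l2_subspace_diff: "l2_subspace M S \<Longrightarrow> f \<in> S \<Longrightarrow> g \<in> S \<Longrightarrow> (\<lambda>x. f x - g x) \<in> S"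
  using l2_subspace_lincomb[of M S f g 1 "-1"] by simp

lemma l2_subspace_scale: "l2_subspace M S \<Longrightarrow> f \<in> S \<Longrightarrow> (\<lambda>x. c * f x) \<in> S"
  using l2_subspace_lincomb[of M S f f c 0] by simp

lemma l2_subspace_sum:
  assumes "l2_subspace M S" "\<And>i. i \<in> I \<Longrightarrow> f i \<in> S"
  shows "(\<lambda>x. \<Sum>i\<in>I. f i x) \<in> S"
  using assms(2)
proof (induction I rule: infinite_finite_induct)
  case (insert a I)
  then show ?case using l2_subspace_lincomb[OF assms(1), of "f a" "\<lambda>x. \<Sum>i\<in>I. f i x" 1 1] by simp
qed (use assms(1) in \<open>auto simp: l2_subspace_def\<close>)

lemma l2_proj_in_subspace:
  "l2_subspace M S \<Longrightarrow> (\<And>i. i < d \<Longrightarrow> e i \<in> S) \<Longrightarrow> l2_proj M d e f \<in> S"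
  unfolding l2_proj_def by (intro l2_subspace_sum l2_subspace_scale) auto

lemma orthonormal_extend:
  assumes e: "orthonormal M d e" and f: "f \<in> l2 M" "l2_norm M f \<noteq> 0"
    and orth: "\<And>i. i < d \<Longrightarrow> l2_inner M f (e i) = 0"
  shows "orthonormal M (Suc d) (e(d := \<lambda>x. of_real (1 / l2_norm M f) * f x))"
proof -
  let ?u = "\<lambda>x. of_real (1 / l2_norm M f) * f x"
  have u: "?u \<in> l2 M" using f by (intro l2_scale)
  have 1: "l2_inner M ?u (e i) = 0" "l2_inner M (e i) ?u = 0" if "i < d" for i
    using orth[OF that] l2_inner_commute[of M "e i" f]
    by (simp_all only: l2_inner_scale_left l2_inner_scale_right) simp_all
  have 2: "l2_inner M ?u ?u = 1"
    using f(2) by (simp only: l2_inner_self l2_norm_scale) (simp add: norm_divide)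
  show ?thesis
    using e u 1 2 by (auto simp: orthonormal_def less_Suc_eq)
qed

text \<open>If the sizes of orthonormal families in a subspace are bounded then a family of maximal size
  spans the subspace, since otherwise the residual of a projection would extend it.\<close>

lemma obtain_orthonormal_basis:
  assumes S: "l2_subspace M S"
    and bound: "\<And>d e. orthonormal M d e \<Longrightarrow> (\<And>i. i < d \<Longrightarrow> e i \<in> S) \<Longrightarrow> d \<le> N"
  obtains d e where "orthonormal M d e" "\<And>i. i < d \<Longrightarrow> e i \<in> S"
    "\<And>f. f \<in> S \<Longrightarrow> l2_norm M (\<lambda>x. f x - l2_proj M d e f x) = 0"
proof -
  let ?P = "\<lambda>d. \<exists>e. orthonormal M d e \<and> (\<forall>i<d. e i \<in> S)"
  have P0: "?P 0" by (simp add: orthonormal_def)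
  have bd: "\<forall>d. ?P d \<longrightarrow> d \<le> N" using bound by blast
  define d where "d = (GREATEST d. ?P d)"
  have "?P d" unfolding d_def by (rule GreatestI_nat[of ?P, OF P0]) (use bd in blast)
  then obtain e where e: "orthonormal M d e" "\<And>i. i < d \<Longrightarrow> e i \<in> S" by blast
  have max: "\<not> ?P (Suc d)"
  proof
    assume "?P (Suc d)"
    then have "Suc d \<le> d" unfolding d_def by (rule Greatest_le_nat[of ?P]) (use bd in blast)
    then show False by simp
  qed
  have "l2_norm M (\<lambda>x. f x - l2_proj M d e f x) = 0" if f: "f \<in> S" for f
  proof (rule ccontr)
    let ?h = "\<lambda>x. f x - l2_proj M d e f x"
    assume nz: "l2_norm M ?h \<noteq> 0"
    have h: "?h \<in> S" by (intro l2_subspace_diff[OF S f] l2_proj_in_subspace[OF S] e)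
    have "orthonormal M (Suc d) (e(d := \<lambda>x. of_real (1 / l2_norm M ?h) * ?h x))"
      using l2_proj_residual_orthogonal[OF e(1) l2_subspace_l2[OF S f]]
      by (intro orthonormal_extend[OF e(1) l2_subspace_l2[OF S h] nz])
    moreover have "\<forall>i<Suc d. (e(d := \<lambda>x. of_real (1 / l2_norm M ?h) * ?h x)) i \<in> S"
      using e(2) l2_subspace_scale[OF S h, of "of_real (1 / l2_norm M ?h)"]
      by (simp add: less_Suc_eq del: of_real_divide)
    ultimately show False using max by blast
  qed
  with e show thesis using that by blast
qed

text \<open>A sequence minimising the distance from \<open>f\<close> stands in for the orthogonal projection onto \<open>E\<close>.  Moving
  \<open>e\<^sub>n\<close> along \<open>h\<close> can lower the squared distance by at most the excess \<open>1 / (n + 1)\<close>, which bounds the inner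
  product of the residual with \<open>h\<close>; with \<open>h = e\<^sub>n - e\<^sub>m\<close> this makes the sequence a Cauchy sequence.\<close>

lemma minimising_sequence:
  assumes E: "l2_subspace M E" and f: "f \<in> l2 M"
  obtains e where "\<And>n::nat. e n \<in> E"
    "\<And>n h. h \<in> E \<Longrightarrow> cmod (l2_inner M (\<lambda>x. f x - e n x) h) \<le> l2_norm M h / sqrt (Suc n)"
    "\<And>n m. l2_norm M (\<lambda>x. e n x - e m x) \<le> 1 / sqrt (Suc n) + 1 / sqrt (Suc m)"
proof -
  define D where "D = (INF h\<in>E. (l2_norm M (\<lambda>x. f x - h x))\<^sup>2)"
  have ne: "E \<noteq> {}" using E by (auto simp: l2_subspace_def)
  have bdd: "bdd_below ((\<lambda>h. (l2_norm M (\<lambda>x. f x - h x))\<^sup>2) ` E)" by (rule bdd_belowI2[of _ 0]) simp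
  have "\<exists>h\<in>E. (l2_norm M (\<lambda>x. f x - h x))\<^sup>2 < D + 1 / Suc n" for n :: nat
    using cINF_less_iff[OF ne bdd, of "D + 1 / Suc n"] by (simp add: D_def)
  then obtain e where e: "\<And>n. e n \<in> E" "\<And>n. (l2_norm M (\<lambda>x. f x - e n x))\<^sup>2 < D + 1 / Suc n"
    by metis
  note l2E = l2_subspace_l2[OF E]
  have A: "cmod (l2_inner M (\<lambda>x. f x - e n x) h) \<le> l2_norm M h / sqrt (Suc n)" if h: "h \<in> E" for n h
  proof -
    let ?u = "\<lambda>x. f x - e n x" let ?c = "l2_inner M ?u h"
    have u: "?u \<in> l2 M" using f e l2E by (intro l2_diff) auto
    show ?thesis
    proof (cases "l2_norm M h = 0")
      case True
      then show ?thesis using l2_Cauchy_Schwarz[OF u l2E[OF h]] by simp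
    next
      case False
      let ?b = "(l2_norm M h)\<^sup>2"
      have b: "?b > 0" using False by simp
      define t where "t = 1 / ?b"
      have "(\<lambda>x. 1 * e n x + (of_real t * ?c) * h x) \<in> E"
        by (rule l2_subspace_lincomb[OF E e(1) h])
      then have "D \<le> (l2_norm M (\<lambda>x. f x - (1 * e n x + (of_real t * ?c) * h x)))\<^sup>2"
        unfolding D_def by (rule cINF_lower[OF bdd])
      also have "\<dots> = (l2_norm M (\<lambda>x. ?u x - (of_real t * ?c) * h x))\<^sup>2"
        by (simp add: algebra_simps)
      also have "\<dots> = (l2_norm M ?u)\<^sup>2 + (l2_norm M (\<lambda>x. (of_real t * ?c) * h x))\<^sup>2
          - 2 * Re (cnj (of_real t * ?c) * ?c)"
        using l2_norm_diff_sq[OF u l2_scale[OF l2E[OF h]]] by simp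
      also have "cnj (of_real t * ?c) * ?c = of_real (t * (cmod ?c)\<^sup>2)"
        unfolding of_real_mult complex_norm_square by simp
      also have "(l2_norm M (\<lambda>x. (of_real t * ?c) * h x))\<^sup>2 = t\<^sup>2 * (cmod ?c)\<^sup>2 * ?b"
        by (simp add: l2_norm_scale norm_mult power_mult_distrib)
      also have "t\<^sup>2 * (cmod ?c)\<^sup>2 * ?b = t * (cmod ?c)\<^sup>2"
        using b by (simp add: t_def power2_eq_square)
      finally have "D + t * (cmod ?c)\<^sup>2 \<le> (l2_norm M ?u)\<^sup>2" by simp
      with e(2)[of n] have "t * (cmod ?c)\<^sup>2 < 1 / Suc n" by linarith
      then have "(cmod ?c)\<^sup>2 \<le> ?b / Suc n"
        using b by (simp add: t_def field_simps)
      also have "\<dots> = (l2_norm M h / sqrt (Suc n))\<^sup>2"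
        by (simp add: power_divide)
      finally show ?thesis by (rule power2_le_imp_le) simp
    qed
  qed
  have B: "l2_norm M (\<lambda>x. e n x - e m x) \<le> 1 / sqrt (Suc n) + 1 / sqrt (Suc m)" for n m
  proof -
    let ?h = "\<lambda>x. e n x - e m x"
    have h: "?h \<in> E" by (intro l2_subspace_diff[OF E] e)
    have "of_real ((l2_norm M ?h)\<^sup>2) = l2_inner M (\<lambda>x. (f x - e m x) - (f x - e n x)) ?h"
      unfolding l2_inner_self[symmetric] by simp
    also have "\<dots> = l2_inner M (\<lambda>x. f x - e m x) ?h - l2_inner M (\<lambda>x. f x - e n x) ?h"
      using f l2E e h by (intro l2_inner_diff_left l2_diff) auto
    finally have "(l2_norm M ?h)\<^sup>2 = cmod (l2_inner M (\<lambda>x. f x - e m x) ?h - l2_inner M (\<lambda>x. f x - e n x) ?h)"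
      by (metis norm_of_real abs_of_nonneg zero_le_power2)
    also have "\<dots> \<le> l2_norm M ?h / sqrt (Suc m) + l2_norm M ?h / sqrt (Suc n)"
      by (intro order_trans[OF norm_triangle_ineq4] add_mono A h)
    finally have *: "l2_norm M ?h * l2_norm M ?h \<le> l2_norm M ?h * (1 / sqrt (Suc n) + 1 / sqrt (Suc m))"
      by (simp add: power2_eq_square algebra_simps)
    show ?thesis
    proof (cases "l2_norm M ?h = 0")
      case False
      then have "l2_norm M ?h > 0" using l2_norm_nonneg[of M ?h] by linarith
      with * show ?thesis by (metis mult_le_cancel_left_pos)
    qed simp
  qed
  show thesis using that[OF e(1) A B] .
qed

section \<open>Eigenvectors of compact self-adjoint operators\<close>

text \<open>The powers of \<open>K\<close> are applied to a vector outside the kernel and normalised to unit vectors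
  \<open>w\<^sub>n\<close>.  By Cauchy--Schwarz the ratios \<open>q\<^sub>n = \<parallel>K w\<^sub>n\<parallel>\<^sup>2\<close> increase to some \<open>\<mu> > 0\<close>, and then
  \<open>\<parallel>K\<^sup>2 w\<^sub>n - \<mu> w\<^sub>n\<parallel>\<^sup>2 = q\<^sub>n q\<^sub>n\<^sub>+\<^sub>1 - 2 \<mu> q\<^sub>n + \<mu>\<^sup>2\<close> tends to \<open>0\<close>; compactness turns this into an
  eigenvector of \<open>K\<^sup>2\<close>.  Since \<open>K\<^sup>2 - \<mu> = (K - \<surd>\<mu>) (K + \<surd>\<mu>)\<close>, one of \<open>\<surd>\<mu>\<close> and \<open>- \<surd>\<mu>\<close> is an
  eigenvalue of \<open>K\<close>.\<close>

lemma compact_selfadjoint_eigenvector: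
  assumes S: "l2_subspace M S"
    and KS: "\<And>f. f \<in> S \<Longrightarrow> K f \<in> S"
    and lin: "\<And>f g a b. f \<in> S \<Longrightarrow> g \<in> S \<Longrightarrow> K (\<lambda>x. a * f x + b * g x) = (\<lambda>x. a * K f x + b * K g x)"
    and sa: "\<And>f g. f \<in> S \<Longrightarrow> g \<in> S \<Longrightarrow> l2_inner M (K f) g = l2_inner M f (K g)"
    and bounded: "\<And>f. f \<in> S \<Longrightarrow> l2_norm M (K f) \<le> C * l2_norm M f"
    and cpt: "\<And>w. (\<And>n::nat. w n \<in> S \<and> l2_norm M (w n) \<le> 1) \<Longrightarrow>
      \<exists>k z. strict_mono k \<and> z \<in> S \<and> (\<lambda>n. l2_norm M (\<lambda>x. K (w (k n)) x - z x)) \<longlonglongrightarrow> 0"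
    and v: "v \<in> S" "l2_norm M (K v) \<noteq> 0"
  obtains \<nu> :: real and u where "\<nu> \<noteq> 0" "u \<in> S" "l2_norm M u \<noteq> 0"
    "l2_norm M (\<lambda>x. K u x - of_real \<nu> * u x) = 0"
proof -
  let ?n = "l2_norm M" and ?i = "l2_inner M"
  note L = l2_subspace_l2[OF S]
  have Kscale: "K (\<lambda>x. a * f x) = (\<lambda>x. a * K f x)" if "f \<in> S" for a f
    using lin[OF that that, of a 0] by simp
  have Kdiff: "K (\<lambda>x. f x - g x) = (\<lambda>x. K f x - K g x)" if "f \<in> S" "g \<in> S" for f g
    using lin[OF that, of 1 "-1"] by simp
  have C0: "0 \<le> C"
  proof (rule ccontr)
    assume "\<not> 0 \<le> C"
    then have "C * ?n v \<le> 0" by (simp add: mult_nonpos_nonneg)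
    then show False using bounded[OF v(1)] v(2) l2_norm_nonneg[of M "K v"] by linarith
  qed
  define p where "p n = (K ^^ n) v" for n
  have p0: "p 0 = v" and pS: "p (Suc n) = K (p n)" for n by (simp_all add: p_def)
  have pin: "p n \<in> S" for n by (induction n) (simp_all add: p0 pS v KS)
  define s where "s n = (?n (p n))\<^sup>2" for n
  have logconvex: "(s (Suc n))\<^sup>2 \<le> s n * s (Suc (Suc n))" for n
  proof -
    have "of_real (s (Suc n)) = ?i (p n) (p (Suc (Suc n)))"
      unfolding s_def l2_inner_self[symmetric] using sa[OF pin KS[OF pin]] by (simp add: pS)
    then have "s (Suc n) = cmod (?i (p n) (p (Suc (Suc n))))"
      by (metis norm_of_real abs_of_nonneg s_def zero_le_power2)
    also have "\<dots> \<le> ?n (p n) * ?n (p (Suc (Suc n)))"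
      by (intro l2_Cauchy_Schwarz L pin)
    finally have "(s (Suc n))\<^sup>2 \<le> (?n (p n) * ?n (p (Suc (Suc n))))\<^sup>2"
      by (intro power_mono) (simp_all add: s_def)
    then show ?thesis by (simp add: s_def power_mult_distrib)
  qed
  have spos: "0 < s n \<and> 0 < s (Suc n)" for n
  proof (induction n)
    case 0
    have "?n v \<noteq> 0"
    proof
      assume "?n v = 0"
      then show False using bounded[OF v(1)] v(2) l2_norm_nonneg[of M "K v"] by (simp add: order_antisym)
    qed
    then show ?case using v by (simp add: s_def p0 pS)
  next
    case (Suc n)
    then have "0 < s n * s (Suc (Suc n))" using logconvex[of n] by (meson less_le_trans zero_less_power)
    then show ?case using Suc by (simp add: zero_less_mult_iff)
  qed
  define q where "q n = s (Suc n) / s n" for n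
  have qpos: "0 < q n" for n using spos by (simp add: q_def)
  have qinc: "incseq q"
  proof (rule incseq_SucI)
    fix n show "q n \<le> q (Suc n)"
      using logconvex[of n] spos[of n] spos[of "Suc n"] by (simp add: q_def field_simps power2_eq_square)
  qed
  have qC: "q n \<le> C\<^sup>2" for n
  proof -
    have "s (Suc n) \<le> (C * ?n (p n))\<^sup>2"
      unfolding s_def pS by (intro power_mono bounded pin) simp
    then show ?thesis using spos[of n] by (simp add: q_def s_def power_mult_distrib field_simps)
  qed
  obtain \<mu> where \<mu>: "q \<longlonglongrightarrow> \<mu>" "\<And>n. q n \<le> \<mu>"
    using incseq_convergent[OF qinc, of "C\<^sup>2"] qC by blast
  have \<mu>pos: "0 < \<mu>" using qpos[of 0] \<mu>(2)[of 0] by linarith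
  define w where "w n = (\<lambda>x. of_real (1 / ?n (p n)) * p n x)" for n
  have npos: "0 < ?n (p n)" for n
    using spos[of n] l2_norm_nonneg[of M "p n"] unfolding s_def by (metis less_eq_real_def power_zero_numeral less_irrefl)
  have wS: "w n \<in> S" for n unfolding w_def by (rule l2_subspace_scale[OF S pin])
  have Kw: "K (w n) = (\<lambda>x. of_real (1 / ?n (p n)) * p (Suc n) x)" for n
    unfolding w_def by (subst Kscale[OF pin]) (simp add: pS)
  have KKw: "K (K (w n)) = (\<lambda>x. of_real (1 / ?n (p n)) * p (Suc (Suc n)) x)" for n
    unfolding Kw by (subst Kscale[OF pin]) (simp add: pS)
  have nw: "?n (w n) = 1" for n
    unfolding w_def l2_norm_scale using npos[of n] by (simp add: norm_divide)
  have nKw: "(?n (K (w n)))\<^sup>2 = q n" for n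
    unfolding Kw l2_norm_scale by (simp add: norm_divide power_divide q_def s_def)
  have nKKw: "(?n (K (K (w n))))\<^sup>2 = q n * q (Suc n)" for n
    unfolding KKw l2_norm_scale using spos[of n] spos[of "Suc n"]
    by (simp add: norm_divide power_divide q_def) (simp add: s_def)
  have "(\<lambda>n. (?n (\<lambda>x. K (K (w n)) x - of_real \<mu> * w n x))\<^sup>2) \<longlonglongrightarrow> 0"
  proof -
    have "(?n (\<lambda>x. K (K (w n)) x - of_real \<mu> * w n x))\<^sup>2 = q n * q (Suc n) + \<mu>\<^sup>2 - 2 * (\<mu> * q n)" for n
    proof -
      have "?i (K (K (w n))) (w n) = of_real (q n)"
        unfolding nKw[symmetric] l2_inner_self[symmetric] by (intro sa KS wS)
      then show ?thesis
        using l2_norm_diff_sq[OF L[OF KS[OF KS[OF wS]]] l2_scale[OF L[OF wS]], of n "of_real \<mu>" n] \<mu>pos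
        by (simp add: nKKw l2_norm_scale nw)
    qed
    moreover have "(\<lambda>n. q n * q (Suc n) + \<mu>\<^sup>2 - 2 * (\<mu> * q n)) \<longlonglongrightarrow> \<mu> * \<mu> + \<mu>\<^sup>2 - 2 * (\<mu> * \<mu>)"
      by (intro tendsto_intros \<mu>(1) LIMSEQ_Suc)
    ultimately show ?thesis by (simp add: power2_eq_square)
  qed
  then have near: "(\<lambda>n. ?n (\<lambda>x. K (K (w n)) x - of_real \<mu> * w n x)) \<longlonglongrightarrow> 0"
    using tendsto_real_sqrt by fastforce
  obtain k z where k: "strict_mono k" and z: "z \<in> S" "(\<lambda>n. ?n (\<lambda>x. K (w (k n)) x - z x)) \<longlonglongrightarrow> 0"
    using cpt[of w] wS nw by auto
  define y where "y = K z"
  have yS: "y \<in> S" by (simp add: y_def KS z)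
  define W where "W n = (\<lambda>x. of_real \<mu> * w (k n) x)" for n
  have WS: "W n \<in> S" for n unfolding W_def by (rule l2_subspace_scale[OF S wS])
  have lim1: "(\<lambda>n. ?n (\<lambda>x. K (K (w (k n))) x - y x)) \<longlonglongrightarrow> 0"
  proof (rule Lim_null_comparison)
    show "\<forall>\<^sub>F n in sequentially. norm (?n (\<lambda>x. K (K (w (k n))) x - y x)) \<le> C * ?n (\<lambda>x. K (w (k n)) x - z x)"
      unfolding y_def
      using bounded[OF l2_subspace_diff[OF S KS[OF wS] z(1)]]
      by (intro always_eventually) (simp add: Kdiff[OF KS[OF wS] z(1)])
    show "(\<lambda>n. C * ?n (\<lambda>x. K (w (k n)) x - z x)) \<longlonglongrightarrow> 0"
      using tendsto_mult_left[OF z(2), of C] by simp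
  qed
  have lim2: "(\<lambda>n. ?n (\<lambda>x. W n x - y x)) \<longlonglongrightarrow> 0"
  proof (rule Lim_null_comparison)
    show "\<forall>\<^sub>F n in sequentially. norm (?n (\<lambda>x. W n x - y x)) \<le>
        ?n (\<lambda>x. K (K (w (k n))) x - of_real \<mu> * w (k n) x) + ?n (\<lambda>x. K (K (w (k n))) x - y x)"
    proof (intro always_eventually allI)
      fix n
      show "norm (?n (\<lambda>x. W n x - y x)) \<le>
        ?n (\<lambda>x. K (K (w (k n))) x - of_real \<mu> * w (k n) x) + ?n (\<lambda>x. K (K (w (k n))) x - y x)"
        using l2_dist_triangle[OF L[OF WS] L[OF KS[OF KS[OF wS]]] L[OF yS], of n "k n"]
          l2_norm_minus_commute[of M "W n" "K (K (w (k n)))"]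
        by (simp add: W_def)
    qed
    show "(\<lambda>n. ?n (\<lambda>x. K (K (w (k n))) x - of_real \<mu> * w (k n) x) + ?n (\<lambda>x. K (K (w (k n))) x - y x)) \<longlonglongrightarrow> 0"
      using tendsto_add[OF LIMSEQ_subseq_LIMSEQ[OF near k] lim1] by (simp add: o_def)
  qed
  have ny: "?n y = \<mu>"
  proof -
    have "(\<lambda>n. ?n (W n)) \<longlonglongrightarrow> ?n y"
      by (intro l2_norm_tendsto L WS yS lim2)
    moreover have "?n (W n) = \<mu>" for n unfolding W_def l2_norm_scale using \<mu>pos by (simp add: nw)
    ultimately show ?thesis by (simp add: LIMSEQ_const_iff)
  qed
  have Ky: "?n (\<lambda>x. K (K y) x - of_real \<mu> * y x) = 0"
  proof -
    have "?n (\<lambda>x. K (K y) x - of_real \<mu> * y x) \<le>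
        C * (C * ?n (\<lambda>x. W n x - y x)) + \<mu> * ?n (\<lambda>x. K (K (w (k n))) x - y x)" for n
    proof -
      have KKW: "K (K (W n)) = (\<lambda>x. of_real \<mu> * K (K (w (k n))) x)"
        unfolding W_def by (simp add: Kscale wS KS)
      have "?n (\<lambda>x. K (K y) x - K (K (W n)) x) = ?n (K (K (\<lambda>x. y x - W n x)))"
        by (simp add: Kdiff yS WS KS)
      also have "\<dots> \<le> C * ?n (K (\<lambda>x. y x - W n x))"
        by (intro bounded KS l2_subspace_diff[OF S] yS WS)
      also have "\<dots> \<le> C * (C * ?n (\<lambda>x. y x - W n x))"
        by (intro mult_left_mono C0 bounded KS l2_subspace_diff[OF S] yS WS)
      finally have 1: "?n (\<lambda>x. K (K y) x - K (K (W n)) x) \<le> C * (C * ?n (\<lambda>x. W n x - y x))"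
        by (simp add: l2_norm_minus_commute[of M y])
      have "?n (\<lambda>x. K (K (W n)) x - of_real \<mu> * y x) = ?n (\<lambda>x. of_real \<mu> * (K (K (w (k n))) x - y x))"
        by (simp add: KKW right_diff_distrib)
      also have "\<dots> = \<mu> * ?n (\<lambda>x. K (K (w (k n))) x - y x)"
        using \<mu>pos by (simp add: l2_norm_scale)
      finally have 2: "?n (\<lambda>x. K (K (W n)) x - of_real \<mu> * y x) = \<mu> * ?n (\<lambda>x. K (K (w (k n))) x - y x)" .
      show ?thesis
        using l2_dist_triangle[OF L[OF KS[OF KS[OF yS]]] L[OF KS[OF KS[OF WS]]] l2_scale[OF L[OF yS]], of "of_real \<mu>" n]
          1 2 by linarith
    qed
    moreover have "(\<lambda>n. C * (C * ?n (\<lambda>x. W n x - y x)) + \<mu> * ?n (\<lambda>x. K (K (w (k n))) x - y x)) \<longlonglongrightarrow> C * (C * 0) + \<mu> * 0"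
      by (intro tendsto_intros lim1 lim2)
    ultimately have "?n (\<lambda>x. K (K y) x - of_real \<mu> * y x) \<le> 0"
      using LIMSEQ_le_const[of _ "C * (C * 0) + \<mu> * 0"] by simp
    then show ?thesis using l2_norm_nonneg by (simp add: order_antisym)
  qed
  define \<rho> where "\<rho> = sqrt \<mu>"
  have \<rho>: "\<rho> \<noteq> 0" "\<rho> * \<rho> = \<mu>" using \<mu>pos by (simp_all add: \<rho>_def)
  define u where "u = (\<lambda>x. 1 * K y x + of_real \<rho> * y x)"
  have uS: "u \<in> S" unfolding u_def by (intro l2_subspace_lincomb[OF S] KS yS)
  show thesis
  proof (cases "?n u = 0")
    case False
    have "K u = (\<lambda>x. 1 * K (K y) x + of_real \<rho> * K y x)"
      unfolding u_def by (intro lin KS yS)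
    then have "(\<lambda>x. K u x - of_real \<rho> * u x) = (\<lambda>x. K (K y) x - of_real \<mu> * y x)"
      by (simp add: u_def algebra_simps flip: \<rho>(2))
    then have "?n (\<lambda>x. K u x - of_real \<rho> * u x) = 0" using Ky by simp
    then show thesis using that[OF \<rho>(1) uS False] by blast
  next
    case True
    then have "?n (\<lambda>x. K y x - of_real (- \<rho>) * y x) = 0" by (simp add: u_def)
    then show thesis using that[of "- \<rho>", OF _ yS] \<rho>(1) ny \<mu>pos by simp
  qed
qed

section \<open>Unitary diagonalisation and Schatten quasi-norms\<close>

lemma mat_adjoint_carrier [simp]: "A \<in> carrier_mat m n \<Longrightarrow> mat_adjoint A \<in> carrier_mat n m"
  by (auto simp: mat_adjoint_def mat_of_rows_def)

lemma mat_adjoint_dim [simp]: "dim_row (mat_adjoint A) = dim_col A" "dim_col (mat_adjoint A) = dim_row A"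
  by (auto simp: mat_adjoint_def mat_of_rows_def)

lemma mat_adjoint_index:
  "A \<in> carrier_mat m n \<Longrightarrow> i < n \<Longrightarrow> j < m \<Longrightarrow> mat_adjoint A $$ (i, j) = cnj (A $$ (j, i))"
  for A :: "complex mat"
  by (auto simp: mat_adjoint_def mat_of_rows_def conjugate_complex_def)

lemma mat_mult_index:
  assumes "A \<in> carrier_mat m n" "B \<in> carrier_mat n p" "i < m" "j < p"
  shows "(A * B) $$ (i, j) = (\<Sum>k<n. A $$ (i, k) * B $$ (k, j))"
  using assms by (auto simp: scalar_prod_def lessThan_atLeast0)

lemma mat_adjoint_mult:
  assumes A: "A \<in> carrier_mat m n" and B: "B \<in> carrier_mat n p"
  shows "mat_adjoint (A * B) = mat_adjoint B * mat_adjoint (A :: complex mat)"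
proof (rule eq_matI)
  have AB: "A * B \<in> carrier_mat m p" using A B by auto
  have BA: "mat_adjoint B * mat_adjoint A \<in> carrier_mat p m"
    using mat_adjoint_carrier[OF A] mat_adjoint_carrier[OF B] by auto
  fix i j assume "i < dim_row (mat_adjoint B * mat_adjoint A)" "j < dim_col (mat_adjoint B * mat_adjoint A)"
  then have ij: "i < p" "j < m" using BA by auto
  have "mat_adjoint (A * B) $$ (i, j) = cnj (\<Sum>k<n. A $$ (j, k) * B $$ (k, i))"
    using mat_adjoint_index[OF AB ij] mat_mult_index[OF A B ij(2,1)] by simp
  also have "\<dots> = (\<Sum>k<n. mat_adjoint B $$ (i, k) * mat_adjoint A $$ (k, j))"
    by (simp add: mat_adjoint_index[OF A _ ij(2)] mat_adjoint_index[OF B ij(1)] mult.commute)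
  also have "\<dots> = (mat_adjoint B * mat_adjoint A) $$ (i, j)"
    using mat_mult_index[OF mat_adjoint_carrier[OF B] mat_adjoint_carrier[OF A] ij] by simp
  finally show "mat_adjoint (A * B) $$ (i, j) = (mat_adjoint B * mat_adjoint A) $$ (i, j)" .
qed (use A B in auto)

lemma unitary_mat_carrier: "unitary_mat d U \<Longrightarrow> U \<in> carrier_mat d d"
  by (simp add: unitary_mat_def)

lemma unitary_mat_right:
  assumes "unitary_mat d U"
  shows "U * mat_adjoint U = 1\<^sub>m d"
  using assms mat_mult_left_right_inverse[of "mat_adjoint U" d U] by (simp add: unitary_mat_def)

lemma unitary_mat_cols:
  assumes U: "unitary_mat d U" and ij: "i < d" "j < d"
  shows "(\<Sum>k<d. cnj (U $$ (k, i)) * U $$ (k, j)) = (if i = j then 1 else 0)"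
proof -
  note c = unitary_mat_carrier[OF U]
  have "(\<Sum>k<d. cnj (U $$ (k, i)) * U $$ (k, j)) = (mat_adjoint U * U) $$ (i, j)"
    using mat_mult_index[OF mat_adjoint_carrier[OF c] c ij] by (simp add: mat_adjoint_index[OF c ij(1)])
  then show ?thesis using U ij by (simp add: unitary_mat_def)
qed

text \<open>Vectors of \<open>\<complex>\<^sup>d\<close> are handled as square-integrable functions on \<open>{..<d}\<close>, so that the eigenvector
  lemma applies to them.\<close>

lemma l2_count_space: "f \<in> l2 (count_space {..<d::nat})"
  by (auto simp: l2_iff intro: integrable_count_space)

lemma l2_norm_count_space: "(l2_norm (count_space {..<d::nat}) f)\<^sup>2 = (\<Sum>i<d. (cmod (f i))\<^sup>2)"
  by (simp add: l2_norm_sq lebesgue_integral_count_space_finite)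

lemma l2_inner_count_space: "l2_inner (count_space {..<d::nat}) f g = (\<Sum>i<d. f i * cnj (g i))"
  by (simp add: l2_inner_def lebesgue_integral_count_space_finite)

lemma l2_norm_count_space_eq_0:
  "l2_norm (count_space {..<d::nat}) f = 0 \<longleftrightarrow> (\<forall>i<d. f i = 0)"
proof -
  have "l2_norm (count_space {..<d}) f = 0 \<longleftrightarrow> (\<Sum>i<d. (cmod (f i))\<^sup>2) = 0"
    by (simp flip: l2_norm_count_space)
  then show ?thesis by (subst (asm) sum_nonneg_eq_0_iff) auto
qed

lemma hermitian_operator_eigenvector:
  fixes B :: "nat \<Rightarrow> nat \<Rightarrow> complex" and d :: nat
  defines "N \<equiv> count_space {..<d}" and "K \<equiv> \<lambda>f i. \<Sum>j<d. B i j * f j"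
  assumes herm: "\<And>i j. i < d \<Longrightarrow> j < d \<Longrightarrow> B i j = cnj (B j i)"
    and S: "l2_subspace N S" and KS: "\<And>f. f \<in> S \<Longrightarrow> K f \<in> S"
    and closed: "\<And>w z. (\<And>n::nat. w n \<in> S) \<Longrightarrow> (\<lambda>n. l2_norm N (\<lambda>x. w n x - z x)) \<longlonglongrightarrow> 0 \<Longrightarrow> z \<in> S"
    and v: "v \<in> S" "l2_norm N v \<noteq> 0"
  shows "\<exists>\<nu> :: real. \<exists>u\<in>S. l2_norm N u \<noteq> 0 \<and> (\<forall>i<d. K u i = of_real \<nu> * u i)"
proof (cases "l2_norm N (K v) = 0")
  case True
  then have "K v i = of_real 0 * v i" if "i < d" for i
    using that by (simp add: N_def l2_norm_count_space_eq_0)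
  with v show ?thesis by blast
next
  case False
  define C where "C = sqrt (\<Sum>i<d. (\<Sum>j<d. cmod (B i j))\<^sup>2)"
  have l2N: "f \<in> l2 N" for f unfolding N_def by (rule l2_count_space)
  have entry: "cmod (f j) \<le> l2_norm N f" if "j < d" for f j
  proof (rule power2_le_imp_le)
    show "(cmod (f j))\<^sup>2 \<le> (l2_norm N f)\<^sup>2"
      unfolding N_def l2_norm_count_space using that by (intro member_le_sum) auto
  qed simp
  have lin: "K (\<lambda>x. a * f x + b * g x) = (\<lambda>x. a * K f x + b * K g x)" for a b f g
    by (simp add: K_def algebra_simps sum.distrib sum_distrib_left)
  have sa: "l2_inner N (K f) g = l2_inner N f (K g)" for f g
  proof -
    have "l2_inner N (K f) g = (\<Sum>i<d. \<Sum>j<d. B i j * f j * cnj (g i))"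
      by (simp add: N_def l2_inner_count_space K_def sum_distrib_right)
    also have "\<dots> = (\<Sum>j<d. \<Sum>i<d. B i j * f j * cnj (g i))" by (rule sum.swap)
    also have "\<dots> = (\<Sum>j<d. \<Sum>i<d. f j * cnj (B j i * g i))"
    proof (intro sum.cong refl)
      fix i j assume "j \<in> {..<d}" "i \<in> {..<d}"
      then show "B i j * f j * cnj (g i) = f j * cnj (B j i * g i)"
        by (subst herm) auto
    qed
    also have "\<dots> = l2_inner N f (K g)"
      by (simp add: N_def l2_inner_count_space K_def sum_distrib_left)
    finally show ?thesis .
  qed
  have bounded: "l2_norm N (K f) \<le> C * l2_norm N f" for f
  proof (rule power2_le_imp_le)
    have "(l2_norm N (K f))\<^sup>2 = (\<Sum>i<d. (cmod (K f i))\<^sup>2)"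
      by (simp add: N_def l2_norm_count_space)
    also have "\<dots> \<le> (\<Sum>i<d. ((\<Sum>j<d. cmod (B i j)) * l2_norm N f)\<^sup>2)"
    proof (intro sum_mono power_mono)
      fix i
      have "cmod (K f i) \<le> (\<Sum>j<d. cmod (B i j) * cmod (f j))"
        unfolding K_def norm_mult[symmetric] by (rule norm_sum)
      also have "\<dots> \<le> (\<Sum>j<d. cmod (B i j) * l2_norm N f)"
        by (intro sum_mono mult_left_mono entry) auto
      finally show "cmod (K f i) \<le> (\<Sum>j<d. cmod (B i j)) * l2_norm N f"
        by (simp add: sum_distrib_right)
    qed simp
    also have "\<dots> = (C * l2_norm N f)\<^sup>2"
      by (simp add: C_def power_mult_distrib sum_nonneg flip: sum_distrib_right)
    finally show "(l2_norm N (K f))\<^sup>2 \<le> (C * l2_norm N f)\<^sup>2" .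
  qed (simp add: C_def sum_nonneg)
  have cpt: "\<exists>k z. strict_mono k \<and> z \<in> S \<and> (\<lambda>n. l2_norm N (\<lambda>x. K (w (k n)) x - z x)) \<longlonglongrightarrow> 0"
    if w: "\<And>n::nat. w n \<in> S \<and> l2_norm N (w n) \<le> 1" for w
  proof -
    have "\<And>n x. x \<in> {..<d} \<Longrightarrow> cmod (w n x) \<le> 1"
      using entry w order_trans by blast
    then obtain k :: "nat \<Rightarrow> nat" where k: "strict_mono k" "\<And>x. x \<in> {..<d} \<Longrightarrow> \<exists>l. (\<lambda>n. w (k n) x) \<longlonglongrightarrow> l"
      using function_convergent_subsequence[of "{..<d}" w 1] by (metis countable_finite finite_lessThan)
    then obtain z where z: "\<And>x. x < d \<Longrightarrow> (\<lambda>n. w (k n) x) \<longlonglongrightarrow> z x"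
      by (metis lessThan_iff)
    have "(\<lambda>n. (l2_norm N (\<lambda>x. w (k n) x - z x))\<^sup>2) \<longlonglongrightarrow> (\<Sum>i<d. (cmod (z i - z i))\<^sup>2)"
      unfolding N_def l2_norm_count_space by (intro tendsto_intros z) auto
    then have "(\<lambda>n. (l2_norm N (\<lambda>x. w (k n) x - z x))\<^sup>2) \<longlonglongrightarrow> 0" by simp
    then have lim: "(\<lambda>n. l2_norm N (\<lambda>x. w (k n) x - z x)) \<longlonglongrightarrow> 0"
      using tendsto_real_sqrt by fastforce
    have zS: "z \<in> S" by (rule closed[OF _ lim]) (use w in blast)
    have "(\<lambda>n. l2_norm N (\<lambda>x. K (w (k n)) x - K z x)) \<longlonglongrightarrow> 0"
    proof (rule Lim_null_comparison)
      show "\<forall>\<^sub>F n in sequentially. norm (l2_norm N (\<lambda>x. K (w (k n)) x - K z x)) \<le> C * l2_norm N (\<lambda>x. w (k n) x - z x)"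
      proof (intro always_eventually allI)
        fix n
        show "norm (l2_norm N (\<lambda>x. K (w (k n)) x - K z x)) \<le> C * l2_norm N (\<lambda>x. w (k n) x - z x)"
          using bounded[of "\<lambda>x. w (k n) x - z x"] lin[of 1 "w (k n)" "-1" z] by simp
      qed
      show "(\<lambda>n. C * l2_norm N (\<lambda>x. w (k n) x - z x)) \<longlonglongrightarrow> 0"
        using tendsto_mult_left[OF lim, of C] by simp
    qed
    with k KS[OF zS] show ?thesis by blast
  qed
  obtain \<nu> :: real and u where "\<nu> \<noteq> 0" "u \<in> S" "l2_norm N u \<noteq> 0"
    "l2_norm N (\<lambda>x. K u x - of_real \<nu> * u x) = 0"
    using compact_selfadjoint_eigenvector[of N S K C v] S KS lin sa bounded cpt v False by blast
  then show ?thesis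
    by (intro exI[of _ \<nu>] bexI[of _ u]) (simp_all add: N_def l2_norm_count_space_eq_0)
qed

text \<open>Eigenvectors are split off one by one: the orthogonal complement of those already found is invariant.\<close>

lemma hermitian_orthonormal_eigenvectors:
  fixes B :: "nat \<Rightarrow> nat \<Rightarrow> complex"
  assumes herm: "\<And>i j. i < d \<Longrightarrow> j < d \<Longrightarrow> B i j = cnj (B j i)" and "m \<le> d"
  shows "\<exists>e (\<nu> :: nat \<Rightarrow> real). orthonormal (count_space {..<d}) m e \<and>
    (\<forall>j<m. \<forall>i<d. (\<Sum>k<d. B i k * e j k) = of_real (\<nu> j) * e j i)"
  using \<open>m \<le> d\<close>
proof (induction m)
  case 0
  then show ?case by (simp add: orthonormal_def)
next
  case (Suc m)
  let ?N = "count_space {..<d}" let ?K = "\<lambda>f i. \<Sum>j<d. B i j * f j"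
  obtain e and \<nu> :: "nat \<Rightarrow> real" where e: "orthonormal ?N m e"
    and eig: "\<And>j i. j < m \<Longrightarrow> i < d \<Longrightarrow> ?K (e j) i = of_real (\<nu> j) * e j i"
    using Suc by auto
  define S where "S = {f. \<forall>j<m. l2_inner ?N f (e j) = 0}"
  note l2N = l2_count_space
  have S: "l2_subspace ?N S"
    using l2N by (auto simp: l2_subspace_def S_def l2_inner_lincomb_left)
  have KS: "?K f \<in> S" if "f \<in> S" for f
  proof -
    have "l2_inner ?N (?K f) (e j) = 0" if j: "j < m" for j
    proof -
      have "l2_inner ?N (?K f) (e j) = (\<Sum>i<d. \<Sum>k<d. B i k * f k * cnj (e j i))"
        by (simp add: l2_inner_count_space sum_distrib_right)
      also have "\<dots> = (\<Sum>k<d. \<Sum>i<d. B i k * f k * cnj (e j i))" by (rule sum.swap)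
      also have "\<dots> = (\<Sum>k<d. f k * cnj (?K (e j) k))"
      proof (rule sum.cong[OF refl])
        fix k assume "k \<in> {..<d}"
        then have "(\<Sum>i<d. B i k * f k * cnj (e j i)) = (\<Sum>i<d. f k * (cnj (B k i) * cnj (e j i)))"
        proof (intro sum.cong refl)
          fix i assume "i \<in> {..<d}"
          then show "B i k * f k * cnj (e j i) = f k * (cnj (B k i) * cnj (e j i))"
            using \<open>k \<in> {..<d}\<close> by (subst herm) auto
        qed
        then show "(\<Sum>i<d. B i k * f k * cnj (e j i)) = f k * cnj (?K (e j) k)"
          by (simp add: sum_distrib_left)
      qed
      also have "\<dots> = (\<Sum>k<d. of_real (\<nu> j) * (f k * cnj (e j k)))"
        using eig[OF j] by (intro sum.cong) auto
      also have "\<dots> = of_real (\<nu> j) * l2_inner ?N f (e j)"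
        by (simp add: l2_inner_count_space sum_distrib_left)
      finally show ?thesis using that \<open>f \<in> S\<close> j by (simp add: S_def)
    qed
    then show ?thesis by (simp add: S_def)
  qed
  have closed: "z \<in> S" if "\<And>n::nat. w n \<in> S" "(\<lambda>n. l2_norm ?N (\<lambda>x. w n x - z x)) \<longlonglongrightarrow> 0" for w z
  proof -
    have "l2_inner ?N z (e j) = 0" if "j < m" for j
    proof -
      have "(\<lambda>n. l2_inner ?N (w n) (e j)) \<longlonglongrightarrow> l2_inner ?N z (e j)"
        by (rule l2_inner_tendsto_left[OF l2N l2N l2N]) fact
      moreover have "l2_inner ?N (w n) (e j) = 0" for n
        using \<open>w n \<in> S\<close> \<open>j < m\<close> by (simp add: S_def)
      ultimately show ?thesis by (simp add: LIMSEQ_const_iff)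
    qed
    then show ?thesis by (simp add: S_def)
  qed
  (* the residuals of the standard basis vectors have total squared norm d - m > 0 *)
  have "\<exists>v\<in>S. l2_norm ?N v \<noteq> 0"
  proof (rule ccontr)
    assume "\<not> ?thesis"
    then have null: "\<And>v. v \<in> S \<Longrightarrow> l2_norm ?N v = 0" by blast
    let ?b = "\<lambda>i x. if x = i then 1 else 0 :: complex"
    have ip: "l2_inner ?N (?b i) (e j) = cnj (e j i)" if "i < d" for i j
    proof -
      have "(\<Sum>x<d. ?b i x * cnj (e j x)) = (\<Sum>x<d. if x = i then cnj (e j x) else 0)"
        by (intro sum.cong) auto
      then show ?thesis using that by (simp add: l2_inner_count_space)
    qed
    have one: "(\<Sum>j<m. (cmod (e j i))\<^sup>2) = 1" if i: "i < d" for i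
    proof -
      have "(\<lambda>x. ?b i x - l2_proj ?N m e (?b i) x) \<in> S"
        using l2_proj_residual_orthogonal[OF e l2N] by (simp add: S_def)
      then have "0 = (l2_norm ?N (?b i))\<^sup>2 - (\<Sum>j<m. (cmod (l2_inner ?N (?b i) (e j)))\<^sup>2)"
        using null l2_proj_residual_norm[OF e l2N, of "?b i"] by (metis power_zero_numeral)
      also have "(l2_norm ?N (?b i))\<^sup>2 = (\<Sum>x<d. if x = i then 1 else 0)"
        unfolding l2_norm_count_space by (intro sum.cong) auto
      also have "\<dots> = 1" using i by simp
      finally show ?thesis by (simp add: ip[OF i])
    qed
    have "real d = (\<Sum>i<d. \<Sum>j<m. (cmod (e j i))\<^sup>2)" by (simp add: one)
    also have "\<dots> = (\<Sum>j<m. \<Sum>i<d. (cmod (e j i))\<^sup>2)" by (rule sum.swap)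
    also have "\<dots> = real m" using orthonormal_norm[OF e] by (simp add: l2_norm_count_space)
    finally show False using Suc.prems by simp
  qed
  then obtain v where v: "v \<in> S" "l2_norm ?N v \<noteq> 0" by blast
  have "\<exists>\<mu> :: real. \<exists>u\<in>S. l2_norm ?N u \<noteq> 0 \<and> (\<forall>i<d. ?K u i = of_real \<mu> * u i)"
  proof (rule hermitian_operator_eigenvector)
    show "B i j = cnj (B j i)" if "i < d" "j < d" for i j using that by (rule herm)
    show "z \<in> S" if "\<And>n::nat. w n \<in> S" "(\<lambda>n. l2_norm ?N (\<lambda>x. w n x - z x)) \<longlonglongrightarrow> 0" for w z
      using that by (rule closed)
    show "?K f \<in> S" if "f \<in> S" for f using that by (rule KS)
  qed (rule S v)+
  then obtain u and \<mu> :: real where u: "u \<in> S" "l2_norm ?N u \<noteq> 0"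
    and Ku: "\<And>i. i < d \<Longrightarrow> ?K u i = of_real \<mu> * u i"
    by blast
  let ?c = "of_real (1 / l2_norm ?N u) :: complex"
  have "orthonormal ?N (Suc m) (e(m := \<lambda>x. ?c * u x))"
    using u(1) by (intro orthonormal_extend[OF e l2N u(2)]) (simp add: S_def)
  moreover have "(\<Sum>k<d. B i k * (e(m := \<lambda>x. ?c * u x)) j k) =
      of_real ((\<nu>(m := \<mu>)) j) * (e(m := \<lambda>x. ?c * u x)) j i" if "j < Suc m" "i < d" for i j
  proof (cases "j = m")
    case True
    have "(\<Sum>k<d. B i k * (?c * u k)) = ?c * ?K u i"
      by (simp add: sum_distrib_left algebra_simps)
    then show ?thesis using True Ku[OF that(2)] by simp
  next
    case False
    then show ?thesis using that eig by simp
  qed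
  ultimately show ?case by blast
qed

text \<open>The eigenvalues are written as the squared norms of the columns of \<open>M U\<close>, so that they are
  visibly nonnegative; they are the squares of the singular values of \<open>M\<close>.\<close>

lemma gram_matrix_diagonalisation:
  fixes M :: "complex mat"
  assumes M: "M \<in> carrier_mat d d"
  obtains U where "unitary_mat d U"
    "mat_adjoint M * M = U * mat_diag d (\<lambda>j. complex_of_real (\<Sum>a<d. (cmod ((M * U) $$ (a, j)))\<^sup>2)) * mat_adjoint U"
proof -
  let ?P = "mat_adjoint M * M"
  have P: "?P \<in> carrier_mat d d" by (rule mult_carrier_mat[OF mat_adjoint_carrier[OF M] M])
  have Pij: "?P $$ (i, j) = (\<Sum>k<d. cnj (M $$ (k, i)) * M $$ (k, j))" if "i < d" "j < d" for i j
    using mat_mult_index[OF mat_adjoint_carrier[OF M] M that] by (simp add: mat_adjoint_index[OF M that(1)])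
  have herm: "?P $$ (i, j) = cnj (?P $$ (j, i))" if "i < d" "j < d" for i j
    by (simp add: Pij that mult.commute)
  obtain e and \<nu> :: "nat \<Rightarrow> real" where e: "orthonormal (count_space {..<d}) d e"
    and eig: "\<And>j i. j < d \<Longrightarrow> i < d \<Longrightarrow> (\<Sum>k<d. ?P $$ (i, k) * e j k) = of_real (\<nu> j) * e j i"
    using hermitian_orthonormal_eigenvectors[of d "\<lambda>i j. ?P $$ (i, j)" d, OF herm order_refl] by blast
  define U where "U = Matrix.mat d d (\<lambda>(i, j). e j i)"
  have Uc: "U \<in> carrier_mat d d" by (simp add: U_def)
  have Uij: "U $$ (i, j) = e j i" if "i < d" "j < d" for i j using that by (simp add: U_def)
  have U: "unitary_mat d U"
  proof -
    have "mat_adjoint U * U = 1\<^sub>m d"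
    proof (rule eq_matI)
      fix i j assume "i < dim_row (1\<^sub>m d)" "j < dim_col (1\<^sub>m d)"
      then have ij: "i < d" "j < d" by auto
      have "(mat_adjoint U * U) $$ (i, j) = (\<Sum>k<d. e j k * cnj (e i k))"
        using mat_mult_index[OF mat_adjoint_carrier[OF Uc] Uc ij] ij
        by (simp add: mat_adjoint_index[OF Uc ij(1)] Uij mult.commute)
      also have "\<dots> = 1\<^sub>m d $$ (i, j)"
        using orthonormal_inner[OF e ij(2,1)] ij by (auto simp: l2_inner_count_space)
      finally show "(mat_adjoint U * U) $$ (i, j) = 1\<^sub>m d $$ (i, j)" .
    qed (use mat_adjoint_carrier[OF Uc] Uc in auto)
    with Uc show ?thesis by (simp add: unitary_mat_def)
  qed
  note Ua = mat_adjoint_carrier[OF Uc]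
  let ?D = "mat_diag d (\<lambda>j. complex_of_real (\<nu> j))"
  have PU: "?P * U = U * ?D"
  proof (rule eq_matI)
    fix i j assume "i < dim_row (U * ?D)" "j < dim_col (U * ?D)"
    then have ij: "i < d" "j < d" using Uc by (auto simp: mat_diag_def)
    show "(?P * U) $$ (i, j) = (U * ?D) $$ (i, j)"
      using ij eig[OF ij(2,1)] by (simp add: mat_mult_index[OF P Uc ij] mat_diag_mult_right[OF Uc] Uij)
  qed (use P Uc in \<open>auto simp: mat_diag_def\<close>)
  have Dc: "?D \<in> carrier_mat d d" by simp
  have "?P = ?P * (U * mat_adjoint U)" by (simp add: unitary_mat_right[OF U] right_mult_one_mat[OF P])
  also have "\<dots> = (U * ?D) * mat_adjoint U" using PU P Uc Ua by (simp add: assoc_mult_mat[of _ d d _ d _ d, symmetric] mult_carrier_mat[of _ d d _ d])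
  finally have Pdec: "?P = U * ?D * mat_adjoint U" .
  have MU: "M * U \<in> carrier_mat d d" using M Uc by auto
  have "of_real (\<nu> j) = complex_of_real (\<Sum>a<d. (cmod ((M * U) $$ (a, j)))\<^sup>2)" if j: "j < d" for j
  proof -
    have "?D = mat_adjoint U * U * ?D" using U by (simp add: unitary_mat_def left_mult_one_mat[OF Dc])
    also have "\<dots> = mat_adjoint U * (?P * U)" using PU Uc Ua Dc by (simp add: assoc_mult_mat[of _ d d _ d _ d] mult_carrier_mat[of _ d d _ d])
    also have "\<dots> = mat_adjoint (M * U) * (M * U)"
      using mat_adjoint_mult[OF M Uc] M Uc Ua mat_adjoint_carrier[OF M] P
      by (simp add: assoc_mult_mat[of _ d d _ d _ d] mult_carrier_mat[of _ d d _ d])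
    finally have "?D $$ (j, j) = (mat_adjoint (M * U) * (M * U)) $$ (j, j)" by simp
    also have "\<dots> = (\<Sum>a<d. (M * U) $$ (a, j) * cnj ((M * U) $$ (a, j)))"
      unfolding mat_mult_index[OF mat_adjoint_carrier[OF MU] MU j j]
      by (intro sum.cong) (simp_all add: mat_adjoint_index[OF MU j] mult.commute)
    also have "\<dots> = complex_of_real (\<Sum>a<d. (cmod ((M * U) $$ (a, j)))\<^sup>2)"
      unfolding of_real_sum complex_norm_square by simp
    finally show ?thesis using j by (simp add: mat_diag_def)
  qed
  then have "?D = mat_diag d (\<lambda>j. complex_of_real (\<Sum>a<d. (cmod ((M * U) $$ (a, j)))\<^sup>2))"
    by (intro eq_matI) (auto simp: mat_diag_def)
  with Pdec U show thesis using that by metis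
qed

text \<open>Two unitary diagonalisations \<open>U diag(l) U\<^sup>* = V diag(m) V\<^sup>*\<close> are compared through \<open>W = V\<^sup>* U\<close>:
  \<open>m\<^sub>i W\<^sub>i\<^sub>j = W\<^sub>i\<^sub>j l\<^sub>j\<close>, hence \<open>m\<^sub>i = l\<^sub>j\<close> wherever \<open>W\<^sub>i\<^sub>j\<close> does not vanish.\<close>

lemma functional_calculus_unique:
  fixes l m :: "nat \<Rightarrow> real" and h :: "real \<Rightarrow> real"
  assumes U: "unitary_mat d U" and V: "unitary_mat d V"
    and eq: "U * mat_diag d (\<lambda>i. complex_of_real (l i)) * mat_adjoint U =
             V * mat_diag d (\<lambda>i. complex_of_real (m i)) * mat_adjoint V"
  shows "U * mat_diag d (\<lambda>i. complex_of_real (h (l i))) * mat_adjoint U =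
         V * mat_diag d (\<lambda>i. complex_of_real (h (m i))) * mat_adjoint V"
proof -
  let ?L = "\<lambda>h. mat_diag d (\<lambda>i. complex_of_real (h (l i)))"
  let ?M = "\<lambda>h. mat_diag d (\<lambda>i. complex_of_real (h (m i)))"
  define W where "W = mat_adjoint V * U"
  note Uc = unitary_mat_carrier[OF U] and Vc = unitary_mat_carrier[OF V]
  note Ua = mat_adjoint_carrier[OF Uc] and Va = mat_adjoint_carrier[OF Vc]
  have Wc: "W \<in> carrier_mat d d" using Uc Va by (auto simp: W_def)
  have Lc: "?L k \<in> carrier_mat d d" "?M k \<in> carrier_mat d d" for k by simp_all
  note as = assoc_mult_mat[of _ d d _ d _ d] and cm = mult_carrier_mat[of _ d d _ d]
  have U1: "mat_adjoint U * U = 1\<^sub>m d" "U * mat_adjoint U = 1\<^sub>m d"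
    using U unitary_mat_right[OF U] by (auto simp: unitary_mat_def)
  have V1: "mat_adjoint V * V = 1\<^sub>m d" "V * mat_adjoint V = 1\<^sub>m d"
    using V unitary_mat_right[OF V] by (auto simp: unitary_mat_def)
  have "?M (\<lambda>x. x) * W = mat_adjoint V * (V * ?M (\<lambda>x. x) * mat_adjoint V) * U"
  proof -
    have "mat_adjoint V * (V * ?M (\<lambda>x. x) * mat_adjoint V) * U = (mat_adjoint V * V) * ?M (\<lambda>x. x) * (mat_adjoint V * U)"
      using Uc Vc Ua Va Lc by (simp add: as cm)
    then show ?thesis by (simp add: V1 W_def left_mult_one_mat[OF Lc(2)[of "\<lambda>x. x"]])
  qed
  also have "\<dots> = mat_adjoint V * (U * ?L (\<lambda>x. x) * mat_adjoint U) * U" using eq by simp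
  also have "\<dots> = (mat_adjoint V * U) * ?L (\<lambda>x. x) * (mat_adjoint U * U)"
    using Uc Vc Ua Va Lc by (simp add: as cm)
  also have "\<dots> = W * ?L (\<lambda>x. x)" by (simp add: U1 W_def[symmetric] right_mult_one_mat[OF mult_carrier_mat[OF Wc Lc(1)[of "\<lambda>x. x"]]])
  finally have comm: "?M (\<lambda>x. x) * W = W * ?L (\<lambda>x. x)" .
  have entry: "complex_of_real (m i) * W $$ (i, j) = W $$ (i, j) * complex_of_real (l j)" if "i < d" "j < d" for i j
    using arg_cong[OF comm, of "\<lambda>A. A $$ (i, j)"] that
    by (simp add: mat_diag_mult_left[OF Wc] mat_diag_mult_right[OF Wc])
  have comm_h: "?M h * W = W * ?L h"
  proof (rule eq_matI)
    fix i j assume "i < dim_row (W * ?L h)" "j < dim_col (W * ?L h)"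
    then have ij: "i < d" "j < d" using Wc by (auto simp: mat_diag_def)
    have "W $$ (i, j) = 0 \<or> m i = l j"
      using entry[OF ij] by (metis mult.commute mult_cancel_left of_real_eq_iff)
    then show "(?M h * W) $$ (i, j) = (W * ?L h) $$ (i, j)"
      using ij by (auto simp: mat_diag_mult_left[OF Wc] mat_diag_mult_right[OF Wc])
  qed (use Wc in \<open>auto simp: mat_diag_def\<close>)
  have VW: "V * W = U"
    unfolding W_def using Uc Vc Va V1 by (simp add: as[symmetric] cm)
  have WU: "W * mat_adjoint U = mat_adjoint V"
    unfolding W_def using Uc Ua Va U1 by (simp add: as cm right_mult_one_mat[OF Va])
  have "U * ?L h * mat_adjoint U = V * (W * ?L h) * mat_adjoint U"
    unfolding VW[symmetric] using Wc Vc Lc by (simp add: as cm)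
  also have "\<dots> = V * ?M h * (W * mat_adjoint U)"
    unfolding comm_h[symmetric] using Wc Vc Lc Ua by (simp add: as cm)
  finally show ?thesis unfolding WU .
qed

lemma psd_powr_eq:
  assumes U: "unitary_mat d U" and l: "\<And>i. i < d \<Longrightarrow> 0 \<le> l i"
    and P: "P = U * mat_diag d (\<lambda>i. complex_of_real (l i)) * mat_adjoint U"
  shows "psd_powr P s = U * mat_diag d (\<lambda>i. complex_of_real (l i powr s)) * mat_adjoint U"
proof -
  have d: "dim_row P = d" using unitary_mat_carrier[OF U] P by auto
  show ?thesis
    unfolding psd_powr_def d
  proof (rule the_equality)
    show "\<exists>V m. unitary_mat d V \<and> (\<forall>i<d. 0 \<le> m i) \<and>
        P = V * mat_diag d (\<lambda>i. complex_of_real (m i)) * mat_adjoint V \<and>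
        U * mat_diag d (\<lambda>i. complex_of_real (l i powr s)) * mat_adjoint U =
        V * mat_diag d (\<lambda>i. complex_of_real (m i powr s)) * mat_adjoint V"
      using U l P by blast
  next
    fix Q assume "\<exists>V m. unitary_mat d V \<and> (\<forall>i<d. 0 \<le> m i) \<and>
        P = V * mat_diag d (\<lambda>i. complex_of_real (m i)) * mat_adjoint V \<and>
        Q = V * mat_diag d (\<lambda>i. complex_of_real (m i powr s)) * mat_adjoint V"
    then show "Q = U * mat_diag d (\<lambda>i. complex_of_real (l i powr s)) * mat_adjoint U"
      using functional_calculus_unique[OF U, of _ l _ "\<lambda>x. x powr s"] P by metis
  qed
qed

lemma mat_trace_conjugate_diag:
  assumes U: "unitary_mat d U"
  shows "mat_trace (U * mat_diag d h * mat_adjoint U) = (\<Sum>k<d. h k)"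
proof -
  note Uc = unitary_mat_carrier[OF U]
  note Ua = mat_adjoint_carrier[OF Uc]
  have UD: "U * mat_diag d h \<in> carrier_mat d d" using Uc by (auto simp: mat_diag_def)
  have "mat_trace (U * mat_diag d h * mat_adjoint U) = (\<Sum>i<d. \<Sum>k<d. (cnj (U $$ (i, k)) * U $$ (i, k)) * h k)"
    using Uc mat_mult_index[OF UD Ua]
    by (simp add: mat_trace_def mat_diag_mult_right[OF Uc] mat_adjoint_index[OF Uc] mult_ac)
  also have "\<dots> = (\<Sum>k<d. \<Sum>i<d. (cnj (U $$ (i, k)) * U $$ (i, k)) * h k)" by (rule sum.swap)
  also have "\<dots> = (\<Sum>k<d. h k)"
    using unitary_mat_cols[OF U] by (simp flip: sum_distrib_right)
  finally show ?thesis .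
qed

lemma schatten_norm_powr:
  assumes r: "0 < r" and U: "unitary_mat d U" and l: "\<And>i. i < d \<Longrightarrow> 0 \<le> l i"
    and P: "mat_adjoint M * M = U * mat_diag d (\<lambda>i. complex_of_real (l i)) * mat_adjoint U"
  shows "schatten_norm r M powr r = (\<Sum>i<d. l i powr (r / 2))"
proof -
  have abs: "mat_abs M = U * mat_diag d (\<lambda>i. complex_of_real (l i powr (1 / 2))) * mat_adjoint U"
    unfolding mat_abs_def by (rule psd_powr_eq[OF U l P])
  have "psd_powr (mat_abs M) r = U * mat_diag d (\<lambda>i. complex_of_real ((l i powr (1 / 2)) powr r)) * mat_adjoint U"
    by (rule psd_powr_eq[OF U _ abs]) simp
  then have "Re (mat_trace (psd_powr (mat_abs M) r)) = (\<Sum>i<d. l i powr (r / 2))"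
    by (simp add: mat_trace_conjugate_diag[OF U] powr_powr)
  moreover have "0 \<le> (\<Sum>i<d. l i powr (r / 2))" by (simp add: sum_nonneg)
  ultimately show ?thesis using r by (simp add: schatten_norm_def powr_powr)
qed

section \<open>Integration on a compact group\<close>

locale compact_haar_group = group G
  for G :: "('a, 'b) monoid_scheme" (structure) +
  fixes T :: "'a topology" and M :: "'a measure"
  assumes topspace_T: "topspace T = carrier G"
    and compact_T: "compact_space T"
    and Hausdorff_T: "Hausdorff_space T"
    and second_countable_T: "second_countable T"
    and mult_cont: "continuous_map (prod_topology T T) T (\<lambda>(x, y). x \<otimes> y)"
    and inv_cont: "continuous_map T T (\<lambda>x. inv x)"
    and haar: "normalised_haar G T M"
begin

abbreviation cont :: "('a \<Rightarrow> complex) \<Rightarrow> bool" where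
  "cont \<equiv> continuous_map T euclidean"

lemma space_M [simp]: "space M = carrier G"
  and sets_M: "sets M = sigma_sets (topspace T) {U. openin T U}"
  and emeasure_total: "emeasure M (carrier G) = 1"
  and emeasure_coset: "x \<in> carrier G \<Longrightarrow> S \<in> sets M \<Longrightarrow> emeasure M (x <# S) = emeasure M S"
  using haar by (auto simp: normalised_haar_def)

lemma measure_total [simp]: "measure M (carrier G) = 1"
  by (simp add: measure_def emeasure_total)

sublocale finite_measure M
  by (rule finite_measureI) (simp add: emeasure_total)

lemma open_sets_M: "openin T U \<Longrightarrow> U \<in> sets M"
  by (simp add: sets_M sigma_sets.Basic)

lemma continuous_imp_borel_measurable:
  assumes "continuous_map T euclidean f"
  shows "f \<in> borel_measurable M"
proof (rule borel_measurableI)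
  fix S :: "'c set" assume "open S"
  then have "openin T {x \<in> topspace T. f x \<in> S}"
    using assms by (simp add: openin_continuous_map_preimage)
  moreover have "{x \<in> topspace T. f x \<in> S} = f -` S \<inter> space M" by (auto simp: topspace_T)
  ultimately show "f -` S \<inter> space M \<in> sets M" using open_sets_M by simp
qed

lemma continuous_bounded:
  fixes f :: "'a \<Rightarrow> 'c::real_normed_vector"
  assumes "continuous_map T euclidean f"
  obtains B where "0 \<le> B" "\<And>x. x \<in> carrier G \<Longrightarrow> norm (f x) \<le> B"
proof -
  have "compactin euclidean (f ` topspace T)"
    using compact_T assms image_compactin unfolding compact_space_def by blast
  then have "bounded (f ` carrier G)" by (simp add: topspace_T compact_imp_bounded)
  then show thesis unfolding bounded_pos using that by (metis imageI less_imp_le)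
qed

lemma cont_l2:
  assumes "cont f" shows "f \<in> l2 M"
proof -
  obtain B where "\<And>x. x \<in> carrier G \<Longrightarrow> cmod (f x) \<le> B" using continuous_bounded[OF assms] by blast
  then show ?thesis by (intro bounded_imp_l2(1)[of f B] continuous_imp_borel_measurable assms) simp
qed

lemma finite_subcover:
  assumes "\<And>p. p \<in> carrier G \<Longrightarrow> openin T (U p)" "\<And>p. p \<in> carrier G \<Longrightarrow> p \<in> U p"
  obtains F where "finite F" "F \<subseteq> carrier G" "carrier G \<subseteq> \<Union>(U ` F)"
proof -
  have "\<exists>\<F>. finite \<F> \<and> \<F> \<subseteq> U ` carrier G \<and> carrier G \<subseteq> \<Union>\<F>"
  proof (rule compactinD)
    show "compactin T (carrier G)" using compact_T by (simp add: compact_space_def topspace_T)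
    show "openin T W" if "W \<in> U ` carrier G" for W using that assms(1) by blast
    show "carrier G \<subseteq> \<Union>(U ` carrier G)" using assms(2) by blast
  qed
  then obtain \<F> where \<F>: "finite \<F>" "\<F> \<subseteq> U ` carrier G" "carrier G \<subseteq> \<Union>\<F>" by blast
  obtain F where "F \<subseteq> carrier G" "finite F" "\<F> = U ` F"
    using finite_subset_image[OF \<F>(1,2)] by blast
  then show thesis using that \<F>(3) by blast
qed

lemma l2_norm_le_sup:
  assumes "f \<in> borel_measurable M" "0 \<le> B" "\<And>x. x \<in> carrier G \<Longrightarrow> cmod (f x) \<le> B"
  shows "l2_norm M f \<le> B"
proof (rule power2_le_imp_le)
  show "(l2_norm M f)\<^sup>2 \<le> B\<^sup>2" using bounded_imp_l2(2)[of f B] assms by simp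
qed (use assms in simp)

lemma continuous_map_metric_iff:
  fixes f :: "'a \<Rightarrow> 'c::metric_space"
  shows "continuous_map T euclidean f \<longleftrightarrow>
    (\<forall>x\<in>carrier G. \<forall>e>0. \<exists>U. openin T U \<and> x \<in> U \<and> (\<forall>y\<in>U. dist (f y) (f x) < e))"
proof -
  have "continuous_map T euclidean f \<longleftrightarrow>
    (\<forall>x\<in>topspace T. \<forall>e>0. \<exists>U. openin T U \<and> x \<in> U \<and> (\<forall>y\<in>U. f y \<in> Met_TC.mball (f x) e))"
    using Met_TC.continuous_map_to_metric[of T f] by simp
  then show ?thesis by (simp add: topspace_T dist_commute)
qed

lemma cont_uniform_limit:
  assumes f: "\<And>n::nat. cont (f n)" and lim: "uniform_limit (carrier G) f z sequentially"
  shows "cont z" "(\<lambda>n. l2_norm M (\<lambda>x. f n x - z x)) \<longlonglongrightarrow> 0"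
proof -
  show z: "cont z"
    using Met_TC.continuous_map_uniform_limit_alt[where F = sequentially and X = T and f = f and g = z] f lim
    by (auto simp: uniform_limit_iff topspace_T)
  show "(\<lambda>n. l2_norm M (\<lambda>x. f n x - z x)) \<longlonglongrightarrow> 0"
  proof (rule tendstoI)
    fix e :: real assume e: "0 < e"
    have meas: "(\<lambda>x. f n x - z x) \<in> borel_measurable M" for n
      by (intro continuous_imp_borel_measurable continuous_map_diff f z)
    have "\<forall>\<^sub>F n in sequentially. \<forall>x\<in>carrier G. dist (f n x) (z x) < e / 2"
      using uniform_limitD[OF lim, of "e / 2"] e by simp
    then show "\<forall>\<^sub>F n in sequentially. dist (l2_norm M (\<lambda>x. f n x - z x)) 0 < e"
    proof eventually_elim
      case (elim n)
      then have "l2_norm M (\<lambda>x. f n x - z x) \<le> e / 2"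
        using e by (intro l2_norm_le_sup meas) (auto simp: dist_norm less_imp_le)
      then show ?case using e by simp
    qed
  qed
qed

lemma continuous_imp_measurable_M:
  assumes "continuous_map T T h"
  shows "h \<in> measurable M M"
proof (rule measurable_sigma_sets[OF sets_M])
  show "{U. openin T U} \<subseteq> Pow (topspace T)" using openin_subset by auto
  show "h \<in> space M \<rightarrow> topspace T" using assms by (auto simp: topspace_T continuous_map_def)
  fix U assume "U \<in> {U. openin T U}"
  then have "openin T {x \<in> topspace T. h x \<in> U}"
    using assms by (simp add: openin_continuous_map_preimage)
  moreover have "{x \<in> topspace T. h x \<in> U} = h -` U \<inter> space M" by (auto simp: topspace_T)
  ultimately show "h -` U \<inter> space M \<in> sets M" using open_sets_M by simp
qed

lemma continuous_map_mult:
  assumes "continuous_map X T f" "continuous_map X T g"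
  shows "continuous_map X T (\<lambda>x. f x \<otimes> g x)"
  using continuous_map_compose[OF continuous_map_pairedI[OF assms] mult_cont] by (simp add: o_def)

lemma continuous_map_inv: "continuous_map X T f \<Longrightarrow> continuous_map X T (\<lambda>x. inv (f x))"
  using continuous_map_compose[OF _ inv_cont] by (simp add: o_def)

lemma translation_cont: "g \<in> carrier G \<Longrightarrow> continuous_map T T (\<lambda>x. g \<otimes> x)"
  by (intro continuous_map_mult) (auto simp: topspace_T)

lemma cont_compose: "continuous_map T Z f \<Longrightarrow> continuous_map X T h \<Longrightarrow> continuous_map X Z (\<lambda>x. f (h x))"
  using continuous_map_compose[of X T h Z f] by (simp add: o_def)

lemma cont_translate: "cont f \<Longrightarrow> g \<in> carrier G \<Longrightarrow> cont (\<lambda>x. f (g \<otimes> x))"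
  by (rule cont_compose[OF _ translation_cont])

lemma distr_translation:
  assumes g: "g \<in> carrier G"
  shows "distr M M (\<lambda>x. g \<otimes> x) = M"
proof (rule measure_eqI)
  note meas = continuous_imp_measurable_M[OF translation_cont[OF g]]
  fix S assume "S \<in> sets (distr M M (\<lambda>x. g \<otimes> x))"
  then have S: "S \<in> sets M" by simp
  then have Sc: "S \<subseteq> carrier G" using sets.sets_into_space by fastforce
  have "(\<lambda>x. g \<otimes> x) -` S \<inter> space M = inv g <# S"
  proof -
    have "x \<in> inv g <# S" if "x \<in> carrier G" "g \<otimes> x \<in> S" for x
    proof -
      have "x = inv g \<otimes> (g \<otimes> x)" using g that(1) by (simp flip: m_assoc)
      then show ?thesis using that(2) unfolding l_coset_def by blast
    qed
    moreover have "x \<in> carrier G \<and> g \<otimes> x \<in> S" if x: "x \<in> inv g <# S" for x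
    proof -
      obtain s where "s \<in> S" "x = inv g \<otimes> s" using x by (auto simp: l_coset_def)
      moreover from this have "s \<in> carrier G" using Sc by blast
      ultimately show ?thesis using g by (simp flip: m_assoc)
    qed
    ultimately show ?thesis by auto
  qed
  then show "emeasure (distr M M (\<lambda>x. g \<otimes> x)) S = emeasure M S"
    using emeasure_distr[OF meas S] emeasure_coset[OF inv_closed[OF g] S] by simp
qed simp

lemma integral_translation:
  fixes f :: "'a \<Rightarrow> 'c::{banach, second_countable_topology}"
  assumes "g \<in> carrier G" "f \<in> borel_measurable M"
  shows "(LINT x|M. f (g \<otimes> x)) = (LINT x|M. f x)"
  using integral_distr[OF continuous_imp_measurable_M[OF translation_cont[OF assms(1)]] assms(2)]
  by (simp add: distr_translation[OF assms(1)])

lemma l2_inner_translation: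
  assumes g: "g \<in> carrier G" and "cont f" "cont h"
  shows "l2_inner M (\<lambda>x. f (g \<otimes> x)) (\<lambda>x. h (g \<otimes> x)) = l2_inner M f h"
proof -
  have "(\<lambda>x. f x * cnj (h x)) \<in> borel_measurable M"
    using borel_measurable_integrable[OF l2_integrable_mult] assms cont_l2 by blast
  then show ?thesis
    unfolding l2_inner_def using integral_translation[OF g, of "\<lambda>x. f x * cnj (h x)"] by simp
qed

text \<open>Finitely many translates of a nonempty open set cover the group.\<close>

lemma emeasure_open_pos:
  assumes U: "openin T U" "U \<noteq> {}"
  shows "emeasure M U \<noteq> 0"
proof
  assume null: "emeasure M U = 0"
  obtain u where u: "u \<in> U" using U by blast
  have Uc: "U \<subseteq> carrier G" using U(1) openin_subset topspace_T by fastforce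
  define V where "V x = {y \<in> carrier G. (u \<otimes> inv x) \<otimes> y \<in> U}" for x
  have V: "openin T (V x)" "x \<in> V x" "emeasure M (V x) = 0" if x: "x \<in> carrier G" for x
  proof -
    have g: "u \<otimes> inv x \<in> carrier G" using x u Uc by auto
    show "openin T (V x)"
      using openin_continuous_map_preimage[OF translation_cont[OF g] U(1)] by (simp add: V_def topspace_T)
    show "x \<in> V x" using x u Uc by (auto simp: V_def m_assoc)
    have "V x = (\<lambda>y. (u \<otimes> inv x) \<otimes> y) -` U \<inter> space M" by (auto simp: V_def)
    then show "emeasure M (V x) = 0"
      using emeasure_distr[OF continuous_imp_measurable_M[OF translation_cont[OF g]] open_sets_M[OF U(1)]]
      by (simp add: distr_translation[OF g] null)
  qed
  obtain F where F: "finite F" "F \<subseteq> carrier G" "carrier G \<subseteq> \<Union>(V ` F)"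
    using finite_subcover[of V] V(1,2) by blast
  have VF: "V ` F \<subseteq> sets M" using F(2) V(1) open_sets_M by blast
  have "emeasure M (carrier G) \<le> emeasure M (\<Union>(V ` F))"
    using F VF by (intro emeasure_mono sets.finite_UN) auto
  also have "\<dots> \<le> (\<Sum>p\<in>F. emeasure M (V p))"
    by (rule emeasure_subadditive_finite[OF F(1) VF])
  also have "\<dots> = 0" using F(2) V(3) by (intro sum.neutral) auto
  finally show False by (simp add: emeasure_total)
qed

lemma cont_null_imp_zero:
  assumes f: "cont f" and null: "l2_norm M f = 0" and x: "x \<in> carrier G"
  shows "f x = 0"
proof (rule ccontr)
  assume nz: "f x \<noteq> 0"
  let ?U = "{x \<in> topspace T. f x \<in> - {0}}"
  have U: "openin T ?U" using f by (intro openin_continuous_map_preimage) auto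
  have "AE x in M. f x = 0" using null cont_l2[OF f] by (simp add: l2_norm_eq_0_iff)
  then have "emeasure M ?U = 0"
    using emeasure_eq_0_AE[of "\<lambda>x. f x \<noteq> 0" M] by (simp add: topspace_T)
  then show False using emeasure_open_pos[OF U] nz x by (auto simp: topspace_T)
qed

text \<open>The tube lemma, applied to the compact fibre over \<open>x\<close>, gives a neighbourhood of \<open>x\<close> that works for all \<open>y\<close>
  at once.\<close>

lemma continuous_uniform_in_fibre:
  fixes F :: "'a \<times> 'a \<Rightarrow> 'c::metric_space"
  assumes F: "continuous_map (prod_topology T T) euclidean F" and x: "x \<in> carrier G" and e: "0 < e"
  obtains U where "openin T U" "x \<in> U" "\<And>x' y. x' \<in> U \<Longrightarrow> y \<in> carrier G \<Longrightarrow> dist (F (x', y)) (F (x, y)) < e"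
proof -
  let ?P = "prod_topology T T"
  define W where "W = {p \<in> topspace ?P. dist (F p) (F (x, snd p)) \<in> {..<e}}"
  have c: "continuous_map ?P euclidean (\<lambda>p. F (x, snd p))"
  proof -
    have "continuous_map ?P ?P (\<lambda>p. (x, snd p))"
      using x by (intro continuous_map_pairedI continuous_map_snd) (simp add: topspace_T)
    from continuous_map_compose[OF this F] show ?thesis by (simp add: o_def)
  qed
  have "continuous_map ?P euclideanreal (\<lambda>p. dist (F p) (F (x, snd p)))"
  proof -
    have "continuous_map ?P (prod_topology euclidean euclidean) (\<lambda>p. (F p, F (x, snd p)))"
      by (intro continuous_map_pairedI F c)
    from continuous_map_compose[OF this, of euclideanreal "\<lambda>(a, b). dist a b"]
    show ?thesis by (simp add: o_def split_beta continuous_on_dist continuous_on_fst continuous_on_snd)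
  qed
  then have W: "openin ?P W"
    unfolding W_def by (rule openin_continuous_map_preimage) simp
  have "{x} \<times> topspace T \<subseteq> W" using x e by (auto simp: W_def topspace_T)
  moreover have "compactin T (topspace T)" using compact_T by (simp add: compact_space_def)
  moreover have "x \<in> topspace T" using x by (simp add: topspace_T)
  ultimately obtain U V where UV: "openin T U" "x \<in> U" "topspace T \<subseteq> V" "U \<times> V \<subseteq> W"
    using tube_lemma_right[OF W, of "topspace T" x] by blast
  show thesis
  proof (rule that[OF UV(1,2)])
    fix x' y assume "x' \<in> U" "y \<in> carrier G"
    then have "(x', y) \<in> W" using UV(3,4) topspace_T by blast
    then show "dist (F (x', y)) (F (x, y)) < e" by (simp add: W_def)
  qed
qed

lemma continuous_fibre:
  assumes F: "continuous_map (prod_topology T T) Z F" and x: "x \<in> carrier G"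
  shows "continuous_map T Z (\<lambda>y. F (x, y))"
proof -
  have "continuous_map T (prod_topology T T) (\<lambda>y. (x, y))"
    using x by (intro continuous_map_pairedI) (auto simp: topspace_T)
  from continuous_map_compose[OF this F] show ?thesis by (simp add: o_def)
qed

lemma cont_integrable:
  assumes "cont f" shows "integrable M f"
proof -
  obtain B where "\<And>x. x \<in> carrier G \<Longrightarrow> cmod (f x) \<le> B" using continuous_bounded[OF assms] by blast
  then show ?thesis
    by (intro integrable_const_bound[of _ B] continuous_imp_borel_measurable assms) auto
qed

lemma integral_norm_le:
  fixes f :: "'a \<Rightarrow> complex"
  assumes "integrable M f" "\<And>x. x \<in> carrier G \<Longrightarrow> cmod (f x) \<le> B"
  shows "cmod (LINT x|M. f x) \<le> B"
proof -
  have "cmod (LINT x|M. f x) \<le> (LINT x|M. cmod (f x))" by (rule integral_norm_bound)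
  also have "\<dots> \<le> (LINT x|M. B)" using assms by (intro integral_mono) auto
  finally show ?thesis by simp
qed

lemma cont_parametric_integral:
  assumes F: "continuous_map (prod_topology T T) euclidean (F :: 'a \<times> 'a \<Rightarrow> complex)"
  shows "cont (\<lambda>x. LINT y|M. F (x, y))"
  unfolding continuous_map_metric_iff
proof (intro ballI allI impI)
  fix x and e :: real assume x: "x \<in> carrier G" and e: "0 < e"
  then obtain U where U: "openin T U" "x \<in> U"
    and b: "\<And>x' y. x' \<in> U \<Longrightarrow> y \<in> carrier G \<Longrightarrow> dist (F (x', y)) (F (x, y)) < e / 2"
    using continuous_uniform_in_fibre[OF F x, of "e / 2"] by auto
  have "dist (LINT y|M. F (x', y)) (LINT y|M. F (x, y)) < e" if x': "x' \<in> U" for x'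
  proof -
    have "x' \<in> carrier G" using U(1) x' openin_subset topspace_T by fastforce
    then have i: "integrable M (\<lambda>y. F (x', y))" "integrable M (\<lambda>y. F (x, y))"
      using x by (auto intro!: cont_integrable continuous_fibre[OF F])
    have "dist (LINT y|M. F (x', y)) (LINT y|M. F (x, y)) = cmod (LINT y|M. F (x', y) - F (x, y))"
      using i by (simp add: dist_norm)
    also have "\<dots> \<le> e / 2"
      using i b[OF x'] by (intro integral_norm_le) (auto simp: dist_norm less_imp_le)
    finally show ?thesis using e by simp
  qed
  with U show "\<exists>U. openin T U \<and> x \<in> U \<and> (\<forall>y\<in>U. dist (LINT ya|M. F (y, ya)) (LINT y|M. F (x, y)) < e)"
    by blast
qed

text \<open>Second countability makes open sets of the product countable unions of open rectangles.\<close>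

lemma continuous_measurable_pair:
  assumes F: "continuous_map (prod_topology T T) euclidean F"
  shows "F \<in> borel_measurable (M \<Otimes>\<^sub>M M)"
proof (rule borel_measurableI)
  fix S :: "'c set" assume "open S"
  let ?W = "{p \<in> topspace (prod_topology T T). F p \<in> S}"
  have W: "openin (prod_topology T T) ?W"
    using F \<open>open S\<close> by (intro openin_continuous_map_preimage) auto
  obtain \<B> where B: "countable \<B>" "\<And>V. V \<in> \<B> \<Longrightarrow> openin T V"
    "\<And>U x. openin T U \<Longrightarrow> x \<in> U \<Longrightarrow> \<exists>V\<in>\<B>. x \<in> V \<and> V \<subseteq> U"
    using second_countable_T unfolding second_countable_def by metis
  let ?R = "{(U, V). U \<in> \<B> \<and> V \<in> \<B> \<and> U \<times> V \<subseteq> ?W}"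
  have "?W = (\<Union>(U, V)\<in>?R. U \<times> V)"
  proof
    show "?W \<subseteq> (\<Union>(U, V)\<in>?R. U \<times> V)"
    proof
      fix p assume p: "p \<in> ?W"
      obtain x y where xy: "p = (x, y)" by force
      then have "(x, y) \<in> ?W" using p by simp
      from W[unfolded openin_prod_topology_alt, rule_format, OF this]
      obtain U V where UV: "openin T U" "openin T V" "x \<in> U" "y \<in> V" "U \<times> V \<subseteq> ?W"
        by (elim exE conjE)
      obtain U' where U': "U' \<in> \<B>" "x \<in> U'" "U' \<subseteq> U" using B(3)[OF UV(1,3)] by blast
      obtain V' where V': "V' \<in> \<B>" "y \<in> V'" "V' \<subseteq> V" using B(3)[OF UV(2,4)] by blast
      have "(U', V') \<in> ?R" using U' V' UV(5) by blast
      then show "p \<in> (\<Union>(U, V)\<in>?R. U \<times> V)"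
        by (rule UN_I) (simp add: xy U'(2) V'(2))
    qed
  qed blast
  moreover have "(\<Union>(U, V)\<in>?R. U \<times> V) \<in> sets (M \<Otimes>\<^sub>M M)"
  proof (intro sets.countable_UN'' )
    show "countable ?R" by (rule countable_subset[of _ "\<B> \<times> \<B>"]) (use B(1) in auto)
    fix p assume "p \<in> ?R"
    then show "(case p of (U, V) \<Rightarrow> U \<times> V) \<in> sets (M \<Otimes>\<^sub>M M)"
      using B(2) open_sets_M by auto
  qed
  moreover have "?W = F -` S \<inter> space (M \<Otimes>\<^sub>M M)"
    by (auto simp: space_pair_measure topspace_T)
  ultimately show "F -` S \<inter> space (M \<Otimes>\<^sub>M M) \<in> sets (M \<Otimes>\<^sub>M M)" by simp
qed


section \<open>Convolution operators\<close>

text \<open>A convolution operator is written so that it visibly commutes with left translations; the change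
  of variables in \<open>conv_eq_kernel\<close> exhibits its kernel \<open>\<phi> (x\<^sup>-\<^sup>1 y)\<close>.  Values off the group are set
  to \<open>0\<close>, which makes the operator linear as a map of functions.\<close>

definition conv :: "('a \<Rightarrow> real) \<Rightarrow> ('a \<Rightarrow> complex) \<Rightarrow> 'a \<Rightarrow> complex" where
  "conv \<phi> f x = (if x \<in> carrier G then LINT z|M. of_real (\<phi> z) * f (x \<otimes> z) else 0)"

definition symmetric_kernel :: "('a \<Rightarrow> real) \<Rightarrow> bool" where
  "symmetric_kernel \<phi> \<longleftrightarrow> continuous_map T euclideanreal \<phi> \<and> (\<forall>x\<in>carrier G. \<phi> (inv x) = \<phi> x)"

lemma cont_of_real: "continuous_map T euclideanreal \<phi> \<Longrightarrow> cont (\<lambda>x. of_real (\<phi> x))"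
  using continuous_map_compose[of T euclideanreal \<phi> euclidean complex_of_real]
  by (simp add: o_def continuous_on_of_real)

lemma kernel_continuous:
  assumes "continuous_map T euclideanreal \<phi>"
  shows "continuous_map (prod_topology T T) euclidean (\<lambda>p. complex_of_real (\<phi> (inv (fst p) \<otimes> snd p)))"
  by (rule cont_compose[OF cont_of_real[OF assms]])
     (intro continuous_map_mult continuous_map_inv continuous_map_fst continuous_map_snd)

lemma kernel_section:
  assumes "continuous_map T euclideanreal \<phi>" "x \<in> carrier G"
  shows "cont (\<lambda>y. of_real (\<phi> (inv x \<otimes> y)))"
  using continuous_fibre[OF kernel_continuous[OF assms(1)] assms(2)] by simp

lemma conv_eq_kernel:
  assumes \<phi>: "continuous_map T euclideanreal \<phi>" and f: "f \<in> borel_measurable M" and x: "x \<in> carrier G"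
  shows "conv \<phi> f x = (LINT y|M. of_real (\<phi> (inv x \<otimes> y)) * f y)"
proof -
  have "(\<lambda>y. of_real (\<phi> (inv x \<otimes> y)) * f y) \<in> borel_measurable M"
    by (intro borel_measurable_times f continuous_imp_borel_measurable[OF kernel_section[OF \<phi> x]])
  from integral_translation[OF x this]
  have "(LINT y|M. of_real (\<phi> (inv x \<otimes> y)) * f y) = (LINT z|M. of_real (\<phi> (inv x \<otimes> (x \<otimes> z))) * f (x \<otimes> z))"
    by simp
  also have "\<dots> = (LINT z|M. of_real (\<phi> z) * f (x \<otimes> z))"
  proof (rule Bochner_Integration.integral_cong[OF refl])
    fix z assume "z \<in> space M"
    then have "inv x \<otimes> (x \<otimes> z) = z" using x by (simp flip: m_assoc)
    then show "of_real (\<phi> (inv x \<otimes> (x \<otimes> z))) * f (x \<otimes> z) = of_real (\<phi> z) * f (x \<otimes> z)" by simp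
  qed
  finally show ?thesis using x by (simp add: conv_def)
qed

lemma conv_eq_inner:
  assumes \<phi>: "continuous_map T euclideanreal \<phi>" and f: "f \<in> borel_measurable M" and x: "x \<in> carrier G"
  shows "conv \<phi> f x = l2_inner M f (\<lambda>y. of_real (\<phi> (inv x \<otimes> y)))"
  unfolding conv_eq_kernel[OF assms] l2_inner_def by (simp add: mult.commute)

lemma conv_lincomb:
  assumes \<phi>: "continuous_map T euclideanreal \<phi>" and f: "f \<in> l2 M" and g: "g \<in> l2 M"
  shows "conv \<phi> (\<lambda>x. a * f x + b * g x) = (\<lambda>x. a * conv \<phi> f x + b * conv \<phi> g x)"
proof
  fix x
  show "conv \<phi> (\<lambda>x. a * f x + b * g x) x = a * conv \<phi> f x + b * conv \<phi> g x"
  proof (cases "x \<in> carrier G")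
    case True
    then show ?thesis
      using f g l2_lincomb[OF f g, of a b] cont_l2[OF kernel_section[OF \<phi> True]]
      by (simp add: conv_eq_inner[OF \<phi> l2_measurable] l2_inner_lincomb_left)
  qed (simp add: conv_def)
qed

lemma conv_sup_bound:
  assumes \<phi>: "continuous_map T euclideanreal \<phi>"
  obtains B where "0 \<le> B" "\<And>f x. f \<in> l2 M \<Longrightarrow> cmod (conv \<phi> f x) \<le> B * l2_norm M f"
    "\<And>x. x \<in> carrier G \<Longrightarrow> l2_norm M (\<lambda>y. of_real (\<phi> (inv x \<otimes> y))) \<le> B"
proof -
  obtain B where B: "0 \<le> B" "\<And>x. x \<in> carrier G \<Longrightarrow> \<bar>\<phi> x\<bar> \<le> B"
    using continuous_bounded[OF \<phi>] by auto
  have k: "l2_norm M (\<lambda>y. of_real (\<phi> (inv x \<otimes> y))) \<le> B" if x: "x \<in> carrier G" for x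
    using B x by (intro l2_norm_le_sup continuous_imp_borel_measurable kernel_section[OF \<phi> x]) auto
  have "cmod (conv \<phi> f x) \<le> B * l2_norm M f" if f: "f \<in> l2 M" for f x
  proof (cases "x \<in> carrier G")
    case True
    have "cmod (conv \<phi> f x) \<le> l2_norm M f * l2_norm M (\<lambda>y. of_real (\<phi> (inv x \<otimes> y)))"
      unfolding conv_eq_inner[OF \<phi> l2_measurable[OF f] True]
      by (rule l2_Cauchy_Schwarz[OF f cont_l2[OF kernel_section[OF \<phi> True]]])
    also have "\<dots> \<le> l2_norm M f * B" using k[OF True] by (intro mult_left_mono) auto
    finally show ?thesis by (simp add: mult.commute)
  qed (simp add: conv_def B)
  then show thesis by (rule that[OF B(1) _ k])
qed

text \<open>The neighbourhood depends on the kernel alone, so that the images of a bounded set are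
  equicontinuous.\<close>

lemma conv_equicontinuous:
  assumes \<phi>: "continuous_map T euclideanreal \<phi>" and x: "x \<in> carrier G" and e: "0 < e"
  obtains U where "openin T U" "x \<in> U"
    "\<And>f x'. f \<in> l2 M \<Longrightarrow> x' \<in> U \<Longrightarrow> cmod (conv \<phi> f x' - conv \<phi> f x) \<le> e * l2_norm M f"
proof -
  obtain U where U: "openin T U" "x \<in> U"
    and d: "\<And>x' y. x' \<in> U \<Longrightarrow> y \<in> carrier G \<Longrightarrow>
      dist (complex_of_real (\<phi> (inv x' \<otimes> y))) (of_real (\<phi> (inv x \<otimes> y))) < e"
    using continuous_uniform_in_fibre[OF kernel_continuous[OF \<phi>] x e] by auto
  have "cmod (conv \<phi> f x' - conv \<phi> f x) \<le> e * l2_norm M f" if f: "f \<in> l2 M" and x': "x' \<in> U" for f x'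
  proof -
    have x'c: "x' \<in> carrier G" using U(1) x' openin_subset topspace_T by fastforce
    let ?k = "\<lambda>x y. complex_of_real (\<phi> (inv x \<otimes> y))"
    have kc: "cont (?k x')" "cont (?k x)" using kernel_section[OF \<phi>] x x'c by auto
    have "conv \<phi> f x' - conv \<phi> f x = l2_inner M f (\<lambda>y. ?k x' y - ?k x y)"
      using x x'c f by (simp add: conv_eq_inner[OF \<phi> l2_measurable] l2_inner_diff_right cont_l2 kc)
    also have "cmod \<dots> \<le> l2_norm M f * l2_norm M (\<lambda>y. ?k x' y - ?k x y)"
      by (intro l2_Cauchy_Schwarz f l2_diff cont_l2 kc)
    also have "\<dots> \<le> l2_norm M f * e"
    proof (intro mult_left_mono l2_norm_le_sup continuous_imp_borel_measurable continuous_map_diff kc)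
      fix y assume "y \<in> carrier G"
      then show "cmod (?k x' y - ?k x y) \<le> e" using d[OF x'] by (simp add: dist_norm less_imp_le)
    qed (use e in auto)
    finally show ?thesis by (simp add: mult.commute)
  qed
  then show thesis by (rule that[OF U])
qed

lemma conv_cont:
  assumes \<phi>: "continuous_map T euclideanreal \<phi>" and f: "f \<in> l2 M"
  shows "cont (conv \<phi> f)"
  unfolding continuous_map_metric_iff
proof (intro ballI allI impI)
  fix x and e :: real assume x: "x \<in> carrier G" and e: "0 < e"
  let ?d = "e / (l2_norm M f + 1)"
  have d: "0 < ?d" using e by (simp add: add_nonneg_pos)
  obtain U where U: "openin T U" "x \<in> U"
    "\<And>f x'. f \<in> l2 M \<Longrightarrow> x' \<in> U \<Longrightarrow> cmod (conv \<phi> f x' - conv \<phi> f x) \<le> ?d * l2_norm M f"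
    using conv_equicontinuous[OF \<phi> x d] by blast
  have "?d * l2_norm M f < ?d * (l2_norm M f + 1)"
    using d by (intro mult_strict_left_mono) auto
  also have "\<dots> = e"
  proof -
    have "0 < l2_norm M f + 1" by (simp add: add_nonneg_pos)
    then show ?thesis by simp
  qed
  finally have less: "?d * l2_norm M f < e" .
  show "\<exists>U. openin T U \<and> x \<in> U \<and> (\<forall>y\<in>U. dist (conv \<phi> f y) (conv \<phi> f x) < e)"
  proof (intro exI[of _ U] conjI ballI U(1,2))
    fix y assume "y \<in> U"
    from le_less_trans[OF U(3)[OF f this] less] show "dist (conv \<phi> f y) (conv \<phi> f x) < e"
      by (simp add: dist_norm)
  qed
qed

lemma conv_l2_bound:
  assumes "continuous_map T euclideanreal \<phi>"
  obtains B where "0 \<le> B" "\<And>f. f \<in> l2 M \<Longrightarrow> l2_norm M (conv \<phi> f) \<le> B * l2_norm M f"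
proof -
  obtain B where B: "0 \<le> B" "\<And>f x. f \<in> l2 M \<Longrightarrow> cmod (conv \<phi> f x) \<le> B * l2_norm M f"
    "\<And>x. x \<in> carrier G \<Longrightarrow> l2_norm M (\<lambda>y. of_real (\<phi> (inv x \<otimes> y))) \<le> B"
    by (rule conv_sup_bound[OF assms]) (rule that)
  show thesis
  proof (rule that[OF B(1)])
    fix f assume f: "f \<in> l2 M"
    show "l2_norm M (conv \<phi> f) \<le> B * l2_norm M f"
      by (intro l2_norm_le_sup continuous_imp_borel_measurable conv_cont[OF assms f] B(2)[OF f] mult_nonneg_nonneg B(1)) simp
  qed
qed

text \<open>Fubini's theorem, since \<open>\<phi> (x\<^sup>-\<^sup>1 y) = \<phi> (y\<^sup>-\<^sup>1 x)\<close>.\<close>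

lemma conv_selfadjoint:
  assumes \<phi>: "symmetric_kernel \<phi>" and f: "cont f" and g: "cont g"
  shows "l2_inner M (conv \<phi> f) g = l2_inner M f (conv \<phi> g)"
proof -
  have c: "continuous_map T euclideanreal \<phi>" and sym: "\<And>x. x \<in> carrier G \<Longrightarrow> \<phi> (inv x) = \<phi> x"
    using \<phi> by (auto simp: symmetric_kernel_def)
  interpret pair_sigma_finite M M ..
  interpret P: finite_measure "M \<Otimes>\<^sub>M M"
    by (rule finite_measure_pair_measure) unfold_locales
  let ?k = "\<lambda>x y. complex_of_real (\<phi> (inv x \<otimes> y))"
  let ?F = "\<lambda>p. ?k (fst p) (snd p) * f (snd p) * cnj (g (fst p))"
  have cnjg: "cont (\<lambda>x. cnj (g x))"
    using continuous_map_compose[OF g, of euclidean cnj] by (simp add: o_def continuous_on_cnj)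
  have meas: "?F \<in> borel_measurable (M \<Otimes>\<^sub>M M)"
    by (intro borel_measurable_times continuous_measurable_pair kernel_continuous[OF c]
        cont_compose[OF f continuous_map_snd] cont_compose[OF cnjg continuous_map_fst])
  obtain A where A: "0 \<le> A" "\<And>x. x \<in> carrier G \<Longrightarrow> cmod (of_real (\<phi> x)) \<le> A" using continuous_bounded[OF cont_of_real[OF c]] by blast
  obtain B where B: "0 \<le> B" "\<And>x. x \<in> carrier G \<Longrightarrow> cmod (f x) \<le> B" using continuous_bounded[OF f] by blast
  obtain C where C: "0 \<le> C" "\<And>x. x \<in> carrier G \<Longrightarrow> cmod (g x) \<le> C" using continuous_bounded[OF g] by blast
  have "integrable (M \<Otimes>\<^sub>M M) ?F"
  proof (rule P.integrable_const_bound[OF AE_I2 meas])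
    fix p assume "p \<in> space (M \<Otimes>\<^sub>M M)"
    then have p: "fst p \<in> carrier G" "snd p \<in> carrier G" by (auto simp: space_pair_measure)
    have "cmod (?k (fst p) (snd p)) \<le> A" using A(2)[of "inv (fst p) \<otimes> snd p"] p by simp
    then show "cmod (?F p) \<le> A * B * C"
      unfolding norm_mult complex_mod_cnj using A(1) B C p by (intro mult_mono) auto
  qed
  then have int: "integrable (M \<Otimes>\<^sub>M M) (\<lambda>(x, y). ?k x y * f y * cnj (g x))"
    by (simp only: case_prod_unfold)
  have "l2_inner M (conv \<phi> f) g = (LINT x|M. LINT y|M. ?k x y * f y * cnj (g x))"
    unfolding l2_inner_def
    by (intro Bochner_Integration.integral_cong refl)
       (simp add: conv_eq_kernel[OF c continuous_imp_borel_measurable[OF f]])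
  also have "\<dots> = (LINT y|M. LINT x|M. ?k x y * f y * cnj (g x))"
    using Fubini_integral[OF int] by simp
  also have "\<dots> = (LINT y|M. f y * cnj (conv \<phi> g y))"
  proof (intro Bochner_Integration.integral_cong refl)
    fix y assume "y \<in> space M"
    then have y: "y \<in> carrier G" by simp
    have "(LINT x|M. ?k x y * f y * cnj (g x)) = (LINT x|M. f y * cnj (of_real (\<phi> (inv y \<otimes> x)) * g x))"
    proof (intro Bochner_Integration.integral_cong refl)
      fix x assume "x \<in> space M"
      then have x: "x \<in> carrier G" by simp
      have "\<phi> (inv x \<otimes> y) = \<phi> (inv y \<otimes> x)"
        using sym[of "inv x \<otimes> y"] x y by (simp add: inv_mult_group)
      then show "?k x y * f y * cnj (g x) = f y * cnj (of_real (\<phi> (inv y \<otimes> x)) * g x)" by simp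
    qed
    also have "\<dots> = f y * cnj (conv \<phi> g y)"
      by (simp only: conv_eq_kernel[OF c continuous_imp_borel_measurable[OF g] y]
          integral_mult_right_zero Bochner_Integration.integral_cnj)
    finally show "(LINT x|M. ?k x y * f y * cnj (g x)) = f y * cnj (conv \<phi> g y)" .
  qed
  finally show ?thesis by (simp add: l2_inner_def)
qed

lemma conv_translate:
  assumes "g \<in> carrier G" "x \<in> carrier G"
  shows "conv \<phi> (\<lambda>x. f (g \<otimes> x)) x = conv \<phi> f (g \<otimes> x)"
  using assms by (auto simp: conv_def m_assoc intro!: Bochner_Integration.integral_cong)

text \<open>Arzela--Ascoli for the images of a bounded sequence: a countable set \<open>D\<close> of points contains, for every
  \<open>\<epsilon>\<close>, a finite \<open>\<epsilon>\<close>-net with respect to the common modulus of continuity, and on \<open>D\<close> a diagonal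
  subsequence converges.\<close>

lemma conv_compact:
  assumes \<phi>: "continuous_map T euclideanreal \<phi>"
    and w: "\<And>n::nat. w n \<in> l2 M \<and> l2_norm M (w n) \<le> 1"
  obtains k z where "strict_mono k" "uniform_limit (carrier G) (\<lambda>n. conv \<phi> (w (k n))) z sequentially"
proof -
  have net: "\<exists>F. finite F \<and> F \<subseteq> carrier G \<and>
      (\<forall>x\<in>carrier G. \<exists>p\<in>F. \<forall>n. cmod (conv \<phi> (w n) x - conv \<phi> (w n) p) \<le> e)" if e: "0 < e" for e :: real
  proof -
    have "\<forall>p\<in>carrier G. \<exists>U. openin T U \<and> p \<in> U \<and> (\<forall>x\<in>U. \<forall>n. cmod (conv \<phi> (w n) x - conv \<phi> (w n) p) \<le> e)"
    proof
      fix p assume p: "p \<in> carrier G"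
      obtain U where U: "openin T U" "p \<in> U"
        "\<And>f x. f \<in> l2 M \<Longrightarrow> x \<in> U \<Longrightarrow> cmod (conv \<phi> f x - conv \<phi> f p) \<le> e * l2_norm M f"
        using conv_equicontinuous[OF \<phi> p e] by blast
      have "cmod (conv \<phi> (w n) x - conv \<phi> (w n) p) \<le> e" if "x \<in> U" for x n
      proof -
        have "e * l2_norm M (w n) \<le> e * 1" using w[of n] e by (intro mult_left_mono) auto
        then show ?thesis using U(3)[of "w n" x] w[of n] that by simp
      qed
      with U show "\<exists>U. openin T U \<and> p \<in> U \<and> (\<forall>x\<in>U. \<forall>n. cmod (conv \<phi> (w n) x - conv \<phi> (w n) p) \<le> e)" by blast
    qed
    then obtain U where U: "\<And>p. p \<in> carrier G \<Longrightarrow> openin T (U p) \<and> p \<in> U p \<and>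
        (\<forall>x\<in>U p. \<forall>n. cmod (conv \<phi> (w n) x - conv \<phi> (w n) p) \<le> e)"
      by metis
    obtain F where F: "finite F" "F \<subseteq> carrier G" "carrier G \<subseteq> \<Union>(U ` F)"
      using finite_subcover[of U] U by blast
    have "\<exists>p\<in>F. \<forall>n. cmod (conv \<phi> (w n) x - conv \<phi> (w n) p) \<le> e" if x: "x \<in> carrier G" for x
    proof -
      obtain p where "p \<in> F" "x \<in> U p" using F(3) x by blast
      then show ?thesis using U F(2) by blast
    qed
    with F show ?thesis by blast
  qed
  have "\<forall>m::nat. \<exists>F. finite F \<and> F \<subseteq> carrier G \<and>
      (\<forall>x\<in>carrier G. \<exists>p\<in>F. \<forall>n. cmod (conv \<phi> (w n) x - conv \<phi> (w n) p) \<le> 1 / Suc m)"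
    using net by simp
  then obtain F where F: "\<And>m::nat. finite (F m)" "\<And>m. F m \<subseteq> carrier G"
    "\<And>m x. x \<in> carrier G \<Longrightarrow> \<exists>p\<in>F m. \<forall>n. cmod (conv \<phi> (w n) x - conv \<phi> (w n) p) \<le> 1 / Suc m"
    by metis
  define D where "D = (\<Union>m. F m)"
  have D: "countable D" unfolding D_def using F(1) by (intro countable_UN) (auto intro: countable_finite)
  obtain B where B: "0 \<le> B" "\<And>f x. f \<in> l2 M \<Longrightarrow> cmod (conv \<phi> f x) \<le> B * l2_norm M f"
    "\<And>x. x \<in> carrier G \<Longrightarrow> l2_norm M (\<lambda>y. of_real (\<phi> (inv x \<otimes> y))) \<le> B"
    by (rule conv_sup_bound[OF \<phi>]) (rule that)
  have "cmod (conv \<phi> (w n) x) \<le> B" for n x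
  proof -
    have "B * l2_norm M (w n) \<le> B * 1" using w[of n] B(1) by (intro mult_left_mono) auto
    then show ?thesis using B(2)[of "w n" x] w[of n] by simp
  qed
  then obtain k :: "nat \<Rightarrow> nat" where k: "strict_mono k"
    and conv: "\<And>x. x \<in> D \<Longrightarrow> \<exists>l. (\<lambda>n. conv \<phi> (w (k n)) x) \<longlonglongrightarrow> l"
    using function_convergent_subsequence[OF D, of "\<lambda>n. conv \<phi> (w n)" B] by blast
  have "uniformly_Cauchy_on (carrier G) (\<lambda>n. conv \<phi> (w (k n)))"
    unfolding uniformly_Cauchy_on_def
  proof (intro allI impI)
    fix e :: real assume e: "0 < e"
    obtain m :: nat where m: "1 / Suc m < e / 3" using e nat_approx_posE[of "e / 3"] by auto
    have "\<forall>p\<in>F m. \<exists>N. \<forall>i\<ge>N. \<forall>j\<ge>N. dist (conv \<phi> (w (k i)) p) (conv \<phi> (w (k j)) p) < e / 3"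
    proof
      fix p assume "p \<in> F m"
      then have "Cauchy (\<lambda>n. conv \<phi> (w (k n)) p)"
        using conv by (intro convergent_Cauchy) (auto simp: D_def convergent_def)
      then show "\<exists>N. \<forall>i\<ge>N. \<forall>j\<ge>N. dist (conv \<phi> (w (k i)) p) (conv \<phi> (w (k j)) p) < e / 3"
        by (rule metric_CauchyD) (use e in simp)
    qed
    then obtain N where N: "\<And>p i j. p \<in> F m \<Longrightarrow> N p \<le> i \<Longrightarrow> N p \<le> j \<Longrightarrow>
        dist (conv \<phi> (w (k i)) p) (conv \<phi> (w (k j)) p) < e / 3"
      by metis
    define N0 where "N0 = (\<Sum>p\<in>F m. N p)"
    have NN0: "N p \<le> N0" if "p \<in> F m" for p
      unfolding N0_def using that F(1) by (intro member_le_sum) auto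
    have "dist (conv \<phi> (w (k i)) x) (conv \<phi> (w (k j)) x) < e" if x: "x \<in> carrier G" and ij: "N0 \<le> i" "N0 \<le> j" for x i j
    proof -
      obtain p where p: "p \<in> F m" "\<And>n. cmod (conv \<phi> (w n) x - conv \<phi> (w n) p) \<le> 1 / Suc m" using F(3)[OF x] by blast
      have "dist (conv \<phi> (w (k i)) p) (conv \<phi> (w (k j)) p) < e / 3"
        using N[OF p(1)] NN0[OF p(1)] ij by simp
      moreover have "dist (conv \<phi> (w (k i)) x) (conv \<phi> (w (k i)) p) < e / 3"
        "dist (conv \<phi> (w (k j)) x) (conv \<phi> (w (k j)) p) < e / 3"
        unfolding dist_norm by (rule le_less_trans[OF p(2) m])+
      ultimately show ?thesis
        using dist_triangle_third[of "conv \<phi> (w (k i)) x" "conv \<phi> (w (k i)) p" e "conv \<phi> (w (k j)) p" "conv \<phi> (w (k j)) x"]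
        by (simp add: dist_commute)
    qed
    then show "\<exists>M. \<forall>x\<in>carrier G. \<forall>m\<ge>M. \<forall>n\<ge>M. dist (conv \<phi> (w (k m)) x) (conv \<phi> (w (k n)) x) < e"
      by blast
  qed
  then have "uniformly_convergent_on (carrier G) (\<lambda>n. conv \<phi> (w (k n)))"
    by (rule Cauchy_uniformly_convergent)
  then show thesis using k that unfolding uniformly_convergent_on_def by blast
qed

text \<open>The kernel is a symmetrised Urysohn function with integral \<open>1\<close>, supported in a neighbourhood of the unit
  in which right translation moves \<open>f\<close> by at most \<open>e\<close>, uniformly on the group.\<close>

lemma approximate_identity:
  assumes f: "cont f" and e: "0 < e"
  obtains \<phi> where "symmetric_kernel \<phi>" "\<And>x. x \<in> carrier G \<Longrightarrow> cmod (conv \<phi> f x - f x) \<le> e"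
proof -
  (* the factors are swapped so that z, which tends to the unit, is the parameter and x runs in the compact fibre *)
  have "continuous_map (prod_topology T T) euclidean (\<lambda>p. f (snd p \<otimes> fst p))"
    by (rule cont_compose[OF f]) (intro continuous_map_mult continuous_map_fst continuous_map_snd)
  then obtain U where U: "openin T U" "\<one> \<in> U"
    and d: "\<And>z x. z \<in> U \<Longrightarrow> x \<in> carrier G \<Longrightarrow> dist (f (x \<otimes> z)) (f (x \<otimes> \<one>)) < e"
    using continuous_uniform_in_fibre[of "\<lambda>p. f (snd p \<otimes> fst p)" \<one> e] e by auto
  define V where "V = U \<inter> {x \<in> topspace T. inv x \<in> U}"
  have V: "openin T V" "\<one> \<in> V" "V \<subseteq> carrier G"
    using U openin_continuous_map_preimage[OF inv_cont U(1)] by (auto simp: V_def topspace_T)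
  have Vinv: "inv x \<in> V \<longleftrightarrow> x \<in> V" if "x \<in> carrier G" for x
    using that U(1) openin_subset by (auto simp: V_def topspace_T)
  have normal: "normal_space T" and t1: "t1_space T"
    using compact_T Hausdorff_T
    by (auto simp: compact_Hausdorff_or_regular_imp_normal_space Hausdorff_imp_t1_space)
  obtain \<psi> where \<psi>: "continuous_map T (top_of_set {0..1::real}) \<psi>" "\<psi> ` (carrier G - V) \<subseteq> {0}" "\<psi> ` {\<one>} \<subseteq> {1}"
  proof (rule Urysohn_lemma[OF normal, of "carrier G - V" "{\<one>}" "0::real" 1])
    show "closedin T (carrier G - V)" using V(1) by (simp add: topspace_T[symmetric] closedin_diff)
    show "closedin T {\<one>}" using t1 by (simp add: closedin_t1_singleton topspace_T)
    show "disjnt (carrier G - V) {\<one>}" using V by auto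
  qed auto
  have \<psi>c: "continuous_map T euclideanreal \<psi>" and \<psi>01: "\<And>x. x \<in> carrier G \<Longrightarrow> 0 \<le> \<psi> x \<and> \<psi> x \<le> 1"
    using \<psi>(1) by (auto simp: continuous_map_in_subtopology topspace_T)
  define \<theta> where "\<theta> x = \<psi> x + \<psi> (inv x)" for x
  have \<theta>c: "continuous_map T euclideanreal \<theta>"
    unfolding \<theta>_def by (intro continuous_map_add \<psi>c cont_compose[OF \<psi>c inv_cont])
  have \<theta>0: "0 \<le> \<theta> x" if "x \<in> carrier G" for x using \<psi>01 that by (simp add: \<theta>_def)
  have \<theta>V: "\<theta> x = 0" if "x \<in> carrier G" "x \<notin> V" for x
    using that \<psi>(2) Vinv[OF that(1)] by (auto simp: \<theta>_def image_subset_iff)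
  have \<theta>i: "integrable M \<theta>"
  proof -
    obtain B where "\<And>x. x \<in> carrier G \<Longrightarrow> norm (\<theta> x) \<le> B" using continuous_bounded[OF \<theta>c] by blast
    then show ?thesis by (intro integrable_const_bound[of _ B] continuous_imp_borel_measurable[OF \<theta>c]) auto
  qed
  define c where "c = (LINT x|M. \<theta> x)"
  have c: "0 < c"
  proof -
    have "c \<noteq> 0"
    proof
      assume "c = 0"
      then have "AE x in M. \<theta> x = 0"
        using \<theta>0 \<theta>i by (subst (asm) c_def, subst (asm) integral_nonneg_eq_0_iff_AE) auto
      then have "emeasure M {x \<in> space M. \<theta> x \<noteq> 0} = 0"
        using emeasure_eq_0_AE[of "\<lambda>x. \<theta> x \<noteq> 0" M] by simp
      moreover have "openin T {x \<in> topspace T. \<theta> x \<in> - {0}}"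
        using \<theta>c by (intro openin_continuous_map_preimage) auto
      moreover have "\<theta> \<one> \<noteq> 0" using \<psi>(3) by (simp add: \<theta>_def)
      ultimately show False using emeasure_open_pos[of "{x \<in> topspace T. \<theta> x \<in> - {0}}"] by (auto simp: topspace_T)
    qed
    moreover have "0 \<le> c" unfolding c_def using \<theta>0 by (intro integral_nonneg_AE) auto
    ultimately show ?thesis by simp
  qed
  define \<phi> where "\<phi> x = \<theta> x / c" for x
  have \<phi>c: "continuous_map T euclideanreal \<phi>"
    unfolding \<phi>_def using c by (intro continuous_map_real_divide \<theta>c) auto
  have sk: "symmetric_kernel \<phi>"
    using \<phi>c by (auto simp: symmetric_kernel_def \<phi>_def \<theta>_def)
  have int1: "(LINT z|M. \<phi> z) = 1" using c by (simp add: \<phi>_def c_def)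
  have \<phi>i: "integrable M \<phi>" unfolding \<phi>_def using \<theta>i by simp
  have "cmod (conv \<phi> f x - f x) \<le> e" if x: "x \<in> carrier G" for x
  proof -
    have i1: "integrable M (\<lambda>z. of_real (\<phi> z) * f (x \<otimes> z))"
    proof -
      have "(\<lambda>z. of_real (\<phi> z) * f (x \<otimes> z)) = (\<lambda>z. f (x \<otimes> z) * cnj (of_real (\<phi> z)))" by (simp add: mult.commute)
      then show ?thesis
        using l2_integrable_mult[OF cont_l2[OF cont_translate[OF f x]] cont_l2[OF cont_of_real[OF \<phi>c]]] by simp
    qed
    have i2: "integrable M (\<lambda>z. of_real (\<phi> z) * f x)" using \<phi>i by simp
    have "conv \<phi> f x - f x = (LINT z|M. of_real (\<phi> z) * f (x \<otimes> z)) - (LINT z|M. of_real (\<phi> z) * f x)"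
      using x int1 by (simp add: conv_def)
    also have "\<dots> = (LINT z|M. of_real (\<phi> z) * (f (x \<otimes> z) - f x))"
      using i1 i2 by (simp add: right_diff_distrib)
    also have "cmod \<dots> \<le> (LINT z|M. cmod (of_real (\<phi> z) * (f (x \<otimes> z) - f x)))" by (rule integral_norm_bound)
    also have "\<dots> \<le> (LINT z|M. \<phi> z * e)"
    proof (rule integral_mono)
      show "integrable M (\<lambda>z. cmod (of_real (\<phi> z) * (f (x \<otimes> z) - f x)))"
        using i1 i2 by (intro integrable_norm) (simp add: right_diff_distrib)
      show "integrable M (\<lambda>z. \<phi> z * e)" using \<phi>i by simp
      fix z assume "z \<in> space M"
      then have z: "z \<in> carrier G" by simp
      show "cmod (of_real (\<phi> z) * (f (x \<otimes> z) - f x)) \<le> \<phi> z * e"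
      proof (cases "z \<in> V")
        case True
        then have "cmod (f (x \<otimes> z) - f x) \<le> e" using d[of z x] x by (simp add: V_def dist_norm)
        moreover have "0 \<le> \<phi> z" using \<theta>0[OF z] c by (simp add: \<phi>_def)
        ultimately show ?thesis by (simp add: norm_mult mult_left_mono)
      next
        case False
        then show ?thesis using \<theta>V[OF z] by (simp add: \<phi>_def)
      qed
    qed
    also have "\<dots> = e" using int1 by simp
    finally show ?thesis .
  qed
  with sk show thesis using that by blast
qed

end

section \<open>Irreducible representations and Schur orthogonality\<close>

lemma subspace_module_vecI:
  fixes W :: "complex vec set"
  assumes "W \<subseteq> carrier_vec d" "0\<^sub>v d \<in> W"
    and "\<And>v w. v \<in> W \<Longrightarrow> w \<in> W \<Longrightarrow> v + w \<in> W" "\<And>c v. v \<in> W \<Longrightarrow> c \<cdot>\<^sub>v v \<in> W"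
  shows "subspace class_ring W (module_vec TYPE(complex) d)"
  using assms by (auto simp: subspace_def submodule_def vec_vs vec_module module_vec_simps)

lemma subspace_module_vecD:
  fixes W :: "complex vec set"
  assumes "subspace class_ring W (module_vec TYPE(complex) d)"
  shows "W \<subseteq> carrier_vec d" "0\<^sub>v d \<in> W"
    and "\<And>v w. v \<in> W \<Longrightarrow> w \<in> W \<Longrightarrow> v + w \<in> W" "\<And>c v. v \<in> W \<Longrightarrow> c \<cdot>\<^sub>v v \<in> W"
  using assms by (auto simp: subspace_def submodule_def module_vec_simps class_ring_simps)

context compact_haar_group
begin

lemma irrepD:
  assumes "\<xi> \<in> unitary_irreps G T"
  shows irrep_dim_pos: "0 < rep_dim G \<xi>"
    and irrep_unitary: "x \<in> carrier G \<Longrightarrow> unitary_mat (rep_dim G \<xi>) (\<xi> x)"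
    and irrep_mult: "x \<in> carrier G \<Longrightarrow> y \<in> carrier G \<Longrightarrow> \<xi> (x \<otimes> y) = \<xi> x * \<xi> y"
    and irrep_cont: "i < rep_dim G \<xi> \<Longrightarrow> j < rep_dim G \<xi> \<Longrightarrow> cont (\<lambda>x. \<xi> x $$ (i, j))"
  using assms by (auto simp: unitary_irreps_def unitary_rep_def irreducible_rep_def)

lemma irrep_carrier:
  "\<xi> \<in> unitary_irreps G T \<Longrightarrow> x \<in> carrier G \<Longrightarrow> \<xi> x \<in> carrier_mat (rep_dim G \<xi>) (rep_dim G \<xi>)"
  by (intro unitary_mat_carrier irrep_unitary)

lemma irrep_entry_mult:
  assumes "\<xi> \<in> unitary_irreps G T" "x \<in> carrier G" "y \<in> carrier G" "i < rep_dim G \<xi>" "j < rep_dim G \<xi>"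
  shows "\<xi> (x \<otimes> y) $$ (i, j) = (\<Sum>k<rep_dim G \<xi>. \<xi> x $$ (i, k) * \<xi> y $$ (k, j))"
  using assms mat_mult_index[OF irrep_carrier irrep_carrier] by (simp add: irrep_mult)

lemma irrep_one:
  assumes \<xi>: "\<xi> \<in> unitary_irreps G T"
  shows "\<xi> \<one> = 1\<^sub>m (rep_dim G \<xi>)"
proof -
  let ?d = "rep_dim G \<xi>"
  note c = irrep_carrier[OF \<xi> one_closed]
  have U: "mat_adjoint (\<xi> \<one>) * \<xi> \<one> = 1\<^sub>m ?d"
    using irrep_unitary[OF \<xi> one_closed] by (simp add: unitary_mat_def)
  have "\<xi> \<one> = mat_adjoint (\<xi> \<one>) * \<xi> \<one> * \<xi> \<one>" using U left_mult_one_mat[OF c] by simp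
  also have "\<dots> = mat_adjoint (\<xi> \<one>) * (\<xi> \<one> * \<xi> \<one>)"
    by (rule assoc_mult_mat[OF mat_adjoint_carrier[OF c] c c])
  also have "\<xi> \<one> * \<xi> \<one> = \<xi> \<one>" using irrep_mult[OF \<xi> one_closed one_closed] by simp
  finally show ?thesis using U by simp
qed

lemma irrep_inv:
  assumes \<xi>: "\<xi> \<in> unitary_irreps G T" and x: "x \<in> carrier G"
  shows "\<xi> (inv x) = mat_adjoint (\<xi> x)"
proof -
  note c = irrep_carrier[OF \<xi> x] and ci = irrep_carrier[OF \<xi> inv_closed[OF x]]
  have "mat_adjoint (\<xi> x) = \<xi> (inv x) * \<xi> x * mat_adjoint (\<xi> x)"
    unfolding irrep_mult[OF \<xi> inv_closed[OF x] x, symmetric]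
    using x by (simp add: irrep_one[OF \<xi>] left_mult_one_mat[OF mat_adjoint_carrier[OF c]])
  also have "\<dots> = \<xi> (inv x) * (\<xi> x * mat_adjoint (\<xi> x))"
    by (rule assoc_mult_mat[OF ci c mat_adjoint_carrier[OF c]])
  also have "\<dots> = \<xi> (inv x)"
    by (simp add: unitary_mat_right[OF irrep_unitary[OF \<xi> x]] right_mult_one_mat[OF ci])
  finally show ?thesis by simp
qed

text \<open>An eigenspace of a matrix commuting with an irreducible representation is invariant.\<close>

lemma commutant_scalar:
  assumes \<xi>: "\<xi> \<in> unitary_irreps G T" and B: "B \<in> carrier_mat (rep_dim G \<xi>) (rep_dim G \<xi>)"
    and comm: "\<And>x. x \<in> carrier G \<Longrightarrow> \<xi> x * B = B * \<xi> x"
  obtains c where "\<And>i j. i < rep_dim G \<xi> \<Longrightarrow> j < rep_dim G \<xi> \<Longrightarrow> B $$ (i, j) = (if i = j then c else 0)"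
proof -
  let ?d = "rep_dim G \<xi>"
  obtain c where "c \<in> spectrum B" using spectrum_non_empty[OF B irrep_dim_pos[OF \<xi>]] by blast
  then obtain v where v: "v \<in> carrier_vec ?d" "v \<noteq> 0\<^sub>v ?d" "B *\<^sub>v v = c \<cdot>\<^sub>v v"
    using B by (auto simp: spectrum_def eigenvalue_def eigenvector_def)
  define W where "W = {w \<in> carrier_vec ?d. B *\<^sub>v w = c \<cdot>\<^sub>v w}"
  have "subspace class_ring W (module_vec TYPE(complex) ?d)"
  proof (rule subspace_module_vecI)
    show "W \<subseteq> carrier_vec ?d" by (auto simp: W_def)
    show "0\<^sub>v ?d \<in> W" using B by (auto simp: W_def)
    show "v + w \<in> W" if "v \<in> W" "w \<in> W" for v w
      using that B by (auto simp: W_def mult_add_distrib_mat_vec smult_add_distrib_vec)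
    show "a \<cdot>\<^sub>v w \<in> W" if "w \<in> W" for a w
      using that B by (auto simp: W_def mult_mat_vec smult_smult_assoc mult.commute)
  qed
  moreover have "\<xi> x *\<^sub>v w \<in> W" if x: "x \<in> carrier G" and w: "w \<in> W" for x w
  proof -
    note X = irrep_carrier[OF \<xi> x]
    have wc: "w \<in> carrier_vec ?d" "B *\<^sub>v w = c \<cdot>\<^sub>v w" using w by (auto simp: W_def)
    have "B *\<^sub>v (\<xi> x *\<^sub>v w) = (B * \<xi> x) *\<^sub>v w" using assoc_mult_mat_vec[OF B X wc(1)] by simp
    also have "\<dots> = \<xi> x *\<^sub>v (B *\<^sub>v w)" using assoc_mult_mat_vec[OF X B wc(1)] comm[OF x] by simp
    also have "\<dots> = c \<cdot>\<^sub>v (\<xi> x *\<^sub>v w)" using wc X by (simp add: mult_mat_vec)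
    finally show ?thesis using mult_mat_vec_carrier[OF X wc(1)] by (simp add: W_def)
  qed
  ultimately have "W = {0\<^sub>v ?d} \<or> W = carrier_vec ?d"
    using \<xi> by (simp add: unitary_irreps_def irreducible_rep_def)
  moreover have "v \<in> W" using v by (simp add: W_def)
  ultimately have W: "W = carrier_vec ?d" using v(2) by blast
  show thesis
  proof
    fix i j assume ij: "i < ?d" "j < ?d"
    have "unit_vec ?d j \<in> W" using W by simp
    then have "B *\<^sub>v unit_vec ?d j = c \<cdot>\<^sub>v unit_vec ?d j" by (simp add: W_def)
    then have "(B *\<^sub>v unit_vec ?d j) $ i = (c \<cdot>\<^sub>v unit_vec ?d j) $ i" by simp
    then show "B $$ (i, j) = (if i = j then c else 0)"
      using B ij by (auto simp: scalar_prod_right_unit index_unit_vec)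
  qed
qed

text \<open>For an intertwiner \<open>B\<close> the matrices \<open>B B\<^sup>*\<close> and \<open>B\<^sup>* B\<close> are scalars \<open>\<lambda>\<close> and \<open>\<mu>\<close>.  If \<open>B\<close> does not vanish, then
  \<open>\<lambda> = \<mu>\<close> because \<open>B B\<^sup>* B = \<lambda> B = \<mu> B\<close>, the dimensions agree because \<open>\<lambda> d = \<mu> d'\<close> is the trace, and
  \<open>\<lambda>\<^sup>-\<^sup>1\<^sup>/\<^sup>2 B\<close> is unitary.\<close>

lemma intertwiner_zero_or_equiv:
  assumes \<xi>: "\<xi> \<in> unitary_irreps G T" and \<eta>: "\<eta> \<in> unitary_irreps G T"
    and B: "B \<in> carrier_mat (rep_dim G \<xi>) (rep_dim G \<eta>)"
    and comm: "\<And>x. x \<in> carrier G \<Longrightarrow> \<xi> x * B = B * \<eta> x"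
    and nz: "\<exists>i<rep_dim G \<xi>. \<exists>j<rep_dim G \<eta>. B $$ (i, j) \<noteq> 0"
  shows "rep_equiv G \<eta> \<xi>"
proof -
  let ?d = "rep_dim G \<xi>" and ?e = "rep_dim G \<eta>" and ?A = "mat_adjoint B"
  note A = mat_adjoint_carrier[OF B]
  have BA: "B * ?A \<in> carrier_mat ?d ?d" and AB: "?A * B \<in> carrier_mat ?e ?e"
    using mult_carrier_mat[OF B A] mult_carrier_mat[OF A B] by auto
  have commA: "?A * \<xi> x = \<eta> x * ?A" if x: "x \<in> carrier G" for x
  proof -
    note X = irrep_carrier[OF \<xi> inv_closed[OF x]] and Y = irrep_carrier[OF \<eta> inv_closed[OF x]]
    have "?A * mat_adjoint (\<xi> (inv x)) = mat_adjoint (\<eta> (inv x)) * ?A"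
      using arg_cong[OF comm[OF inv_closed[OF x]], of mat_adjoint]
      by (simp add: mat_adjoint_mult[OF X B] mat_adjoint_mult[OF B Y])
    then show ?thesis
      using irrep_inv[OF \<xi> inv_closed[OF x]] irrep_inv[OF \<eta> inv_closed[OF x]] x by simp
  qed
  have "\<xi> x * (B * ?A) = B * ?A * \<xi> x" if x: "x \<in> carrier G" for x
  proof -
    note X = irrep_carrier[OF \<xi> x] and Y = irrep_carrier[OF \<eta> x]
    have "\<xi> x * (B * ?A) = B * \<eta> x * ?A" using comm[OF x] assoc_mult_mat[OF X B A] by simp
    also have "\<dots> = B * (?A * \<xi> x)" using commA[OF x] assoc_mult_mat[OF B Y A] by simp
    finally show ?thesis using assoc_mult_mat[OF B A X] by simp
  qed
  from commutant_scalar[OF \<xi> BA this] obtain l where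
    l: "\<And>i j. i < ?d \<Longrightarrow> j < ?d \<Longrightarrow> (B * ?A) $$ (i, j) = (if i = j then l else 0)" by blast
  have "\<eta> x * (?A * B) = ?A * B * \<eta> x" if x: "x \<in> carrier G" for x
  proof -
    note X = irrep_carrier[OF \<xi> x] and Y = irrep_carrier[OF \<eta> x]
    have "\<eta> x * (?A * B) = ?A * \<xi> x * B" using commA[OF x] assoc_mult_mat[OF Y A B] by simp
    also have "\<dots> = ?A * (B * \<eta> x)" using comm[OF x] assoc_mult_mat[OF A X B] by simp
    finally show ?thesis using assoc_mult_mat[OF A B Y] by simp
  qed
  from commutant_scalar[OF \<eta> AB this] obtain m where
    m: "\<And>i j. i < ?e \<Longrightarrow> j < ?e \<Longrightarrow> (?A * B) $$ (i, j) = (if i = j then m else 0)" by blast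
  define s where "s = (\<Sum>i<?d. \<Sum>j<?e. (cmod (B $$ (i, j)))\<^sup>2)"
  have "(\<Sum>i<?d. (B * ?A) $$ (i, i)) = of_real s"
    unfolding s_def of_real_sum complex_norm_square
    by (intro sum.cong) (simp_all add: mat_mult_index[OF B A] mat_adjoint_index[OF B])
  then have tl: "of_nat ?d * l = of_real s" using l by simp
  have "(\<Sum>j<?e. (?A * B) $$ (j, j)) = (\<Sum>j<?e. \<Sum>i<?d. of_real ((cmod (B $$ (i, j)))\<^sup>2))"
    unfolding complex_norm_square
    by (intro sum.cong) (simp_all add: mat_mult_index[OF A B] mat_adjoint_index[OF B] mult.commute)
  also have "\<dots> = of_real s" unfolding s_def of_real_sum by (rule sum.swap)
  finally have tm: "of_nat ?e * m = of_real s" using m by simp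
  obtain i0 j0 where ij0: "i0 < ?d" "j0 < ?e" "B $$ (i0, j0) \<noteq> 0" using nz by blast
  have spos: "0 < s"
  proof -
    have "0 < (cmod (B $$ (i0, j0)))\<^sup>2" using ij0 by simp
    also have "\<dots> \<le> (\<Sum>j<?e. (cmod (B $$ (i0, j)))\<^sup>2)" using ij0 by (intro member_le_sum) auto
    also have "\<dots> \<le> s"
      using ij0 member_le_sum[of i0 "{..<?d}" "\<lambda>i. \<Sum>j<?e. (cmod (B $$ (i, j)))\<^sup>2"]
      by (simp add: sum_nonneg s_def)
    finally show ?thesis .
  qed
  have lm: "l = m"
  proof -
    have "l * B $$ (i0, j0) = (B * ?A * B) $$ (i0, j0)"
      using ij0 l by (simp add: mat_mult_index[OF BA B] if_distrib[of "\<lambda>a. a * _"] sum.delta cong: if_cong)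
    also have "\<dots> = (B * (?A * B)) $$ (i0, j0)" by (simp add: assoc_mult_mat[OF B A B])
    also have "\<dots> = m * B $$ (i0, j0)"
      using ij0 m by (simp add: mat_mult_index[OF B AB] if_distrib[of "\<lambda>a. _ * a"] sum.delta cong: if_cong)
    finally show ?thesis using ij0 by simp
  qed
  have l0: "l \<noteq> 0" using tl spos by auto
  have de: "?d = ?e"
  proof -
    have "of_nat ?d * l = of_nat ?e * l" using tl tm lm by simp
    then show ?thesis using l0 by simp
  qed
  define t where "t = s / ?d"
  have t: "0 < t" using spos irrep_dim_pos[OF \<xi>] by (simp add: t_def)
  have lt: "l = of_real t" using tl irrep_dim_pos[OF \<xi>] by (simp add: t_def field_simps)
  define q where "q = 1 / sqrt t"
  have qq: "q * q = 1 / t" using t by (simp add: q_def)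
  define U where "U = Matrix.mat ?e ?e (\<lambda>(i, j). of_real q * B $$ (i, j))"
  have Uc: "U \<in> carrier_mat ?e ?e" by (simp add: U_def)
  have Uij: "U $$ (i, j) = of_real q * B $$ (i, j)" if "i < ?e" "j < ?e" for i j
    using that by (simp add: U_def)
  have "mat_adjoint U * U = 1\<^sub>m ?e"
  proof (rule eq_matI)
    fix i j assume "i < dim_row (1\<^sub>m ?e)" "j < dim_col (1\<^sub>m ?e)"
    then have ij: "i < ?e" "j < ?e" by auto
    have "(mat_adjoint U * U) $$ (i, j) = (\<Sum>k<?e. of_real (q * q) * (?A $$ (i, k) * B $$ (k, j)))"
      unfolding mat_mult_index[OF mat_adjoint_carrier[OF Uc] Uc ij]
      by (intro sum.cong) (use ij in \<open>simp_all add: mat_adjoint_index[OF Uc] mat_adjoint_index[OF B] Uij de\<close>)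
    also have "\<dots> = of_real (q * q) * (?A * B) $$ (i, j)"
      unfolding mat_mult_index[OF A B ij] by (simp add: de sum_distrib_left)
    also note qq
    finally show "(mat_adjoint U * U) $$ (i, j) = 1\<^sub>m ?e $$ (i, j)"
      using ij m t by (simp add: lm[symmetric] lt)
  qed (use Uc in auto)
  then have U: "unitary_mat ?e U" using Uc by (simp add: unitary_mat_def)
  have "U * \<eta> x = \<xi> x * U" if x: "x \<in> carrier G" for x
  proof (rule eq_matI)
    note X = irrep_carrier[OF \<xi> x, unfolded de] and Y = irrep_carrier[OF \<eta> x]
    note B' = B[unfolded de]
    fix i j assume "i < dim_row (\<xi> x * U)" "j < dim_col (\<xi> x * U)"
    then have ij: "i < ?e" "j < ?e" using X Uc by auto
    have "(U * \<eta> x) $$ (i, j) = of_real q * (B * \<eta> x) $$ (i, j)"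
      unfolding mat_mult_index[OF Uc Y ij] mat_mult_index[OF B' Y ij] sum_distrib_left
      by (intro sum.cong) (use ij in \<open>simp_all add: Uij mult.assoc\<close>)
    also have "\<dots> = of_real q * (\<xi> x * B) $$ (i, j)" using comm[OF x] by simp
    also have "\<dots> = (\<xi> x * U) $$ (i, j)"
      unfolding mat_mult_index[OF X Uc ij] mat_mult_index[OF X B' ij] sum_distrib_left
      by (intro sum.cong) (use ij in \<open>simp_all add: Uij mult_ac\<close>)
    finally show "(U * \<eta> x) $$ (i, j) = (\<xi> x * U) $$ (i, j)" .
  qed (use Uc irrep_carrier[OF \<xi> x] irrep_carrier[OF \<eta> x] de in auto)
  with U de show ?thesis by (auto simp: rep_equiv_def)
qed

text \<open>Averaging \<open>x \<mapsto> \<xi> x E \<eta>(x)\<^sup>*\<close> over the group, for a matrix unit \<open>E\<close>, gives an intertwiner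
  by left invariance of the integral.\<close>

lemma averaged_intertwiner:
  assumes \<xi>: "\<xi> \<in> unitary_irreps G T" and \<eta>: "\<eta> \<in> unitary_irreps G T"
    and a: "a < rep_dim G \<xi>" and b: "b < rep_dim G \<eta>" and g: "g \<in> carrier G"
  defines "B \<equiv> Matrix.mat (rep_dim G \<xi>) (rep_dim G \<eta>)
    (\<lambda>(i, j). l2_inner M (\<lambda>x. \<xi> x $$ (i, a)) (\<lambda>x. \<eta> x $$ (j, b)))"
  shows "\<xi> g * B = B * \<eta> g"
proof (rule eq_matI)
  let ?d = "rep_dim G \<xi>" and ?e = "rep_dim G \<eta>"
  have B: "B \<in> carrier_mat ?d ?e" by (simp add: B_def)
  note X = irrep_carrier[OF \<xi> g] and Y = irrep_carrier[OF \<eta> g]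
  note gi = inv_closed[OF g]
  fix i j assume "i < dim_row (B * \<eta> g)" "j < dim_col (B * \<eta> g)"
  then have ij: "i < ?d" "j < ?e" using B Y by auto
  have lx: "(\<lambda>x. \<xi> x $$ (k, a)) \<in> l2 M" if "k < ?d" for k using cont_l2[OF irrep_cont[OF \<xi> that a]] .
  have ly: "(\<lambda>x. \<eta> x $$ (k, b)) \<in> l2 M" if "k < ?e" for k using cont_l2[OF irrep_cont[OF \<eta> that b]] .
  have "(\<xi> g * B) $$ (i, j) = (\<Sum>k<?d. \<xi> g $$ (i, k) * l2_inner M (\<lambda>x. \<xi> x $$ (k, a)) (\<lambda>x. \<eta> x $$ (j, b)))"
    using mat_mult_index[OF X B ij] ij by (simp add: B_def)
  also have "\<dots> = l2_inner M (\<lambda>x. \<Sum>k<?d. \<xi> g $$ (i, k) * \<xi> x $$ (k, a)) (\<lambda>x. \<eta> x $$ (j, b))"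
    using lx ly ij by (subst l2_inner_sum_left) (auto intro: l2_scale)
  also have "\<dots> = l2_inner M (\<lambda>x. \<xi> (g \<otimes> x) $$ (i, a)) (\<lambda>x. \<eta> (inv g \<otimes> (g \<otimes> x)) $$ (j, b))"
    unfolding l2_inner_def
    using g ij a by (intro Bochner_Integration.integral_cong refl)
      (simp add: irrep_entry_mult[OF \<xi>] m_assoc[symmetric])
  also have "\<dots> = l2_inner M (\<lambda>x. \<xi> x $$ (i, a)) (\<lambda>x. \<eta> (inv g \<otimes> x) $$ (j, b))"
    using l2_inner_translation[OF g irrep_cont[OF \<xi> ij(1) a] cont_translate[OF irrep_cont[OF \<eta> ij(2) b] gi]] .
  also have "\<dots> = l2_inner M (\<lambda>x. \<xi> x $$ (i, a)) (\<lambda>x. \<Sum>k<?e. cnj (\<eta> g $$ (k, j)) * \<eta> x $$ (k, b))"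
    unfolding l2_inner_def
    using g ij b by (intro Bochner_Integration.integral_cong refl)
      (simp add: irrep_entry_mult[OF \<eta>] irrep_inv[OF \<eta> g] mat_adjoint_index[OF Y])
  also have "\<dots> = (\<Sum>k<?e. l2_inner M (\<lambda>x. \<xi> x $$ (i, a)) (\<lambda>x. \<eta> x $$ (k, b)) * \<eta> g $$ (k, j))"
  proof -
    have "l2_inner M (\<lambda>x. \<xi> x $$ (i, a)) (\<lambda>x. \<Sum>k<?e. cnj (\<eta> g $$ (k, j)) * \<eta> x $$ (k, b)) =
      (\<Sum>k<?e. l2_inner M (\<lambda>x. \<xi> x $$ (i, a)) (\<lambda>x. cnj (\<eta> g $$ (k, j)) * \<eta> x $$ (k, b)))"
      using lx ly ij by (intro l2_inner_sum_right l2_scale) auto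
    then show ?thesis by (simp add: mult.commute[of "\<eta> g $$ _"])
  qed
  also have "\<dots> = (B * \<eta> g) $$ (i, j)"
    using mat_mult_index[OF B Y ij] ij by (simp add: B_def)
  finally show "(\<xi> g * B) $$ (i, j) = (B * \<eta> g) $$ (i, j)" .
qed (use irrep_carrier[OF \<xi> g] irrep_carrier[OF \<eta> g] in \<open>auto simp: B_def\<close>)

lemma Schur_orthogonality_inequivalent:
  assumes \<xi>: "\<xi> \<in> unitary_irreps G T" and \<eta>: "\<eta> \<in> unitary_irreps G T" and ne: "\<not> rep_equiv G \<eta> \<xi>"
    and "i < rep_dim G \<xi>" "a < rep_dim G \<xi>" "j < rep_dim G \<eta>" "b < rep_dim G \<eta>"
  shows "l2_inner M (\<lambda>x. \<xi> x $$ (i, a)) (\<lambda>x. \<eta> x $$ (j, b)) = 0"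
proof -
  let ?B = "Matrix.mat (rep_dim G \<xi>) (rep_dim G \<eta>)
    (\<lambda>(i, j). l2_inner M (\<lambda>x. \<xi> x $$ (i, a)) (\<lambda>x. \<eta> x $$ (j, b)))"
  have "?B $$ (i, j) = 0"
  proof (rule ccontr)
    assume "?B $$ (i, j) \<noteq> 0"
    then have "\<exists>i<rep_dim G \<xi>. \<exists>j<rep_dim G \<eta>. ?B $$ (i, j) \<noteq> 0" using assms by blast
    from intertwiner_zero_or_equiv[OF \<xi> \<eta> _ averaged_intertwiner[OF \<xi> \<eta>] this] ne assms
    show False by simp
  qed
  then show ?thesis using assms by simp
qed

lemma Schur_orthogonality:
  assumes \<xi>: "\<xi> \<in> unitary_irreps G T"
    and ia: "i < rep_dim G \<xi>" "a < rep_dim G \<xi>" and jb: "j < rep_dim G \<xi>" "b < rep_dim G \<xi>"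
  shows "l2_inner M (\<lambda>x. \<xi> x $$ (i, a)) (\<lambda>x. \<xi> x $$ (j, b)) =
    (if i = j \<and> a = b then 1 / of_nat (rep_dim G \<xi>) else 0)"
proof -
  let ?d = "rep_dim G \<xi>"
  let ?B = "Matrix.mat ?d ?d (\<lambda>(i, j). l2_inner M (\<lambda>x. \<xi> x $$ (i, a)) (\<lambda>x. \<xi> x $$ (j, b)))"
  have "\<xi> x * ?B = ?B * \<xi> x" if "x \<in> carrier G" for x
    by (rule averaged_intertwiner[OF \<xi> \<xi> ia(2) jb(2) that])
  then obtain c where c: "\<And>i j. i < ?d \<Longrightarrow> j < ?d \<Longrightarrow> ?B $$ (i, j) = (if i = j then c else 0)"
    using commutant_scalar[OF \<xi>, of ?B] by (metis mat_carrier)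
  have c': "l2_inner M (\<lambda>x. \<xi> x $$ (i, a)) (\<lambda>x. \<xi> x $$ (j, b)) = (if i = j then c else 0)"
    if "i < ?d" "j < ?d" for i j
    using c[OF that] that by simp
  have lx: "integrable M (\<lambda>x. \<xi> x $$ (i, a) * cnj (\<xi> x $$ (i, b)))" if "i < ?d" for i
    using l2_integrable_mult[OF cont_l2 cont_l2] irrep_cont[OF \<xi>] that ia jb by blast
  have "of_nat ?d * c = (\<Sum>i<?d. l2_inner M (\<lambda>x. \<xi> x $$ (i, a)) (\<lambda>x. \<xi> x $$ (i, b)))"
    using c' by simp
  also have "\<dots> = (LINT x|M. (\<Sum>i<?d. \<xi> x $$ (i, a) * cnj (\<xi> x $$ (i, b))))"
    unfolding l2_inner_def using lx by (intro Bochner_Integration.integral_sum[symmetric]) auto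
  also have "\<dots> = (LINT x|M. (if a = b then 1 else 0))"
  proof (intro Bochner_Integration.integral_cong refl)
    fix x assume "x \<in> space M"
    then have "(\<Sum>i<?d. cnj (\<xi> x $$ (i, b)) * \<xi> x $$ (i, a)) = (if b = a then 1 else 0)"
      using unitary_mat_cols[OF irrep_unitary[OF \<xi>] jb(2) ia(2)] by simp
    then show "(\<Sum>i<?d. \<xi> x $$ (i, a) * cnj (\<xi> x $$ (i, b))) = (if a = b then 1 else 0)"
      by (auto simp: mult.commute)
  qed
  also have "\<dots> = (if a = b then 1 else 0)" by simp
  finally have "c = (if a = b then 1 / of_nat ?d else 0)"
    using irrep_dim_pos[OF \<xi>] by (auto simp: field_simps)
  then show ?thesis using c'[OF ia(1) jb(1)] by simp
qed

end

section \<open>The Peter--Weyl theorem\<close>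

context compact_haar_group
begin

text \<open>Values off the group are arbitrary, hence the closure under changing them.\<close>

inductive_set coeff_span :: "('a \<Rightarrow> complex) set" where
  zero: "(\<lambda>x. 0) \<in> coeff_span"
| step: "f \<in> coeff_span \<Longrightarrow> \<xi> \<in> unitary_irreps G T \<Longrightarrow> i < rep_dim G \<xi> \<Longrightarrow> j < rep_dim G \<xi> \<Longrightarrow>
    (\<lambda>x. f x + c * \<xi> x $$ (i, j)) \<in> coeff_span"
| agree: "f \<in> coeff_span \<Longrightarrow> (\<And>x. x \<in> carrier G \<Longrightarrow> g x = f x) \<Longrightarrow> g \<in> coeff_span"

lemma cont_cong: "cont f \<Longrightarrow> (\<And>x. x \<in> carrier G \<Longrightarrow> g x = f x) \<Longrightarrow> cont g"
  by (rule continuous_map_eq[of T euclidean f g]) (auto simp: topspace_T)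

lemma cont_mult_const: "cont f \<Longrightarrow> cont (\<lambda>x. c * f x)"
  using continuous_map_compose[of T euclidean f euclidean "\<lambda>z. c * z"]
  by (simp add: o_def continuous_on_mult_left)

lemma coeff_span_cont: "f \<in> coeff_span \<Longrightarrow> cont f"
proof (induction rule: coeff_span.induct)
  case (step f \<xi> i j c)
  show ?case by (intro continuous_map_add step.IH cont_mult_const irrep_cont[OF step.hyps(2-4)])
next
  case (agree f g)
  show ?case by (rule cont_cong[OF agree.IH agree.hyps(2)])
qed simp

lemma coeff_span_scale: "f \<in> coeff_span \<Longrightarrow> (\<lambda>x. a * f x) \<in> coeff_span"
proof (induction rule: coeff_span.induct)
  case (step f \<xi> i j c)
  show ?case
    by (rule coeff_span.agree[OF coeff_span.step[OF step.IH step.hyps(2-4), of "a * c"]])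
       (simp add: algebra_simps)
next
  case (agree f g)
  show ?case by (rule coeff_span.agree[OF agree.IH]) (simp add: agree.hyps(2))
qed (simp add: coeff_span.zero)

lemma coeff_span_add:
  assumes f: "f \<in> coeff_span"
  shows "g \<in> coeff_span \<Longrightarrow> (\<lambda>x. f x + g x) \<in> coeff_span"
proof (induction rule: coeff_span.induct)
  case (step h \<xi> i j c)
  show ?case
    by (rule coeff_span.agree[OF coeff_span.step[OF step.IH step.hyps(2-4), of c]]) simp
next
  case (agree h g)
  show ?case by (rule coeff_span.agree[OF agree.IH]) (simp add: agree.hyps(2))
qed (simp add: f)

lemma coeff_span_subspace: "l2_subspace M coeff_span"
  unfolding l2_subspace_def
  by (auto intro: coeff_span.zero coeff_span_add coeff_span_scale cont_l2 coeff_span_cont)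

lemma coeff_in_span:
  assumes "\<xi> \<in> unitary_irreps G T" "i < rep_dim G \<xi>" "j < rep_dim G \<xi>"
  shows "(\<lambda>x. \<xi> x $$ (i, j)) \<in> coeff_span"
  using coeff_span.step[OF coeff_span.zero assms, of 1] by simp

lemma coeff_span_combination:
  assumes "\<And>k. k \<in> I \<Longrightarrow> f k \<in> coeff_span"
    and "\<And>x. x \<in> carrier G \<Longrightarrow> g x = (\<Sum>k\<in>I. c k * f k x)"
  shows "g \<in> coeff_span"
  by (rule coeff_span.agree[OF l2_subspace_sum[OF coeff_span_subspace coeff_span_scale[OF assms(1)]] assms(2)])

text \<open>Because \<open>\<xi> (x z) = \<xi> x \<xi> z\<close>, integrating over \<open>z\<close> leaves a combination of coefficients in the same
  row.\<close>

lemma conv_coeff_span: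
  assumes \<phi>: "continuous_map T euclideanreal \<phi>"
  shows "f \<in> coeff_span \<Longrightarrow> conv \<phi> f \<in> coeff_span"
proof (induction rule: coeff_span.induct)
  case zero
  have "conv \<phi> (\<lambda>x. 0) = (\<lambda>x. 0)" by (simp add: conv_def fun_eq_iff)
  then show ?case by (simp add: coeff_span.zero)
next
  case (step f \<xi> i j c)
  let ?u = "\<lambda>x. \<xi> x $$ (i, j)"
  have l: "f \<in> l2 M" "?u \<in> l2 M"
    using coeff_span_cont[OF step.hyps(1)] irrep_cont[OF step.hyps(2-4)] cont_l2 by auto
  have int: "integrable M (\<lambda>z. of_real (\<phi> z) * \<xi> z $$ (k, j))" if "k < rep_dim G \<xi>" for k
  proof -
    have "integrable M (\<lambda>z. \<xi> z $$ (k, j) * cnj (of_real (\<phi> z)))"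
      by (intro l2_integrable_mult cont_l2 irrep_cont[OF step.hyps(2) that step.hyps(4)] cont_of_real \<phi>)
    then show ?thesis by (simp add: mult.commute)
  qed
  have "conv \<phi> ?u \<in> coeff_span"
  proof (rule coeff_span_combination)
    show "(\<lambda>x. \<xi> x $$ (i, k)) \<in> coeff_span" if "k \<in> {..<rep_dim G \<xi>}" for k
      using that by (intro coeff_in_span step.hyps(2,3)) simp
    fix x assume x: "x \<in> carrier G"
    have "conv \<phi> ?u x = (LINT z|M. (\<Sum>k<rep_dim G \<xi>. \<xi> x $$ (i, k) * (of_real (\<phi> z) * \<xi> z $$ (k, j))))"
      using x unfolding conv_def
      by (auto intro!: Bochner_Integration.integral_cong
          simp: irrep_entry_mult[OF step.hyps(2) _ _ step.hyps(3,4)] sum_distrib_left mult_ac)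
    also have "\<dots> = (\<Sum>k<rep_dim G \<xi>. (LINT z|M. \<xi> x $$ (i, k) * (of_real (\<phi> z) * \<xi> z $$ (k, j))))"
      using int by (intro Bochner_Integration.integral_sum) auto
    also have "\<dots> = (\<Sum>k<rep_dim G \<xi>. (LINT z|M. of_real (\<phi> z) * \<xi> z $$ (k, j)) * \<xi> x $$ (i, k))"
      by (simp add: mult.commute)
    finally show "conv \<phi> ?u x = (\<Sum>k<rep_dim G \<xi>. (LINT z|M. of_real (\<phi> z) * \<xi> z $$ (k, j)) * \<xi> x $$ (i, k))" .
  qed
  then have "(\<lambda>x. conv \<phi> f x + c * conv \<phi> ?u x) \<in> coeff_span"
    by (intro coeff_span_add step.IH coeff_span_scale)
  then show ?case using conv_lincomb[OF \<phi> l, of 1 c] by simp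
next
  case (agree f g)
  have "conv \<phi> g = conv \<phi> f"
    by (auto simp: conv_def fun_eq_iff agree.hyps(2) intro!: Bochner_Integration.integral_cong)
  then show ?case using agree.IH by simp
qed

lemma coeff_span_translate:
  assumes g: "g \<in> carrier G"
  shows "f \<in> coeff_span \<Longrightarrow> (\<lambda>x. f (g \<otimes> x)) \<in> coeff_span"
proof (induction rule: coeff_span.induct)
  case (step f \<xi> i j c)
  have "(\<lambda>x. \<xi> (g \<otimes> x) $$ (i, j)) \<in> coeff_span"
  proof (rule coeff_span_combination)
    show "(\<lambda>x. \<xi> x $$ (k, j)) \<in> coeff_span" if "k \<in> {..<rep_dim G \<xi>}" for k
      using that by (intro coeff_in_span step.hyps(2,4)) simp
    show "\<xi> (g \<otimes> x) $$ (i, j) = (\<Sum>k<rep_dim G \<xi>. \<xi> g $$ (i, k) * \<xi> x $$ (k, j))" if "x \<in> carrier G" for x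
      by (rule irrep_entry_mult[OF step.hyps(2) g that step.hyps(3,4)])
  qed
  then show ?case by (intro coeff_span_add step.IH coeff_span_scale)
next
  case (agree f f')
  show ?case by (rule coeff_span.agree[OF agree.IH]) (simp add: agree.hyps(2) g)
qed (simp add: coeff_span.zero)

definition coeff_perp :: "('a \<Rightarrow> complex) set" where
  "coeff_perp = {v. cont v \<and> (\<forall>f\<in>coeff_span. l2_inner M v f = 0)}"

lemma coeff_perpD: "v \<in> coeff_perp \<Longrightarrow> cont v" "v \<in> coeff_perp \<Longrightarrow> f \<in> coeff_span \<Longrightarrow> l2_inner M v f = 0"
  by (auto simp: coeff_perp_def)

lemma coeff_perp_subspace: "l2_subspace M coeff_perp"
  unfolding l2_subspace_def
proof (intro conjI ballI allI subsetI)
  show "(\<lambda>x. 0) \<in> coeff_perp" by (simp add: coeff_perp_def)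
  show "f \<in> l2 M" if "f \<in> coeff_perp" for f using that by (intro cont_l2 coeff_perpD)
  fix f g a b assume f: "f \<in> coeff_perp" and g: "g \<in> coeff_perp"
  have "l2_inner M (\<lambda>x. a * f x + b * g x) h = 0" if h: "h \<in> coeff_span" for h
    using l2_inner_lincomb_left[of f M g h a b] f g h by (simp add: coeff_perpD cont_l2 coeff_span_cont)
  moreover have "cont (\<lambda>x. a * f x + b * g x)"
    by (intro continuous_map_add cont_mult_const coeff_perpD(1) f g)
  ultimately show "(\<lambda>x. a * f x + b * g x) \<in> coeff_perp" by (simp add: coeff_perp_def)
qed

lemma coeff_perp_limit:
  assumes v: "\<And>n::nat. v n \<in> l2 M" and z: "cont z" and lim: "(\<lambda>n. l2_norm M (\<lambda>x. v n x - z x)) \<longlonglongrightarrow> 0"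
    and orth: "\<And>h. h \<in> coeff_span \<Longrightarrow> (\<lambda>n. l2_inner M (v n) h) \<longlonglongrightarrow> 0"
  shows "z \<in> coeff_perp"
proof -
  have "l2_inner M z h = 0" if h: "h \<in> coeff_span" for h
  proof -
    have "(\<lambda>n. l2_inner M (v n) h) \<longlonglongrightarrow> l2_inner M z h"
      by (intro l2_inner_tendsto_left v cont_l2 z coeff_span_cont h lim)
    then show ?thesis using orth[OF h] by (rule LIMSEQ_unique)
  qed
  with z show ?thesis by (simp add: coeff_perp_def)
qed

lemma coeff_perp_conv:
  assumes \<phi>: "symmetric_kernel \<phi>" and v: "v \<in> coeff_perp"
  shows "conv \<phi> v \<in> coeff_perp"
proof -
  have c: "continuous_map T euclideanreal \<phi>" using \<phi> by (simp add: symmetric_kernel_def)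
  have "l2_inner M (conv \<phi> v) h = 0" if h: "h \<in> coeff_span" for h
    using conv_selfadjoint[OF \<phi> coeff_perpD(1)[OF v] coeff_span_cont[OF h]]
      coeff_perpD(2)[OF v conv_coeff_span[OF c h]] by simp
  then show ?thesis
    using conv_cont[OF c cont_l2[OF coeff_perpD(1)[OF v]]] by (simp add: coeff_perp_def)
qed

lemma coeff_perp_translate:
  assumes g: "g \<in> carrier G" and v: "v \<in> coeff_perp"
  shows "(\<lambda>x. v (g \<otimes> x)) \<in> coeff_perp"
proof -
  have "l2_inner M (\<lambda>x. v (g \<otimes> x)) h = 0" if h: "h \<in> coeff_span" for h
  proof -
    have h': "(\<lambda>x. h (inv g \<otimes> x)) \<in> coeff_span" by (rule coeff_span_translate[OF inv_closed[OF g] h])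
    have "l2_inner M (\<lambda>x. v (g \<otimes> x)) h = l2_inner M (\<lambda>x. v (g \<otimes> x)) (\<lambda>x. h (inv g \<otimes> (g \<otimes> x)))"
      unfolding l2_inner_def using g
      by (intro Bochner_Integration.integral_cong refl) (simp add: m_assoc[symmetric])
    also have "\<dots> = l2_inner M v (\<lambda>x. h (inv g \<otimes> x))"
      using l2_inner_translation[OF g coeff_perpD(1)[OF v] coeff_span_cont[OF h']] .
    also have "\<dots> = 0" by (rule coeff_perpD(2)[OF v h'])
    finally show ?thesis .
  qed
  then show ?thesis using cont_translate[OF coeff_perpD(1)[OF v] g] by (simp add: coeff_perp_def)
qed

lemma l2_inner_cong_carrier: "(\<And>x. x \<in> carrier G \<Longrightarrow> f x = f' x) \<Longrightarrow> l2_inner M f h = l2_inner M f' h"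
  unfolding l2_inner_def by (intro Bochner_Integration.integral_cong) auto

text \<open>An orthonormal family of continuous functions with left-invariant span, orthogonal to all
  matrix coefficients.\<close>

definition invariant_family :: "nat \<Rightarrow> (nat \<Rightarrow> 'a \<Rightarrow> complex) \<Rightarrow> bool" where
  "invariant_family d e \<longleftrightarrow> orthonormal M d e \<and> (\<forall>i<d. e i \<in> coeff_perp) \<and>
     (\<forall>g\<in>carrier G. \<forall>i<d. \<forall>x\<in>carrier G. e i (g \<otimes> x) = l2_proj M d e (\<lambda>x. e i (g \<otimes> x)) x)"

lemma l2_proj_cont:
  assumes "\<And>i. i < d \<Longrightarrow> cont (e i)" shows "cont (l2_proj M d e f)"
  unfolding l2_proj_def by (intro continuous_map_sum cont_mult_const assms) auto

lemma invariant_familyI: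
  assumes S: "l2_subspace M S" "S \<subseteq> coeff_perp"
    and e: "orthonormal M d e" "\<And>i. i < d \<Longrightarrow> e i \<in> S"
    and span: "\<And>f. f \<in> S \<Longrightarrow> l2_norm M (\<lambda>x. f x - l2_proj M d e f x) = 0"
    and inv: "\<And>g f. g \<in> carrier G \<Longrightarrow> f \<in> S \<Longrightarrow> \<exists>h\<in>S. \<forall>x\<in>carrier G. f (g \<otimes> x) = h x"
  shows "invariant_family d e"
  unfolding invariant_family_def
proof (intro conjI ballI allI impI)
  show "orthonormal M d e" by (rule e)
  show "e i \<in> coeff_perp" if "i < d" for i using e(2)[OF that] S(2) by blast
  fix g i x assume g: "g \<in> carrier G" and i: "i < d" and x: "x \<in> carrier G"
  obtain h where h: "h \<in> S" "\<And>x. x \<in> carrier G \<Longrightarrow> e i (g \<otimes> x) = h x" using inv[OF g e(2)[OF i]] by blast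
  have hc: "cont h" using h(1) S(2) coeff_perpD(1) by blast
  have ec: "cont (e j)" if "j < d" for j using e(2)[OF that] S(2) coeff_perpD(1) by blast
  have "cont (\<lambda>x. h x - l2_proj M d e h x)" by (intro continuous_map_diff hc l2_proj_cont ec)
  then have "h x - l2_proj M d e h x = 0" by (rule cont_null_imp_zero[OF _ span[OF h(1)] x])
  moreover have "l2_proj M d e h x = l2_proj M d e (\<lambda>x. e i (g \<otimes> x)) x"
    unfolding l2_proj_def using h(2) by (intro sum.cong refl arg_cong2[of _ _ _ _ "(*)"] l2_inner_cong_carrier) auto
  ultimately show "e i (g \<otimes> x) = l2_proj M d e (\<lambda>x. e i (g \<otimes> x)) x" using h(2)[OF x] by simp
qed

text \<open>Bessel's inequality for the kernel sections bounds the dimension of an eigenspace of a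
  convolution operator.\<close>

lemma conv_eigenspace_bound:
  assumes \<phi>: "continuous_map T euclideanreal \<phi>" and \<nu>: "\<nu> \<noteq> 0"
  shows "\<exists>N. \<forall>d e. orthonormal M d e \<longrightarrow>
    (\<forall>i<d. cont (e i) \<and> (\<forall>x\<in>carrier G. conv \<phi> (e i) x = of_real \<nu> * e i x)) \<longrightarrow> d \<le> N"
proof -
  obtain B where B: "0 \<le> B" "\<And>f x. f \<in> l2 M \<Longrightarrow> cmod (conv \<phi> f x) \<le> B * l2_norm M f"
    "\<And>x. x \<in> carrier G \<Longrightarrow> l2_norm M (\<lambda>y. of_real (\<phi> (inv x \<otimes> y))) \<le> B"
    by (rule conv_sup_bound[OF \<phi>]) (rule that)
  have "d \<le> nat \<lceil>B\<^sup>2 / \<nu>\<^sup>2\<rceil>" if e: "orthonormal M d e"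
    and eig: "\<forall>i<d. cont (e i) \<and> (\<forall>x\<in>carrier G. conv \<phi> (e i) x = of_real \<nu> * e i x)" for d e
  proof -
    have pt: "(\<Sum>i<d. \<nu>\<^sup>2 * (cmod (e i x))\<^sup>2) \<le> B\<^sup>2" if x: "x \<in> carrier G" for x
    proof -
      let ?k = "\<lambda>y. complex_of_real (\<phi> (inv x \<otimes> y))"
      have k: "?k \<in> l2 M" by (rule cont_l2[OF kernel_section[OF \<phi> x]])
      have "\<nu>\<^sup>2 * (cmod (e i x))\<^sup>2 = (cmod (l2_inner M ?k (e i)))\<^sup>2" if "i < d" for i
      proof -
        have "cmod (of_real \<nu> * e i x) = cmod (conv \<phi> (e i) x)" using eig that x by simp
        also have "\<dots> = cmod (l2_inner M (e i) ?k)"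
          using conv_eq_inner[OF \<phi> l2_measurable[OF orthonormal_l2[OF e that]] x] by simp
        also have "\<dots> = cmod (l2_inner M ?k (e i))" by (subst l2_inner_commute) simp
        finally show ?thesis by (metis norm_mult norm_of_real power_mult_distrib power2_abs)
      qed
      then have "(\<Sum>i<d. \<nu>\<^sup>2 * (cmod (e i x))\<^sup>2) = (\<Sum>i<d. (cmod (l2_inner M ?k (e i)))\<^sup>2)"
        by (intro sum.cong) auto
      also have "\<dots> \<le> (l2_norm M ?k)\<^sup>2" by (rule Bessel_inequality[OF e k])
      also have "\<dots> \<le> B\<^sup>2" by (intro power_mono B(3) x) simp
      finally show ?thesis .
    qed
    have int: "integrable M (\<lambda>x. (cmod (e i x))\<^sup>2)" if "i < d" for i
      using orthonormal_l2[OF e that] by (simp add: l2_iff)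
    have "real d * \<nu>\<^sup>2 = (\<Sum>i<d. \<nu>\<^sup>2 * (l2_norm M (e i))\<^sup>2)"
      using orthonormal_norm[OF e] by simp
    also have "\<dots> = (LINT x|M. (\<Sum>i<d. \<nu>\<^sup>2 * (cmod (e i x))\<^sup>2))"
      using int by (subst Bochner_Integration.integral_sum) (auto simp: l2_norm_sq)
    also have "\<dots> \<le> (LINT x|M. B\<^sup>2)"
      using int pt by (intro integral_mono) auto
    also have "\<dots> = B\<^sup>2" by simp
    finally have "real d \<le> B\<^sup>2 / \<nu>\<^sup>2" using \<nu> by (simp add: field_simps)
    also have "\<dots> \<le> real (nat \<lceil>B\<^sup>2 / \<nu>\<^sup>2\<rceil>)" by (rule real_nat_ceiling_ge)
    finally show ?thesis by simp
  qed
  then show ?thesis by blast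
qed

text \<open>A convolution close to the identity does not annihilate \<open>v\<close>.  Its eigenspaces in \<open>coeff_perp\<close> for nonzero
  eigenvalues are finite-dimensional, and left-invariant as it commutes with left translations.\<close>

lemma ex_invariant_family:
  assumes v: "v \<in> coeff_perp" and nz: "l2_norm M v \<noteq> 0"
  shows "\<exists>d e. 0 < d \<and> invariant_family d e"
proof -
  have vc: "cont v" by (rule coeff_perpD(1)[OF v])
  have npos: "0 < l2_norm M v" using nz l2_norm_nonneg[of M v] by linarith
  obtain \<phi> where \<phi>: "symmetric_kernel \<phi>" and approx: "\<And>x. x \<in> carrier G \<Longrightarrow> cmod (conv \<phi> v x - v x) \<le> l2_norm M v / 2"
    by (rule approximate_identity[OF vc half_gt_zero[OF npos]]) (rule that)
  have c: "continuous_map T euclideanreal \<phi>" using \<phi> by (simp add: symmetric_kernel_def)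
  have cc: "cont (conv \<phi> v)" by (rule conv_cont[OF c cont_l2[OF vc]])
  have conv_nz: "l2_norm M (conv \<phi> v) \<noteq> 0"
  proof
    assume 0: "l2_norm M (conv \<phi> v) = 0"
    have "l2_norm M (\<lambda>x. conv \<phi> v x - v x) \<le> l2_norm M v / 2"
      using npos by (intro l2_norm_le_sup approx continuous_imp_borel_measurable continuous_map_diff cc vc) auto
    moreover have "\<bar>l2_norm M (conv \<phi> v) - l2_norm M v\<bar> \<le> l2_norm M (\<lambda>x. conv \<phi> v x - v x)"
      by (intro l2_norm_diff_abs cont_l2 cc vc)
    ultimately show False using npos 0 by simp
  qed
  note L = l2_subspace_l2[OF coeff_perp_subspace]
  obtain C where C: "0 \<le> C" "\<And>f. f \<in> l2 M \<Longrightarrow> l2_norm M (conv \<phi> f) \<le> C * l2_norm M f"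
    by (rule conv_l2_bound[OF c]) (rule that)
  have cpt: "\<exists>k z. strict_mono k \<and> z \<in> coeff_perp \<and> (\<lambda>n. l2_norm M (\<lambda>x. conv \<phi> (w (k n)) x - z x)) \<longlonglongrightarrow> 0"
    if w: "\<And>n::nat. w n \<in> coeff_perp \<and> l2_norm M (w n) \<le> 1" for w
  proof -
    have wl: "w n \<in> l2 M \<and> l2_norm M (w n) \<le> 1" for n using w[of n] L by simp
    obtain k z where k: "strict_mono k" and lim: "uniform_limit (carrier G) (\<lambda>n. conv \<phi> (w (k n))) z sequentially"
      by (rule conv_compact[OF c wl]) (rule that)
    have kc: "cont (conv \<phi> (w (k n)))" for n by (rule conv_cont[OF c]) (use wl in simp)
    note lim' = cont_uniform_limit[OF kc lim]
    have "l2_inner M (conv \<phi> (w (k n))) h = 0" if "h \<in> coeff_span" for n h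
      by (rule coeff_perpD(2)[OF coeff_perp_conv[OF \<phi>] that]) (use w in simp)
    then have "z \<in> coeff_perp"
      by (intro coeff_perp_limit[OF cont_l2[OF kc] lim'(1,2)]) simp
    with k lim'(2) show ?thesis by blast
  qed
  obtain \<nu> :: real and u where \<nu>: "\<nu> \<noteq> 0" and u: "u \<in> coeff_perp" "l2_norm M u \<noteq> 0"
    "l2_norm M (\<lambda>x. conv \<phi> u x - of_real \<nu> * u x) = 0"
  proof (rule compact_selfadjoint_eigenvector[OF coeff_perp_subspace, of "conv \<phi>" C v])
    show "conv \<phi> f \<in> coeff_perp" if "f \<in> coeff_perp" for f by (rule coeff_perp_conv[OF \<phi> that])
    show "conv \<phi> (\<lambda>x. a * f x + b * g x) = (\<lambda>x. a * conv \<phi> f x + b * conv \<phi> g x)"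
      if "f \<in> coeff_perp" "g \<in> coeff_perp" for f g a b
      by (rule conv_lincomb[OF c L[OF that(1)] L[OF that(2)]])
    show "l2_inner M (conv \<phi> f) g = l2_inner M f (conv \<phi> g)" if "f \<in> coeff_perp" "g \<in> coeff_perp" for f g
      by (rule conv_selfadjoint[OF \<phi> coeff_perpD(1)[OF that(1)] coeff_perpD(1)[OF that(2)]])
    show "l2_norm M (conv \<phi> f) \<le> C * l2_norm M f" if "f \<in> coeff_perp" for f by (rule C(2)[OF L[OF that]])
    show "\<exists>k z. strict_mono k \<and> z \<in> coeff_perp \<and> (\<lambda>n. l2_norm M (\<lambda>x. conv \<phi> (w (k n)) x - z x)) \<longlonglongrightarrow> 0"
      if "\<And>n::nat. w n \<in> coeff_perp \<and> l2_norm M (w n) \<le> 1" for w by (rule cpt[OF that])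
  qed (rule v, rule conv_nz, rule that)
  define S where "S = {f \<in> coeff_perp. \<forall>x\<in>carrier G. conv \<phi> f x = of_real \<nu> * f x}"
  have S: "l2_subspace M S"
    unfolding l2_subspace_def
  proof (intro conjI ballI allI subsetI)
    show "f \<in> l2 M" if "f \<in> S" for f using that L by (simp add: S_def)
    show "(\<lambda>x. 0) \<in> S" using coeff_perp_subspace by (simp add: S_def l2_subspace_def conv_def)
    fix f g a b assume f: "f \<in> S" and g: "g \<in> S"
    then show "(\<lambda>x. a * f x + b * g x) \<in> S"
      using l2_subspace_lincomb[OF coeff_perp_subspace] conv_lincomb[OF c L L]
      by (simp add: S_def algebra_simps)
  qed
  have uS: "u \<in> S"
  proof -
    have uc: "cont u" by (rule coeff_perpD(1)[OF u(1)])
    have "cont (\<lambda>x. conv \<phi> u x - of_real \<nu> * u x)"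
      by (intro continuous_map_diff conv_cont[OF c] cont_l2 uc cont_mult_const)
    from cont_null_imp_zero[OF this u(3)] show ?thesis using u(1) by (simp add: S_def)
  qed
  obtain N where N: "\<forall>d e. orthonormal M d e \<longrightarrow>
    (\<forall>i<d. cont (e i) \<and> (\<forall>x\<in>carrier G. conv \<phi> (e i) x = of_real \<nu> * e i x)) \<longrightarrow> d \<le> N"
    using conv_eigenspace_bound[OF c \<nu>] by (rule exE)
  have bound: "d \<le> N" if "orthonormal M d e" "\<And>i. i < d \<Longrightarrow> e i \<in> S" for d e
  proof -
    have "\<forall>i<d. cont (e i) \<and> (\<forall>x\<in>carrier G. conv \<phi> (e i) x = of_real \<nu> * e i x)"
      using that(2) coeff_perpD(1) by (simp add: S_def)
    then show ?thesis using N that(1) by blast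
  qed
  obtain d e where e: "orthonormal M d e" "\<And>i. i < d \<Longrightarrow> e i \<in> S"
    and span: "\<And>f. f \<in> S \<Longrightarrow> l2_norm M (\<lambda>x. f x - l2_proj M d e f x) = 0"
    proof (rule obtain_orthonormal_basis[OF S])
    show "m \<le> N" if "orthonormal M m f" "\<And>i. i < m \<Longrightarrow> f i \<in> S" for m f by (rule bound[OF that])
  qed (rule that)
  have d: "0 < d"
  proof (rule ccontr)
    assume "\<not> 0 < d"
    then have "l2_norm M u = 0" using span[OF uS] by (simp add: l2_proj_def)
    then show False using u(2) by simp
  qed
  have "invariant_family d e"
  proof (rule invariant_familyI[OF S _ e span])
    show "S \<subseteq> coeff_perp" by (auto simp: S_def)
    fix g f assume g: "g \<in> carrier G" and f: "f \<in> S"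
    have "conv \<phi> (\<lambda>x. f (g \<otimes> x)) x = of_real \<nu> * f (g \<otimes> x)" if "x \<in> carrier G" for x
      using f g that by (simp add: conv_translate[OF g that] S_def)
    then have "(\<lambda>x. f (g \<otimes> x)) \<in> S"
      using f coeff_perp_translate[OF g, of f] by (simp add: S_def)
    then show "\<exists>h\<in>S. \<forall>x\<in>carrier G. f (g \<otimes> x) = h x" by (rule bexI[rotated]) simp
  qed
  with d show ?thesis by blast
qed

text \<open>The index convention is \<open>e (g x) = \<rho>(g) e(x)\<close> for the column \<open>e = (e\<^sub>1, \<dots>, e\<^sub>d)\<close>; this makes left
  translation a homomorphism rather than an anti-homomorphism.\<close>

definition family_rep :: "nat \<Rightarrow> (nat \<Rightarrow> 'a \<Rightarrow> complex) \<Rightarrow> 'a \<Rightarrow> complex mat" where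
  "family_rep d e g = Matrix.mat d d (\<lambda>(i, j). l2_inner M (\<lambda>x. e i (g \<otimes> x)) (e j))"

lemma family_rep_carrier [simp]: "family_rep d e g \<in> carrier_mat d d"
  by (simp add: family_rep_def)

lemma rep_dim_family_rep [simp]: "rep_dim G (family_rep d e) = d"
  by (simp add: rep_dim_def family_rep_def)

lemma invariant_familyD:
  assumes "invariant_family d e"
  shows "orthonormal M d e" "i < d \<Longrightarrow> cont (e i)" "i < d \<Longrightarrow> e i \<in> coeff_perp"
    and "g \<in> carrier G \<Longrightarrow> i < d \<Longrightarrow> x \<in> carrier G \<Longrightarrow>
      e i (g \<otimes> x) = (\<Sum>j<d. family_rep d e g $$ (i, j) * e j x)"
  using assms coeff_perpD(1) by (auto simp: invariant_family_def l2_proj_def family_rep_def)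

lemma family_rep_unitary:
  assumes e: "invariant_family d e"
  shows "unitary_rep G T (family_rep d e)"
proof -
  let ?\<rho> = "family_rep d e"
  note orth = invariant_familyD(1)[OF e] and ec = invariant_familyD(2)[OF e] and act = invariant_familyD(4)[OF e]
  have coeff: "?\<rho> g $$ (i, j) = l2_inner M (\<lambda>x. e i (g \<otimes> x)) (e j)" if "i < d" "j < d" for g i j
    using that by (simp add: family_rep_def)
  have "unitary_mat d (?\<rho> g)" if g: "g \<in> carrier G" for g
  proof -
    have "?\<rho> g * mat_adjoint (?\<rho> g) = 1\<^sub>m d"
    proof (rule eq_matI)
      fix i j assume "i < dim_row (1\<^sub>m d)" "j < dim_col (1\<^sub>m d)"
      then have ij: "i < d" "j < d" by auto
      have "(if i = j then 1 else 0) = l2_inner M (e i) (e j)"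
        using orthonormal_inner[OF orth ij] by simp
      also have "\<dots> = l2_inner M (\<lambda>x. e i (g \<otimes> x)) (\<lambda>x. e j (g \<otimes> x))"
        using l2_inner_translation[OF g ec[OF ij(1)] ec[OF ij(2)]] by simp
      also have "\<dots> = l2_inner M (\<lambda>x. \<Sum>k<d. ?\<rho> g $$ (i, k) * e k x) (\<lambda>x. \<Sum>k<d. ?\<rho> g $$ (j, k) * e k x)"
        unfolding l2_inner_def
        by (intro Bochner_Integration.integral_cong refl) (simp add: act[OF g ij(1)] act[OF g ij(2)])
      also have "\<dots> = (\<Sum>k<d. ?\<rho> g $$ (i, k) * cnj (?\<rho> g $$ (j, k)))"
        by (rule orthonormal_inner_sums[OF orth])
      also have "\<dots> = (?\<rho> g * mat_adjoint (?\<rho> g)) $$ (i, j)"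
        unfolding mat_mult_index[OF family_rep_carrier mat_adjoint_carrier[OF family_rep_carrier] ij]
        using ij by (intro sum.cong refl) (simp add: mat_adjoint_index[OF family_rep_carrier])
      finally show "(?\<rho> g * mat_adjoint (?\<rho> g)) $$ (i, j) = 1\<^sub>m d $$ (i, j)" using ij by simp
    qed (simp_all add: family_rep_def)
    then have "mat_adjoint (?\<rho> g) * ?\<rho> g = 1\<^sub>m d"
      by (rule mat_mult_left_right_inverse[OF family_rep_carrier mat_adjoint_carrier[OF family_rep_carrier]])
    then show ?thesis by (simp add: unitary_mat_def)
  qed
  moreover have "?\<rho> (g \<otimes> h) = ?\<rho> g * ?\<rho> h" if g: "g \<in> carrier G" and h: "h \<in> carrier G" for g h
  proof (rule eq_matI)
    fix i j assume "i < dim_row (?\<rho> g * ?\<rho> h)" "j < dim_col (?\<rho> g * ?\<rho> h)"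
    then have ij: "i < d" "j < d" by (auto simp: family_rep_def)
    have "?\<rho> (g \<otimes> h) $$ (i, j) = l2_inner M (\<lambda>x. \<Sum>k<d. ?\<rho> g $$ (i, k) * e k (h \<otimes> x)) (e j)"
      unfolding coeff[OF ij] using act[OF g ij(1)] g h
      by (intro l2_inner_cong_carrier) (simp add: m_assoc)
    also have "\<dots> = (\<Sum>k<d. ?\<rho> g $$ (i, k) * l2_inner M (\<lambda>x. e k (h \<otimes> x)) (e j))"
    proof -
      have l: "(\<lambda>x. e k (h \<otimes> x)) \<in> l2 M" if "k < d" for k by (rule cont_l2[OF cont_translate[OF ec[OF that] h]])
      have "l2_inner M (\<lambda>x. \<Sum>k<d. ?\<rho> g $$ (i, k) * e k (h \<otimes> x)) (e j) =
          (\<Sum>k<d. l2_inner M (\<lambda>x. ?\<rho> g $$ (i, k) * e k (h \<otimes> x)) (e j))"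
        by (intro l2_inner_sum_left l2_scale l orthonormal_l2[OF orth ij(2)]) simp
      then show ?thesis by simp
    qed
    also have "\<dots> = (?\<rho> g * ?\<rho> h) $$ (i, j)"
      unfolding mat_mult_index[OF family_rep_carrier family_rep_carrier ij]
      using ij by (intro sum.cong refl) (simp add: coeff)
    finally show "?\<rho> (g \<otimes> h) $$ (i, j) = (?\<rho> g * ?\<rho> h) $$ (i, j)" .
  qed (simp_all add: family_rep_def)
  moreover have "cont (\<lambda>g. ?\<rho> g $$ (i, j))" if ij: "i < d" "j < d" for i j
  proof -
    have cnje: "cont (\<lambda>x. cnj (e j x))"
      using continuous_map_compose[OF ec[OF ij(2)], of euclidean cnj] by (simp add: o_def continuous_on_cnj)
    have "continuous_map (prod_topology T T) euclidean (\<lambda>p. e i (fst p \<otimes> snd p) * cnj (e j (snd p)))"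
    proof -
      have 1: "continuous_map (prod_topology T T) euclidean (\<lambda>p. e i (fst p \<otimes> snd p))"
        by (rule cont_compose[OF ec[OF ij(1)]]) (intro continuous_map_mult continuous_map_fst continuous_map_snd)
      have 2: "continuous_map (prod_topology T T) euclidean (\<lambda>p. cnj (e j (snd p)))"
        by (rule cont_compose[OF cnje continuous_map_snd])
      from continuous_map_compose[OF continuous_map_pairedI[OF 1 2], of euclidean "\<lambda>(a, b). a * b"]
      show ?thesis by (simp add: o_def split_beta continuous_on_mult continuous_on_fst continuous_on_snd)
    qed
    from cont_parametric_integral[OF this] show ?thesis
      by (simp add: coeff[OF ij] l2_inner_def)
  qed
  ultimately show ?thesis by (simp add: unitary_rep_def)
qed

text \<open>A proper invariant subspace would yield an invariant family with fewer elements.\<close>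

lemma family_rep_irreducible:
  assumes e: "invariant_family d e" and d: "0 < d"
    and minimal: "\<And>m f. 0 < m \<Longrightarrow> invariant_family m f \<Longrightarrow> d \<le> m"
  shows "irreducible_rep G (family_rep d e)"
  unfolding irreducible_rep_def rep_dim_family_rep
proof (intro conjI allI impI d)
  let ?\<rho> = "family_rep d e"
  note orth = invariant_familyD(1)[OF e] and ec = invariant_familyD(2)[OF e] and act = invariant_familyD(4)[OF e]
  fix W assume sub: "subspace class_ring W (module_vec TYPE(complex) d)"
    and invW: "\<forall>x\<in>carrier G. \<forall>w\<in>W. ?\<rho> x *\<^sub>v w \<in> W"
  note W = subspace_module_vecD[OF sub]
  show "W = {0\<^sub>v d} \<or> W = carrier_vec d"
  proof (cases "W = {0\<^sub>v d}")
    case False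
    then obtain w0 where w0: "w0 \<in> W" "w0 \<noteq> 0\<^sub>v d" using W(2) by blast
    (* the conjugates make translation by g act on F w as the matrix of the inverse of g on w *)
    define F where "F w = (\<lambda>x. \<Sum>i<d. cnj (w $ i) * e i x)" for w :: "complex vec"
    define S where "S = F ` W"
    have Finner: "l2_inner M (F w) (e i) = cnj (w $ i)" if "i < d" for w i
      unfolding F_def by (rule orthonormal_inner_sum_left[OF orth that])
    have Fperp: "F w \<in> coeff_perp" for w
      unfolding F_def using invariant_familyD(3)[OF e]
      by (intro l2_subspace_sum[OF coeff_perp_subspace] l2_subspace_scale[OF coeff_perp_subspace]) simp
    have Fl2: "F w \<in> l2 M" for w by (rule l2_subspace_l2[OF coeff_perp_subspace Fperp])
    have Fproj: "F w = l2_proj M d e (F w)" for w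
      by (rule ext) (simp add: l2_proj_def Finner, simp add: F_def)
    have Fnorm: "(l2_norm M (F w))\<^sup>2 = (\<Sum>i<d. (cmod (l2_inner M (F w) (e i)))\<^sup>2)" for w
    proof -
      have "l2_norm M (\<lambda>x. F w x - l2_proj M d e (F w) x) = 0"
        by (subst Fproj[symmetric]) simp
      then show ?thesis using l2_proj_residual_norm[OF orth Fl2, of w] by simp
    qed
    have S: "l2_subspace M S"
      unfolding l2_subspace_def
    proof (intro conjI ballI allI subsetI)
      show "f \<in> l2 M" if "f \<in> S" for f using that Fl2 by (auto simp: S_def)
      have "F (0\<^sub>v d) = (\<lambda>x. 0)" by (simp add: F_def)
      then show "(\<lambda>x. 0) \<in> S" using W(2) by (metis S_def imageI)
      fix f g a b assume "f \<in> S" "g \<in> S"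
      then obtain v w where vw: "v \<in> W" "w \<in> W" "f = F v" "g = F w" by (auto simp: S_def)
      have vwc: "v \<in> carrier_vec d" "w \<in> carrier_vec d" using vw W(1) by auto
      have "(\<lambda>x. a * f x + b * g x) = F (cnj a \<cdot>\<^sub>v v + cnj b \<cdot>\<^sub>v w)"
      proof
        fix x
        have "F (cnj a \<cdot>\<^sub>v v + cnj b \<cdot>\<^sub>v w) x = (\<Sum>i<d. a * (cnj (v $ i) * e i x) + b * (cnj (w $ i) * e i x))"
          unfolding F_def using vwc by (intro sum.cong refl) (simp add: distrib_right mult.assoc)
        then show "a * f x + b * g x = F (cnj a \<cdot>\<^sub>v v + cnj b \<cdot>\<^sub>v w) x"
          by (simp add: vw F_def sum.distrib sum_distrib_left)
      qed
      moreover have "cnj a \<cdot>\<^sub>v v + cnj b \<cdot>\<^sub>v w \<in> W" by (intro W(3,4) vw)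
      ultimately show "(\<lambda>x. a * f x + b * g x) \<in> S" by (simp add: S_def)
    qed
    (* Parseval for each f_k in the basis e; summed over k first, Bessel bounds each summand by 1 *)
    have count: "real m = (\<Sum>i<d. \<Sum>k<m. (cmod (l2_inner M (e i) (f k)))\<^sup>2)"
      if f: "orthonormal M m f" "\<And>k. k < m \<Longrightarrow> f k \<in> S" for m f
    proof -
      have "(\<Sum>i<d. (cmod (l2_inner M (e i) (f k)))\<^sup>2) = 1" if k: "k < m" for k
      proof -
        obtain w where w: "f k = F w" using f(2)[OF k] by (auto simp: S_def)
        have "(\<Sum>i<d. (cmod (l2_inner M (e i) (f k)))\<^sup>2) = (\<Sum>i<d. (cmod (l2_inner M (f k) (e i)))\<^sup>2)"
          by (subst l2_inner_commute) simp
        also have "\<dots> = (l2_norm M (f k))\<^sup>2" unfolding w by (rule Fnorm[symmetric])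
        finally show ?thesis using orthonormal_norm[OF f(1) k] by simp
      qed
      then have "real m = (\<Sum>k<m. \<Sum>i<d. (cmod (l2_inner M (e i) (f k)))\<^sup>2)" by simp
      also have "\<dots> = (\<Sum>i<d. \<Sum>k<m. (cmod (l2_inner M (e i) (f k)))\<^sup>2)" by (rule sum.swap)
      finally show ?thesis .
    qed
    have bessel: "(\<Sum>k<m. (cmod (l2_inner M (e i) (f k)))\<^sup>2) \<le> 1" if "orthonormal M m f" "i < d" for m f i
      using Bessel_inequality[OF that(1) orthonormal_l2[OF orth that(2)]] orthonormal_norm[OF orth that(2)] by simp
    have bound: "m \<le> d" if f: "orthonormal M m f" "\<And>k. k < m \<Longrightarrow> f k \<in> S" for m f
    proof -
      have "(\<Sum>i<d. \<Sum>k<m. (cmod (l2_inner M (e i) (f k)))\<^sup>2) \<le> (\<Sum>i<d. 1)"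
        by (intro sum_mono bessel[OF f(1)]) simp
      then show ?thesis using count[OF f] by simp
    qed
    obtain m f where f: "orthonormal M m f" "\<And>k. k < m \<Longrightarrow> f k \<in> S"
      and span: "\<And>h. h \<in> S \<Longrightarrow> l2_norm M (\<lambda>x. h x - l2_proj M m f h x) = 0"
      proof (rule obtain_orthonormal_basis[OF S])
        show "m \<le> d" if "orthonormal M m f" "\<And>i. i < m \<Longrightarrow> f i \<in> S" for m f by (rule bound[OF that])
      qed (rule that)
    have m0: "0 < m"
    proof (rule ccontr)
      assume "\<not> 0 < m"
      then have "l2_norm M (F w0) = 0" using span[of "F w0"] w0(1) by (simp add: l2_proj_def S_def)
      then have "(\<Sum>i<d. (cmod (l2_inner M (F w0) (e i)))\<^sup>2) = 0" using Fnorm[of w0] by simp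
      then have "\<forall>i\<in>{..<d}. (cmod (l2_inner M (F w0) (e i)))\<^sup>2 = 0" by (subst (asm) sum_nonneg_eq_0_iff) auto
      then have "w0 $ i = 0" if "i < d" for i using that by (simp add: Finner)
      then have "w0 = 0\<^sub>v d" using w0(1) W(1) by (intro eq_vecI) auto
      then show False using w0(2) by simp
    qed
    have "invariant_family m f"
    proof (rule invariant_familyI[OF S _ f span])
      show "S \<subseteq> coeff_perp" using Fperp by (auto simp: S_def)
      fix g h assume g: "g \<in> carrier G" and "h \<in> S"
      then obtain w where w: "w \<in> W" "h = F w" by (auto simp: S_def)
      have wc: "w \<in> carrier_vec d" using w W(1) by blast
      define w' where "w' = ?\<rho> (inv g) *\<^sub>v w"
      have w'W: "w' \<in> W" using invW w(1) g by (simp add: w'_def)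
      have \<rho>inv: "?\<rho> (inv g) $$ (j, i) = cnj (?\<rho> g $$ (i, j))" if "i < d" "j < d" for i j
      proof -
        have "?\<rho> (inv g) $$ (j, i) = l2_inner M (\<lambda>x. e j (inv g \<otimes> x)) (e i)" using that by (simp add: family_rep_def)
        also have "\<dots> = l2_inner M (\<lambda>x. e j (inv g \<otimes> (g \<otimes> x))) (\<lambda>x. e i (g \<otimes> x))"
          using l2_inner_translation[OF g cont_translate[OF ec[OF that(2)] inv_closed[OF g]] ec[OF that(1)]] by simp
        also have "\<dots> = l2_inner M (e j) (\<lambda>x. e i (g \<otimes> x))"
          using g by (intro l2_inner_cong_carrier) (simp add: m_assoc[symmetric])
        also have "\<dots> = cnj (?\<rho> g $$ (i, j))"
          using that by (subst l2_inner_commute) (simp add: family_rep_def)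
        finally show ?thesis .
      qed
      have w'i: "w' $ j = (\<Sum>i<d. cnj (?\<rho> g $$ (i, j)) * w $ i)" if "j < d" for j
        unfolding w'_def using that wc \<rho>inv
        by (simp add: mult_mat_vec_def scalar_prod_def family_rep_def lessThan_atLeast0)
      have "h (g \<otimes> x) = F w' x" if x: "x \<in> carrier G" for x
      proof -
        have "h (g \<otimes> x) = (\<Sum>i<d. \<Sum>j<d. cnj (w $ i) * (?\<rho> g $$ (i, j) * e j x))"
          unfolding w(2) F_def using act[OF g _ x] by (simp add: sum_distrib_left)
        also have "\<dots> = (\<Sum>j<d. \<Sum>i<d. cnj (w $ i) * (?\<rho> g $$ (i, j) * e j x))" by (rule sum.swap)
        also have "\<dots> = F w' x"
          unfolding F_def by (intro sum.cong refl) (simp add: w'i sum_distrib_left mult_ac)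
        finally show ?thesis .
      qed
      then show "\<exists>k\<in>S. \<forall>x\<in>carrier G. h (g \<otimes> x) = k x" using w'W by (auto simp: S_def)
    qed
    then have "d \<le> m" by (rule minimal[OF m0])
    with bound[OF f] have md: "m = d" by simp
    have one: "(\<Sum>k<m. (cmod (l2_inner M (e i) (f k)))\<^sup>2) = 1" if i: "i < d" for i
    proof (rule ccontr)
      assume "(\<Sum>k<m. (cmod (l2_inner M (e i) (f k)))\<^sup>2) \<noteq> 1"
      then have "(\<Sum>k<m. (cmod (l2_inner M (e i) (f k)))\<^sup>2) < 1" using bessel[OF f(1) i] by simp
      then have "(\<Sum>i<d. \<Sum>k<m. (cmod (l2_inner M (e i) (f k)))\<^sup>2) < (\<Sum>i<d. 1)"
        using i bessel[OF f(1)] by (intro sum_strict_mono_ex1) auto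
      then show False using count[OF f] md by simp
    qed
    have unit: "unit_vec d i \<in> W" if i: "i < d" for i
    proof -
      have "(l2_norm M (\<lambda>x. e i x - l2_proj M m f (e i) x))\<^sup>2 = 0"
        using l2_proj_residual_norm[OF f(1) orthonormal_l2[OF orth i]] one[OF i] orthonormal_norm[OF orth i] by simp
      then have null: "l2_norm M (\<lambda>x. e i x - l2_proj M m f (e i) x) = 0" by simp
      have "l2_proj M m f (e i) \<in> S" by (rule l2_proj_in_subspace[OF S f(2)])
      then obtain w where w: "w \<in> W" "l2_proj M m f (e i) = F w" by (auto simp: S_def)
      have "w = unit_vec d i"
      proof (rule eq_vecI)
        fix j assume "j < dim_vec (unit_vec d i)"
        then have j: "j < d" by simp
        have "cmod (l2_inner M (\<lambda>x. e i x - F w x) (e j)) \<le> l2_norm M (\<lambda>x. e i x - F w x) * l2_norm M (e j)"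
          by (intro l2_Cauchy_Schwarz l2_diff orthonormal_l2[OF orth] i j Fl2)
        then have "l2_inner M (\<lambda>x. e i x - F w x) (e j) = 0" using null w(2) by simp
        then have "l2_inner M (e i) (e j) = cnj (w $ j)"
          using l2_inner_diff_left[OF orthonormal_l2[OF orth i] Fl2 orthonormal_l2[OF orth j]] Finner[OF j] by simp
        then have "cnj (w $ j) = (if i = j then 1 else 0)" using orthonormal_inner[OF orth i j] by simp
        then have "w $ j = (if i = j then 1 else 0)" by (metis complex_cnj_cnj complex_cnj_one complex_cnj_zero)
        then show "w $ j = unit_vec d i $ j" using i j by simp
      qed (use w(1) W(1) in auto)
      with w(1) show ?thesis by simp
    qed
    have "w \<in> W" if w: "w \<in> carrier_vec d" for w
    proof -
      have "vec d (\<lambda>i. if i < n then w $ i else 0) \<in> W" if "n \<le> d" for n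
        using that
      proof (induction n)
        case 0
        have "vec d (\<lambda>i. if i < 0 then w $ i else 0) = 0\<^sub>v d" by (intro eq_vecI) auto
        then show ?case using W(2) by simp
      next
        case (Suc n)
        have "vec d (\<lambda>i. if i < Suc n then w $ i else 0) = vec d (\<lambda>i. if i < n then w $ i else 0) + w $ n \<cdot>\<^sub>v unit_vec d n"
          using Suc.prems by (intro eq_vecI) (auto simp: less_Suc_eq)
        moreover have "vec d (\<lambda>i. if i < n then w $ i else 0) + w $ n \<cdot>\<^sub>v unit_vec d n \<in> W"
          using Suc by (intro W(3,4) unit) auto
        ultimately show ?case by simp
      qed
      from this[OF order_refl] have "vec d (\<lambda>i. if i < d then w $ i else 0) \<in> W" .
      moreover have "vec d (\<lambda>i. if i < d then w $ i else 0) = w" using w by (intro eq_vecI) auto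
      ultimately show ?thesis by simp
    qed
    then show ?thesis using W(1) by blast
  qed simp
qed

text \<open>In an invariant family of least size, \<open>e\<^sub>0 (x) = \<Sum>\<^sub>j \<rho>\<^sub>0\<^sub>j(x) e\<^sub>j(1)\<close> is a combination of coefficients of an irreducible
  representation \<open>\<rho>\<close>, and yet orthogonal to all of them.\<close>

lemma coeff_perp_trivial:
  assumes v: "v \<in> coeff_perp"
  shows "l2_norm M v = 0"
proof (rule ccontr)
  assume nz: "l2_norm M v \<noteq> 0"
  define P where "P d \<longleftrightarrow> 0 < d \<and> (\<exists>e. invariant_family d e)" for d
  have "\<exists>d. P d" using ex_invariant_family[OF v nz] by (auto simp: P_def)
  then have P: "P (LEAST d. P d)" by (rule LeastI_ex)
  define d where "d = (LEAST d. P d)"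
  obtain e where d: "0 < d" and e: "invariant_family d e" using P by (auto simp: P_def d_def)
  have minimal: "d \<le> m" if "0 < m" "invariant_family m f" for m f
    unfolding d_def by (rule Least_le) (use that in \<open>auto simp: P_def\<close>)
  let ?\<rho> = "family_rep d e"
  have \<rho>: "?\<rho> \<in> unitary_irreps G T"
    using family_rep_unitary[OF e] family_rep_irreducible[OF e d minimal] by (simp add: unitary_irreps_def)
  have "e 0 \<in> coeff_span"
  proof (rule coeff_span_combination)
    show "(\<lambda>x. ?\<rho> x $$ (0, j)) \<in> coeff_span" if "j \<in> {..<d}" for j
      using that d by (intro coeff_in_span[OF \<rho>]) auto
    show "e 0 x = (\<Sum>j<d. e j \<one> * ?\<rho> x $$ (0, j))" if x: "x \<in> carrier G" for x
      using invariant_familyD(4)[OF e x d one_closed] x by (simp add: mult.commute)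
  qed
  then have "l2_inner M (e 0) (e 0) = 0" using coeff_perpD(2)[OF invariant_familyD(3)[OF e d]] by blast
  then show False using orthonormal_inner[OF invariant_familyD(1)[OF e] d d] by simp
qed

text \<open>For a sequence \<open>e\<^sub>n\<close> in the span that minimises the distance to \<open>f\<close>, the residuals are a Cauchy sequence and
  asymptotically orthogonal to the span.  Convolution turns this into uniform convergence to a function in
  \<open>coeff_perp\<close>, so the convolutions of the \<open>e\<^sub>n\<close> approximate that of \<open>f\<close>.\<close>

theorem Peter_Weyl_density:
  assumes f: "cont f" and \<epsilon>: "0 < \<epsilon>"
  obtains h where "h \<in> coeff_span" "l2_norm M (\<lambda>x. f x - h x) < \<epsilon>"
proof -
  obtain \<phi> where \<phi>: "symmetric_kernel \<phi>" and approx: "\<And>x. x \<in> carrier G \<Longrightarrow> cmod (conv \<phi> f x - f x) \<le> \<epsilon> / 2"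
    by (rule approximate_identity[OF f half_gt_zero[OF \<epsilon>]]) (rule that)
  have c: "continuous_map T euclideanreal \<phi>" using \<phi> by (simp add: symmetric_kernel_def)
  obtain e where e: "\<And>n::nat. e n \<in> coeff_span"
    and orth: "\<And>n h. h \<in> coeff_span \<Longrightarrow> cmod (l2_inner M (\<lambda>x. f x - e n x) h) \<le> l2_norm M h / sqrt (Suc n)"
    and cauchy: "\<And>n m. l2_norm M (\<lambda>x. e n x - e m x) \<le> 1 / sqrt (Suc n) + 1 / sqrt (Suc m)"
    by (rule minimising_sequence[OF coeff_span_subspace cont_l2[OF f]]) (rule that)
  define w where "w n = (\<lambda>x. f x - e n x)" for n
  have ec: "cont (e n)" for n by (rule coeff_span_cont[OF e])
  have wc: "cont (w n)" for n unfolding w_def by (intro continuous_map_diff f ec)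
  have Kdiff: "conv \<phi> (\<lambda>x. a x - b x) = (\<lambda>x. conv \<phi> a x - conv \<phi> b x)" if "cont a" "cont b" for a b
    using conv_lincomb[OF c cont_l2[OF that(1)] cont_l2[OF that(2)], of 1 "-1"] by simp
  have sq: "(\<lambda>n. 1 / sqrt (Suc n)) \<longlonglongrightarrow> 0"
  proof -
    have "(\<lambda>n. sqrt (inverse (real (Suc n)))) \<longlonglongrightarrow> sqrt 0"
      by (intro tendsto_real_sqrt LIMSEQ_inverse_real_of_nat)
    then show ?thesis by (simp add: real_sqrt_inverse divide_inverse)
  qed
  obtain B where B: "0 \<le> B" "\<And>f x. f \<in> l2 M \<Longrightarrow> cmod (conv \<phi> f x) \<le> B * l2_norm M f"
    "\<And>x. x \<in> carrier G \<Longrightarrow> l2_norm M (\<lambda>y. of_real (\<phi> (inv x \<otimes> y))) \<le> B"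
    by (rule conv_sup_bound[OF c]) (rule that)
  have "uniformly_Cauchy_on (carrier G) (\<lambda>n. conv \<phi> (w n))"
    unfolding uniformly_Cauchy_on_def
  proof (intro allI impI)
    fix \<delta> :: real assume \<delta>: "0 < \<delta>"
    define \<eta> where "\<eta> = \<delta> / (2 * (B + 1))"
    have \<eta>: "0 < \<eta>" "\<eta> * (2 * (B + 1)) = \<delta>" using \<delta> B(1) by (simp_all add: \<eta>_def)
    from order_tendstoD(2)[OF sq \<eta>(1)] obtain N where N: "\<And>n. N \<le> n \<Longrightarrow> 1 / sqrt (Suc n) < \<eta>"
      by (auto simp: eventually_sequentially)
    have "dist (conv \<phi> (w n) x) (conv \<phi> (w m) x) < \<delta>" if nm: "N \<le> n" "N \<le> m" for x n m
    proof -
      have "conv \<phi> (w n) x - conv \<phi> (w m) x = conv \<phi> (\<lambda>y. w n y - w m y) x"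
        by (simp add: Kdiff[OF wc wc])
      also have "(\<lambda>y. w n y - w m y) = (\<lambda>y. e m y - e n y)" by (simp add: w_def)
      finally have "dist (conv \<phi> (w n) x) (conv \<phi> (w m) x) = cmod (conv \<phi> (\<lambda>y. e m y - e n y) x)"
        by (simp add: dist_norm)
      also have "\<dots> \<le> B * l2_norm M (\<lambda>y. e m y - e n y)"
        by (intro B(2) cont_l2 continuous_map_diff ec)
      also have "\<dots> \<le> B * (1 / sqrt (Suc m) + 1 / sqrt (Suc n))"
        by (intro mult_left_mono cauchy B(1))
      also have "\<dots> \<le> B * (\<eta> + \<eta>)"
        by (intro mult_left_mono add_mono less_imp_le[OF N] nm B(1))
      also have "\<dots> = \<eta> * (2 * (B + 1)) - 2 * \<eta>" by (simp add: algebra_simps)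
      also have "\<dots> < \<delta>" using \<eta> by simp
      finally show ?thesis .
    qed
    then show "\<exists>M. \<forall>x\<in>carrier G. \<forall>m\<ge>M. \<forall>n\<ge>M. dist (conv \<phi> (w m) x) (conv \<phi> (w n) x) < \<delta>" by blast
  qed
  then have "uniformly_convergent_on (carrier G) (\<lambda>n. conv \<phi> (w n))" by (rule Cauchy_uniformly_convergent)
  then obtain z where z: "uniform_limit (carrier G) (\<lambda>n. conv \<phi> (w n)) z sequentially"
    unfolding uniformly_convergent_on_def by blast
  have Kc: "cont (conv \<phi> (w n))" for n by (rule conv_cont[OF c cont_l2[OF wc]])
  note lim = cont_uniform_limit[OF Kc z]
  have "z \<in> coeff_perp"
  proof (rule coeff_perp_limit[OF cont_l2[OF Kc] lim(1,2)])
    fix h assume h: "h \<in> coeff_span"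
    have Kh: "conv \<phi> h \<in> coeff_span" by (rule conv_coeff_span[OF c h])
    show "(\<lambda>n. l2_inner M (conv \<phi> (w n)) h) \<longlonglongrightarrow> 0"
    proof (rule Lim_null_comparison)
      show "\<forall>\<^sub>F n in sequentially. cmod (l2_inner M (conv \<phi> (w n)) h) \<le> l2_norm M (conv \<phi> h) * (1 / sqrt (Suc n))"
        using orth[OF Kh] by (intro always_eventually allI)
          (simp add: conv_selfadjoint[OF \<phi> wc coeff_span_cont[OF h]], simp add: w_def)
      show "(\<lambda>n. l2_norm M (conv \<phi> h) * (1 / sqrt (Suc n))) \<longlonglongrightarrow> 0"
        using tendsto_mult_left[OF sq, of "l2_norm M (conv \<phi> h)"] by simp
    qed
  qed
  then have z0: "l2_norm M z = 0" by (rule coeff_perp_trivial)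
  have "(\<lambda>n. l2_norm M (conv \<phi> (w n))) \<longlonglongrightarrow> 0"
    using l2_norm_tendsto[OF cont_l2[OF Kc] cont_l2[OF lim(1)] lim(2)] z0 by simp
  from order_tendstoD(2)[OF this, of "\<epsilon> / 2"] \<epsilon> obtain n where n: "l2_norm M (conv \<phi> (w n)) < \<epsilon> / 2"
    by (auto simp: eventually_sequentially)
  have fc: "cont (conv \<phi> f)" and ecc: "cont (conv \<phi> (e n))" by (intro conv_cont[OF c] cont_l2 f ec)+
  have "l2_norm M (\<lambda>x. f x - conv \<phi> (e n) x) \<le>
      l2_norm M (\<lambda>x. f x - conv \<phi> f x) + l2_norm M (\<lambda>x. conv \<phi> f x - conv \<phi> (e n) x)"
    by (intro l2_dist_triangle cont_l2 f fc ecc)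
  moreover have "l2_norm M (\<lambda>x. conv \<phi> f x - f x) \<le> \<epsilon> / 2"
    using \<epsilon> by (intro l2_norm_le_sup approx continuous_imp_borel_measurable continuous_map_diff f fc) auto
  moreover have "(\<lambda>x. conv \<phi> f x - conv \<phi> (e n) x) = conv \<phi> (w n)"
    unfolding w_def by (simp add: Kdiff[OF f ec])
  ultimately have "l2_norm M (\<lambda>x. f x - conv \<phi> (e n) x) < \<epsilon>"
    using n l2_norm_minus_commute[of M f "conv \<phi> f"] by simp
  then show thesis using that[OF conv_coeff_span[OF c e]] by blast
qed

end

section \<open>Total sets and a criterion for nuclearity\<close>

definition closed_l2_subspace :: "'a measure \<Rightarrow> ('a \<Rightarrow> complex) set \<Rightarrow> bool" where
  "closed_l2_subspace M S \<longleftrightarrow> l2_subspace M S \<and>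
     (\<forall>w f. (\<forall>n::nat. w n \<in> S) \<longrightarrow> f \<in> l2 M \<longrightarrow> (\<lambda>n. l2_norm M (\<lambda>x. w n x - f x)) \<longlonglongrightarrow> 0 \<longrightarrow> f \<in> S)"

lemma closed_l2_subspace_imp_subspace: "closed_l2_subspace M S \<Longrightarrow> l2_subspace M S"
  by (simp add: closed_l2_subspace_def)

lemma closed_l2_subspace_limit:
  assumes "closed_l2_subspace M S" "\<And>n::nat. w n \<in> S" "f \<in> l2 M"
    and "(\<lambda>n. l2_norm M (\<lambda>x. w n x - f x)) \<longlonglongrightarrow> 0"
  shows "f \<in> S"
  by (rule assms(1)[unfolded closed_l2_subspace_def, THEN conjunct2, rule_format, OF assms(2-4)])

lemma closed_l2_subspace_null:
  assumes "closed_l2_subspace M S" "g \<in> S" "f \<in> l2 M" "l2_norm M (\<lambda>x. g x - f x) = 0"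
  shows "f \<in> S"
  by (rule closed_l2_subspace_limit[OF assms(1), of "\<lambda>_. g"]) (use assms in simp_all)

text \<open>Linearity of an operator holds only up to null functions, so differences of values are
  estimated directly.\<close>

lemma bounded_operator_l2D:
  assumes A: "bounded_operator (L2 M) (L2 M) A"
  obtains C where "0 \<le> C" "\<And>f. f \<in> l2 M \<Longrightarrow> A f \<in> l2 M"
    "\<And>f g a b. f \<in> l2 M \<Longrightarrow> g \<in> l2 M \<Longrightarrow>
      l2_norm M (\<lambda>x. A (\<lambda>x. a * f x + b * g x) x - (a * A f x + b * A g x)) = 0"
    "\<And>f g. f \<in> l2 M \<Longrightarrow> g \<in> l2 M \<Longrightarrow> l2_norm M (\<lambda>x. A f x - A g x) \<le> C * l2_norm M (\<lambda>x. f x - g x)"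
proof -
  note lin = A[unfolded bounded_operator_def linear_operator_def]
  have Al: "A f \<in> l2 M" if "f \<in> l2 M" for f using lin that by blast
  have add: "l2_norm M (\<lambda>x. A (\<lambda>x. f x + g x) x - (A f x + A g x)) = 0" if "f \<in> l2 M" "g \<in> l2 M" for f g
  proof -
    have "sn_norm (L2 M) (A (f + g) - (A f + A g)) = 0" using lin that by blast
    then show ?thesis by (simp add: plus_fun_def fun_diff_def)
  qed
  have scale: "l2_norm M (\<lambda>x. A (\<lambda>x. c * f x) x - c * A f x) = 0" if "f \<in> l2 M" for f c
  proof -
    have "sn_norm (L2 M) (A (sn_scale (L2 M) c f) - sn_scale (L2 M) c (A f)) = 0" using lin that by blast
    moreover have "sn_scale (L2 M) = (\<lambda>c f x. c * f x)" by (simp add: L2_def)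
    ultimately show ?thesis by (simp add: fun_diff_def)
  qed
  have lc: "l2_norm M (\<lambda>x. A (\<lambda>x. a * f x + b * g x) x - (a * A f x + b * A g x)) = 0"
    if f: "f \<in> l2 M" and g: "g \<in> l2 M" for f g a b
  proof -
    note af = l2_scale[OF f, of a] and bg = l2_scale[OF g, of b]
    note l = Al[OF l2_lincomb[OF f g, of a b]] Al[OF af] Al[OF bg] Al[OF f] Al[OF g]
    have 1: "l2_norm M (\<lambda>x. A (\<lambda>x. a * f x + b * g x) x - (A (\<lambda>x. a * f x) x + A (\<lambda>x. b * g x) x)) = 0"
      by (rule add[OF af bg])
    have 2: "l2_norm M (\<lambda>x. (A (\<lambda>x. a * f x) x + A (\<lambda>x. b * g x) x) - (a * A f x + b * A g x)) \<le> 0"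
    proof -
      have "(\<lambda>x. (A (\<lambda>x. a * f x) x + A (\<lambda>x. b * g x) x) - (a * A f x + b * A g x)) =
        (\<lambda>x. (A (\<lambda>x. a * f x) x - a * A f x) + (A (\<lambda>x. b * g x) x - b * A g x))"
        by (simp add: fun_eq_iff)
      then show ?thesis
        using l2_norm_triangle[OF l2_diff[OF l(2) l2_scale[OF l(4), of a]] l2_diff[OF l(3) l2_scale[OF l(5), of b]]]
          scale[OF f, of a] scale[OF g, of b] by simp
    qed
    have "l2_norm M (\<lambda>x. A (\<lambda>x. a * f x + b * g x) x - (a * A f x + b * A g x)) \<le> 0"
      using l2_dist_triangle[OF l(1) l2_add[OF l(2,3)] l2_lincomb[OF l(4,5), of a b]] 1 2 by linarith
    then show ?thesis by (simp add: order_antisym)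
  qed
  obtain C where C: "\<And>f. f \<in> l2 M \<Longrightarrow> l2_norm M (A f) \<le> C * l2_norm M f" using lin by blast
  define C' where "C' = max C 0"
  have C': "l2_norm M (A f) \<le> C' * l2_norm M f" if "f \<in> l2 M" for f
    using C[OF that] mult_right_mono[of C C' "l2_norm M f"] by (simp add: C'_def)
  have "l2_norm M (\<lambda>x. A f x - A g x) \<le> C' * l2_norm M (\<lambda>x. f x - g x)" if f: "f \<in> l2 M" and g: "g \<in> l2 M" for f g
  proof -
    have 0: "l2_norm M (\<lambda>x. (A f x - A g x) - A (\<lambda>x. f x - g x) x) = 0"
      using lc[OF f g, of 1 "-1"] l2_norm_minus_commute[of M "A (\<lambda>x. f x - g x)" "\<lambda>x. A f x - A g x"] by simp
    have "\<bar>l2_norm M (\<lambda>x. A f x - A g x) - l2_norm M (A (\<lambda>x. f x - g x))\<bar> \<le> 0"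
      using l2_norm_diff_abs[OF l2_diff[OF Al[OF f] Al[OF g]] Al[OF l2_diff[OF f g]]] 0 by simp
    then show ?thesis using C'[OF l2_diff[OF f g]] by simp
  qed
  then show thesis using that[of C'] Al lc by (simp add: C'_def)
qed

lemma summable_of_summable_powr:
  fixes a :: "nat \<Rightarrow> real"
  assumes r: "0 < r" "r \<le> 1" and a: "\<And>k. 0 \<le> a k" and sum: "summable (\<lambda>k. a k powr r)"
  shows "summable a"
proof (rule summable_comparison_test_ev[OF _ sum])
  have "\<forall>\<^sub>F k in sequentially. a k powr r < 1"
    using order_tendstoD(2)[OF summable_LIMSEQ_zero[OF sum], of 1] by simp
  then show "\<forall>\<^sub>F k in sequentially. norm (a k) \<le> a k powr r"
  proof eventually_elim
    case (elim k)
    have "a k \<le> 1"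
    proof (rule ccontr)
      assume "\<not> a k \<le> 1"
      then have "1 powr r \<le> a k powr r" using r by (intro powr_mono2) auto
      with elim show False by simp
    qed
    then have "a k powr 1 \<le> a k powr r" using r a by (intro powr_mono') auto
    then show ?case using a[of k] by simp
  qed
qed

text \<open>The series \<open>\<Sum> \<phi>\<^sub>p(f) y\<^sub>p\<close> may be indexed by an arbitrary set, as summability makes all but countably many terms
  vanish.  Since \<open>r \<le> 1\<close>, its partial sums are uniformly bounded operators, so the set of all \<open>f\<close> for
  which it converges to \<open>A f\<close> is a closed subspace, and it is enough that it contains a total
  set.\<close>

lemma r_nuclear_criterion:
  assumes r: "0 < r" "r \<le> 1" and A: "bounded_operator (L2 M) (L2 M) A"
    and dual: "\<And>p. p \<in> I \<Longrightarrow> \<phi> p \<in> sn_dual (L2 M)"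
    and b: "\<And>p. p \<in> I \<Longrightarrow> 0 \<le> b p" "\<And>p f. p \<in> I \<Longrightarrow> f \<in> l2 M \<Longrightarrow> cmod (\<phi> p f) \<le> b p * l2_norm M f"
    and y: "\<And>p. p \<in> I \<Longrightarrow> y p \<in> l2 M"
    and sum: "(\<lambda>p. (b p * l2_norm M (y p)) powr r) summable_on I"
    and total: "\<And>S. closed_l2_subspace M S \<Longrightarrow> D \<subseteq> S \<Longrightarrow> l2 M \<subseteq> S"
    and D: "\<And>f. f \<in> D \<Longrightarrow> f \<in> l2 M \<and> (\<exists>F. finite F \<and> F \<subseteq> I \<and> (\<forall>p\<in>I - F. \<phi> p f = 0) \<and>
      l2_norm M (\<lambda>x. A f x - (\<Sum>p\<in>F. \<phi> p f * y p x)) = 0)"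
  shows "r_nuclear r (L2 M) (L2 M) A"
proof -
  define t where "t p = b p * l2_norm M (y p)" for p
  have t0: "0 \<le> t p" if "p \<in> I" for p using b(1)[OF that] by (simp add: t_def)
  define J where "J = {p \<in> I. t p \<noteq> 0}"
  have "countable {p \<in> I. t p powr r \<noteq> 0}" using summable_countable_real[OF sum] by (simp add: t_def)
  then have J: "countable J" by (rule countable_subset[rotated]) (auto simp: J_def)
  define Q where "Q = to_nat_on J ` J"
  define g where "g = inv_into J (to_nat_on J)"
  have inj: "inj_on (to_nat_on J) J" by (rule inj_on_to_nat_on[OF J])
  have bij: "bij_betw g Q J" unfolding g_def Q_def by (intro bij_betw_inv_into inj_on_imp_bij_betw inj)
  have gJ: "g k \<in> J" if "k \<in> Q" for k using bij that by (auto simp: bij_betw_def)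
  have gI: "g k \<in> I" if "k \<in> Q" for k using gJ[OF that] by (simp add: J_def)
  define \<Phi> where "\<Phi> k = (if k \<in> Q then \<phi> (g k) else (\<lambda>_. 0))" for k
  define Y where "Y k = (if k \<in> Q then y (g k) else (\<lambda>_. 0))" for k
  define \<tau> where "\<tau> k = (if k \<in> Q then t (g k) else 0)" for k
  have \<tau>0: "0 \<le> \<tau> k" for k using t0 gI by (simp add: \<tau>_def)
  have Yl: "Y k \<in> l2 M" for k using y gI by (simp add: Y_def)
  have bound: "cmod (\<Phi> k f) * l2_norm M (Y k) \<le> \<tau> k * l2_norm M f" if f: "f \<in> l2 M" for k f
  proof (cases "k \<in> Q")
    case True
    have "cmod (\<phi> (g k) f) * l2_norm M (y (g k)) \<le> (b (g k) * l2_norm M f) * l2_norm M (y (g k))"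
      by (intro mult_right_mono b(2) gI True f) simp
    then show ?thesis using True by (simp add: \<Phi>_def Y_def \<tau>_def t_def mult_ac)
  qed (simp add: \<Phi>_def \<tau>_def)
  have dualk: "\<Phi> k \<in> sn_dual (L2 M)" for k
  proof (cases "k \<in> Q")
    case False
    have "(\<lambda>_. 0) \<in> sn_dual (L2 M)" by (auto simp: sn_dual_def intro: exI[of _ 0])
    then show ?thesis using False by (simp add: \<Phi>_def)
  qed (simp add: \<Phi>_def dual gI)
  have \<Phi>lin: "\<Phi> k (\<lambda>x. a * f x + c * h x) = a * \<Phi> k f + c * \<Phi> k h" if f: "f \<in> l2 M" and h: "h \<in> l2 M" for k f h a c
  proof -
    have add: "\<And>f h. f \<in> l2 M \<Longrightarrow> h \<in> l2 M \<Longrightarrow> \<Phi> k (f + h) = \<Phi> k f + \<Phi> k h"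
      and scale: "\<And>a f. f \<in> l2 M \<Longrightarrow> \<Phi> k (sn_scale (L2 M) a f) = a * \<Phi> k f"
      using dualk[of k] by (auto simp: sn_dual_def)
    have sc: "\<Phi> k (\<lambda>x. a * f x) = a * \<Phi> k f" if "f \<in> l2 M" for a f
      using scale[OF that, of a] by (simp add: L2_def)
    have "\<Phi> k ((\<lambda>x. a * f x) + (\<lambda>x. c * h x)) = \<Phi> k (\<lambda>x. a * f x) + \<Phi> k (\<lambda>x. c * h x)"
      by (intro add l2_scale f h)
    then show ?thesis by (simp add: sc f h plus_fun_def)
  qed
  have sumr: "summable (\<lambda>k. \<tau> k powr r)"
  proof -
    have "(\<lambda>p. t p powr r) summable_on J"
      by (rule summable_on_subset_banach[of _ I]) (use sum in \<open>auto simp: t_def J_def\<close>)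
    then have "(\<lambda>k. t (g k) powr r) summable_on Q"
      using summable_on_reindex_bij_betw[OF bij, of "\<lambda>p. t p powr r"] by simp
    then have "(\<lambda>k. \<tau> k powr r) summable_on UNIV"
      by (subst (asm) summable_on_cong_neutral[where T = UNIV and g = "\<lambda>k. \<tau> k powr r"]) (auto simp: \<tau>_def)
    then show ?thesis by (simp add: summable_on_UNIV_nonneg_real_iff)
  qed
  have sum\<tau>: "summable \<tau>" by (rule summable_of_summable_powr[OF r \<tau>0 sumr])
  define B where "B = suminf \<tau>"
  define S where "S N f = (\<lambda>x. \<Sum>k<N. \<Phi> k f * Y k x)" for N :: nat and f
  have Sl: "S N f \<in> l2 M" for N f unfolding S_def by (intro l2_sum l2_scale Yl)
  have Sbound: "l2_norm M (S N f) \<le> B * l2_norm M f" if f: "f \<in> l2 M" for N f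
  proof -
    have "l2_norm M (S N f) \<le> (\<Sum>k<N. l2_norm M (\<lambda>x. \<Phi> k f * Y k x))"
      unfolding S_def by (intro l2_norm_sum l2_scale Yl)
    also have "\<dots> \<le> (\<Sum>k<N. \<tau> k * l2_norm M f)"
      using bound[OF f] by (intro sum_mono) (simp add: l2_norm_scale)
    also have "\<dots> = (\<Sum>k<N. \<tau> k) * l2_norm M f" by (simp add: sum_distrib_right)
    also have "\<dots> \<le> B * l2_norm M f"
      unfolding B_def by (intro mult_right_mono sum_le_suminf sum\<tau>) (auto simp: \<tau>0)
    finally show ?thesis .
  qed
  have Slin: "S N (\<lambda>x. a * f x + c * h x) = (\<lambda>x. a * S N f x + c * S N h x)" if "f \<in> l2 M" "h \<in> l2 M" for N a f c h
    by (simp add: S_def \<Phi>lin[OF that] distrib_right sum.distrib sum_distrib_left mult.assoc)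
  obtain C where C: "0 \<le> C" and Al: "\<And>f. f \<in> l2 M \<Longrightarrow> A f \<in> l2 M"
    and Alin: "\<And>f g a b. f \<in> l2 M \<Longrightarrow> g \<in> l2 M \<Longrightarrow>
      l2_norm M (\<lambda>x. A (\<lambda>x. a * f x + b * g x) x - (a * A f x + b * A g x)) = 0"
    and Abound: "\<And>f g. f \<in> l2 M \<Longrightarrow> g \<in> l2 M \<Longrightarrow> l2_norm M (\<lambda>x. A f x - A g x) \<le> C * l2_norm M (\<lambda>x. f x - g x)"
    by (rule bounded_operator_l2D[OF A]) (rule that)
  define err where "err N f = l2_norm M (\<lambda>x. A f x - S N f x)" for N f
  define Good where "Good = {f \<in> l2 M. (\<lambda>N. err N f) \<longlonglongrightarrow> 0}"
  have "closed_l2_subspace M Good"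
    unfolding closed_l2_subspace_def l2_subspace_def
  proof (intro conjI ballI allI impI subsetI)
    show "f \<in> l2 M" if "f \<in> Good" for f using that by (simp add: Good_def)
    have lincomb: "(\<lambda>x. a * f x + c * h x) \<in> Good" if "f \<in> Good" "h \<in> Good" for f h a c
    proof -
      have f: "f \<in> l2 M" "(\<lambda>N. err N f) \<longlonglongrightarrow> 0" and h: "h \<in> l2 M" "(\<lambda>N. err N h) \<longlonglongrightarrow> 0"
        using that by (auto simp: Good_def)
      let ?u = "\<lambda>x. a * f x + c * h x"
      have u: "?u \<in> l2 M" by (intro l2_lincomb f h)
      have "err N ?u \<le> cmod a * err N f + cmod c * err N h" for N
      proof -
        let ?v = "\<lambda>x. a * A f x + c * A h x"
        have v: "?v \<in> l2 M" by (intro l2_lincomb Al f h)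
        have "err N ?u \<le> l2_norm M (\<lambda>x. A ?u x - ?v x) + l2_norm M (\<lambda>x. ?v x - S N ?u x)"
          unfolding err_def by (intro l2_dist_triangle Al u v Sl)
        also have "l2_norm M (\<lambda>x. A ?u x - ?v x) = 0" by (rule Alin[OF f(1) h(1)])
        also have "(\<lambda>x. ?v x - S N ?u x) = (\<lambda>x. a * (A f x - S N f x) + c * (A h x - S N h x))"
          by (simp add: Slin[OF f(1) h(1)] algebra_simps)
        also have "l2_norm M \<dots> \<le> l2_norm M (\<lambda>x. a * (A f x - S N f x)) + l2_norm M (\<lambda>x. c * (A h x - S N h x))"
          by (intro l2_norm_triangle l2_scale l2_diff Al f h Sl)
        finally show ?thesis by (simp add: l2_norm_scale err_def)
      qed
      moreover have "(\<lambda>N. cmod a * err N f + cmod c * err N h) \<longlonglongrightarrow> cmod a * 0 + cmod c * 0"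
        by (intro tendsto_intros f h)
      ultimately have "(\<lambda>N. err N ?u) \<longlonglongrightarrow> 0"
        by (intro Lim_null_comparison[of "\<lambda>N. err N ?u" "\<lambda>N. cmod a * err N f + cmod c * err N h"])
           (auto simp: err_def intro!: always_eventually)
      with u show ?thesis by (simp add: Good_def)
    qed
    then show "(\<lambda>x. a * f x + c * h x) \<in> Good" if "f \<in> Good" "h \<in> Good" for f h a c using that by blast
    show "(\<lambda>x. 0) \<in> Good"
    proof -
      have "S N (\<lambda>x. 0) = (\<lambda>x. 0)" for N
        using Slin[OF l2_zero l2_zero, of N 0 0] by simp
      moreover have "l2_norm M (A (\<lambda>x. 0)) = 0"
        using Alin[OF l2_zero l2_zero, of 0 0] by simp
      ultimately have "err N (\<lambda>x. 0) = 0" for N by (simp add: err_def)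
      then show ?thesis by (simp add: Good_def)
    qed
    fix w f assume w: "\<forall>n::nat. w n \<in> Good" and f: "f \<in> l2 M"
      and lim: "(\<lambda>n. l2_norm M (\<lambda>x. w n x - f x)) \<longlonglongrightarrow> 0"
    have wl: "w n \<in> l2 M" for n using w by (simp add: Good_def)
    have B0: "0 \<le> B" unfolding B_def by (intro suminf_nonneg sum\<tau> \<tau>0)
    have le: "err N f \<le> (C + B) * l2_norm M (\<lambda>x. w n x - f x) + err N (w n)" for N n
    proof -
      have Sd: "S N (\<lambda>x. w n x - f x) = (\<lambda>x. S N (w n) x - S N f x)"
        using Slin[OF wl f, of N 1 n "-1"] by simp
      have "err N f \<le> l2_norm M (\<lambda>x. A f x - A (w n) x) + l2_norm M (\<lambda>x. A (w n) x - S N f x)"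
        unfolding err_def by (intro l2_dist_triangle Al f wl Sl)
      moreover have "l2_norm M (\<lambda>x. A (w n) x - S N f x) \<le> err N (w n) + l2_norm M (\<lambda>x. S N (w n) x - S N f x)"
        unfolding err_def by (intro l2_dist_triangle Al f wl Sl)
      moreover have "l2_norm M (\<lambda>x. S N (w n) x - S N f x) \<le> B * l2_norm M (\<lambda>x. w n x - f x)"
        unfolding Sd[symmetric] by (intro Sbound l2_diff wl f)
      moreover have "l2_norm M (\<lambda>x. A f x - A (w n) x) \<le> C * l2_norm M (\<lambda>x. w n x - f x)"
        using Abound[OF f wl, of n] by (simp add: l2_norm_minus_commute[of M f])
      ultimately show ?thesis by (simp add: algebra_simps)
    qed
    have "(\<lambda>N. err N f) \<longlonglongrightarrow> 0"
    proof (rule LIMSEQ_I)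
      fix e :: real assume e: "0 < e"
      have "(\<lambda>n. (C + B) * l2_norm M (\<lambda>x. w n x - f x)) \<longlonglongrightarrow> 0"
        using tendsto_mult_left[OF lim, of "C + B"] by simp
      from order_tendstoD(2)[OF this, of "e / 2"] e
      obtain n where n: "(C + B) * l2_norm M (\<lambda>x. w n x - f x) < e / 2"
        by (auto simp: eventually_sequentially)
      have "(\<lambda>N. err N (w n)) \<longlonglongrightarrow> 0" using w by (simp add: Good_def)
      from order_tendstoD(2)[OF this, of "e / 2"] e obtain N0 where N0: "\<And>N. N0 \<le> N \<Longrightarrow> err N (w n) < e / 2"
        by (auto simp: eventually_sequentially)
      have "norm (err N f - 0) < e" if "N0 \<le> N" for N
      proof -
        have "err N f < e" using le[of N n] n N0[OF that] by linarith
        then show ?thesis by (simp add: err_def)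
      qed
      then show "\<exists>N0. \<forall>N\<ge>N0. norm (err N f - 0) < e" by blast
    qed
    with f show "f \<in> Good" by (simp add: Good_def)
  qed
  moreover have "D \<subseteq> Good"
  proof
    fix f assume "f \<in> D"
    from D[OF this] obtain F where f: "f \<in> l2 M" and F: "finite F" "F \<subseteq> I"
      and zero: "\<And>p. p \<in> I - F \<Longrightarrow> \<phi> p f = 0"
      and Af: "l2_norm M (\<lambda>x. A f x - (\<Sum>p\<in>F. \<phi> p f * y p x)) = 0" by blast
    define R where "R = to_nat_on J ` (F \<inter> J)"
    have R: "finite R" "R \<subseteq> Q" using F(1) by (auto simp: R_def Q_def)
    have gR: "bij_betw g R (F \<inter> J)"
      unfolding R_def g_def by (intro bij_betw_imageI inj_on_inv_into inv_into_image_cancel inj) auto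
    obtain N0 where N0: "R \<subseteq> {..<N0}" using finite_nat_bounded[OF R(1)] by blast
    have "err N f = 0" if N: "N0 \<le> N" for N
    proof -
      have "S N f x = (\<Sum>p\<in>F \<inter> J. \<phi> p f * y p x)" for x
      proof -
        have "S N f x = (\<Sum>k\<in>R. \<Phi> k f * Y k x)"
          unfolding S_def
        proof (rule sum.mono_neutral_right)
          show "R \<subseteq> {..<N}" using N0 N by auto
          show "\<forall>k\<in>{..<N} - R. \<Phi> k f * Y k x = 0"
          proof
            fix k assume k: "k \<in> {..<N} - R"
            show "\<Phi> k f * Y k x = 0"
            proof (cases "k \<in> Q")
              case True
              have "g k \<notin> F"
              proof
                assume "g k \<in> F"
                then have "to_nat_on J (g k) \<in> R" using gJ[OF True] by (auto simp: R_def)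
                moreover have "to_nat_on J (g k) = k"
                  using True unfolding g_def Q_def by (rule f_inv_into_f)
                ultimately show False using k by simp
              qed
              then show ?thesis using zero gI[OF True] True by (simp add: \<Phi>_def)
            qed (simp add: \<Phi>_def)
          qed
        qed simp
        also have "\<dots> = (\<Sum>k\<in>R. \<phi> (g k) f * y (g k) x)"
          using R(2) by (intro sum.cong refl) (auto simp: \<Phi>_def Y_def)
        also have "\<dots> = (\<Sum>p\<in>F \<inter> J. \<phi> p f * y p x)" by (rule sum.reindex_bij_betw[OF gR])
        finally show ?thesis .
      qed
      then have SN: "S N f = (\<lambda>x. \<Sum>p\<in>F \<inter> J. \<phi> p f * y p x)" by (simp add: fun_eq_iff)
      let ?T = "\<lambda>x. \<Sum>p\<in>F. \<phi> p f * y p x"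
      have T: "?T \<in> l2 M" using F y by (intro l2_sum l2_scale) auto
      have "(\<lambda>x. ?T x - S N f x) = (\<lambda>x. \<Sum>p\<in>F - J. \<phi> p f * y p x)"
      proof
        fix x
        show "?T x - S N f x = (\<Sum>p\<in>F - J. \<phi> p f * y p x)"
          using sum.Int_Diff[OF F(1), of "\<lambda>p. \<phi> p f * y p x" J] unfolding SN by simp
      qed
      then have "l2_norm M (\<lambda>x. ?T x - S N f x) = l2_norm M (\<lambda>x. \<Sum>p\<in>F - J. \<phi> p f * y p x)" by simp
      also have "\<dots> \<le> (\<Sum>p\<in>F - J. l2_norm M (\<lambda>x. \<phi> p f * y p x))"
        using F y by (intro l2_norm_sum l2_scale) auto
      also have "\<dots> \<le> (\<Sum>p\<in>F - J. t p * l2_norm M f)"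
      proof (rule sum_mono)
        fix p assume "p \<in> F - J"
        then have p: "p \<in> I" using F(2) by blast
        have "cmod (\<phi> p f) * l2_norm M (y p) \<le> (b p * l2_norm M f) * l2_norm M (y p)"
          by (intro mult_right_mono b(2) p f) simp
        then show "l2_norm M (\<lambda>x. \<phi> p f * y p x) \<le> t p * l2_norm M f"
          by (simp add: l2_norm_scale t_def mult_ac)
      qed
      also have "\<dots> = 0" using F(2) by (intro sum.neutral) (auto simp: J_def)
      finally have "err N f \<le> 0"
        unfolding err_def using l2_dist_triangle[OF Al[OF f] T Sl, of N f] Af by linarith
      then show ?thesis by (simp add: err_def order_antisym)
    qed
    then have "\<forall>\<^sub>F N in sequentially. err N f = 0" by (auto simp: eventually_sequentially)
    then have "(\<lambda>N. err N f) \<longlonglongrightarrow> 0" by (rule tendsto_eventually)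
    with f show "f \<in> Good" by (simp add: Good_def)
  qed
  ultimately have Good: "l2 M \<subseteq> Good" by (rule total)
  have "(\<lambda>N. l2_norm M (A f - (\<Sum>k<N. sn_scale (L2 M) (\<Phi> k f) (Y k)))) \<longlonglongrightarrow> 0" if "f \<in> l2 M" for f
  proof -
    have "A f - (\<Sum>k<N. sn_scale (L2 M) (\<Phi> k f) (Y k)) = (\<lambda>x. A f x - S N f x)" for N
    proof -
      have "(\<Sum>k<N. sn_scale (L2 M) (\<Phi> k f) (Y k)) = S N f"
        by (induction N) (simp_all add: S_def zero_fun_def plus_fun_def L2_def)
      then show ?thesis by (simp add: fun_diff_def)
    qed
    then show ?thesis using Good that by (auto simp: Good_def err_def)
  qed
  moreover have "summable (\<lambda>k. dual_norm (L2 M) (\<Phi> k) powr r * l2_norm M (Y k) powr r)"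
  proof (rule summable_comparison_test'[OF sumr])
    fix k
    have z: "(\<lambda>x. 0) \<in> {f \<in> l2 M. l2_norm M f \<le> 1}" by simp
    have "dual_norm (L2 M) (\<Phi> k) * l2_norm M (Y k) \<le> \<tau> k \<and> 0 \<le> dual_norm (L2 M) (\<Phi> k)"
    proof (cases "k \<in> Q")
      case True
      have le: "cmod (\<Phi> k f) \<le> b (g k)" if f: "f \<in> {f \<in> l2 M. l2_norm M f \<le> 1}" for f
      proof -
        have "cmod (\<Phi> k f) \<le> b (g k) * l2_norm M f" using b(2)[OF gI[OF True], of f] f True by (simp add: \<Phi>_def)
        also have "\<dots> \<le> b (g k) * 1" using f b(1)[OF gI[OF True]] by (intro mult_left_mono) auto
        finally show ?thesis by simp
      qed
      have up: "dual_norm (L2 M) (\<Phi> k) \<le> b (g k)"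
        unfolding dual_norm_def by (rule cSUP_least) (use z le in blast)+
      have "cmod (\<Phi> k (\<lambda>x. 0)) \<le> dual_norm (L2 M) (\<Phi> k)"
        unfolding dual_norm_def by (rule cSUP_upper[OF z]) (rule bdd_aboveI2[OF le])
      then have nn: "0 \<le> dual_norm (L2 M) (\<Phi> k)" using norm_ge_zero order_trans by blast
      have "dual_norm (L2 M) (\<Phi> k) * l2_norm M (Y k) \<le> b (g k) * l2_norm M (Y k)"
        by (intro mult_right_mono up) simp
      with nn True show ?thesis by (simp add: \<tau>_def t_def Y_def)
    next
      case False
      have "dual_norm (L2 M) (\<Phi> k) = (SUP f\<in>{f \<in> l2 M. l2_norm M f \<le> 1}. 0)"
        using False by (simp add: dual_norm_def \<Phi>_def)
      also have "\<dots> = 0" by (rule cSUP_const) (use z in blast)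
      finally show ?thesis using False by (simp add: \<tau>_def)
    qed
    then have "(dual_norm (L2 M) (\<Phi> k) * l2_norm M (Y k)) powr r \<le> \<tau> k powr r" and "0 \<le> dual_norm (L2 M) (\<Phi> k)"
      using r by (auto intro!: powr_mono2)
    then show "norm (dual_norm (L2 M) (\<Phi> k) powr r * l2_norm M (Y k) powr r) \<le> \<tau> k powr r"
      by (simp add: powr_mult)
  qed
  moreover have "linear_operator (L2 M) (L2 M) A" using A by (simp add: bounded_operator_def)
  ultimately show ?thesis unfolding r_nuclear_def using dualk Yl by blast
qed

section \<open>Continuous functions are dense in the square-integrable functions\<close>

lemma l2_norm_eq_0_space:
  assumes "\<And>x. x \<in> space M \<Longrightarrow> f x = 0" shows "l2_norm M f = 0"
proof -
  have "(LINT x|M. (cmod (f x))\<^sup>2) = (LINT x|M. 0)"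
    using assms by (intro Bochner_Integration.integral_cong) auto
  then show ?thesis by (simp add: l2_norm_eq)
qed

lemma l2_dominated_limit:
  assumes f: "f \<in> borel_measurable M" and s: "\<And>n::nat. s n \<in> borel_measurable M" and w: "integrable M w"
    and lim: "\<And>x. x \<in> space M \<Longrightarrow> (\<lambda>n. s n x) \<longlonglongrightarrow> f x"
    and bound: "\<And>n x. x \<in> space M \<Longrightarrow> (cmod (s n x - f x))\<^sup>2 \<le> w x"
  shows "(\<lambda>n. l2_norm M (\<lambda>x. s n x - f x)) \<longlonglongrightarrow> 0"
proof -
  have "(\<lambda>n. LINT x|M. (cmod (s n x - f x))\<^sup>2) \<longlonglongrightarrow> (LINT x|M. 0)"
  proof (rule integral_dominated_convergence[OF _ _ w])
    show "(\<lambda>x. (cmod (s n x - f x))\<^sup>2) \<in> borel_measurable M" for n using f s by simp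
    show "AE x in M. (\<lambda>n. (cmod (s n x - f x))\<^sup>2) \<longlonglongrightarrow> 0"
    proof (rule AE_I2)
      fix x assume "x \<in> space M"
      from lim[OF this] have "(\<lambda>n. (cmod (s n x - f x))\<^sup>2) \<longlonglongrightarrow> (cmod (f x - f x))\<^sup>2" by (intro tendsto_intros)
      then show "(\<lambda>n. (cmod (s n x - f x))\<^sup>2) \<longlonglongrightarrow> 0" by simp
    qed
    show "AE x in M. norm ((cmod (s n x - f x))\<^sup>2) \<le> w x" for n using bound by (intro AE_I2) simp
  qed simp
  then have "(\<lambda>n. sqrt (LINT x|M. (cmod (s n x - f x))\<^sup>2)) \<longlonglongrightarrow> sqrt 0"
    by (intro tendsto_real_sqrt) simp
  then show ?thesis by (simp add: l2_norm_eq)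
qed

context compact_haar_group
begin

text \<open>A regular second countable space is perfectly normal: an open set is the union of countably many
  closed sets, and Urysohn functions for the finite unions increase to its indicator.\<close>

lemma indicator_open_limit:
  assumes U: "openin T U"
  obtains f :: "nat \<Rightarrow> 'a \<Rightarrow> real" where "\<And>n. continuous_map T euclideanreal (f n)"
    "\<And>n x. x \<in> carrier G \<Longrightarrow> 0 \<le> f n x \<and> f n x \<le> 1"
    "\<And>x. x \<in> carrier G \<Longrightarrow> (\<lambda>n. f n x) \<longlonglongrightarrow> indicator U x"
proof -
  have reg: "regular_space T" and normal: "normal_space T"
    using compact_T Hausdorff_T
    by (simp_all add: compact_Hausdorff_imp_regular_space compact_Hausdorff_or_regular_imp_normal_space)
  obtain \<B> where B: "countable \<B>" "\<And>V. V \<in> \<B> \<Longrightarrow> openin T V"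
    "\<And>U x. openin T U \<Longrightarrow> x \<in> U \<Longrightarrow> \<exists>V\<in>\<B>. x \<in> V \<and> V \<subseteq> U"
    using second_countable_T unfolding second_countable_def by metis
  define \<C> where "\<C> = insert {} {V \<in> \<B>. T closure_of V \<subseteq> U}"
  have C: "countable \<C>" "\<C> \<noteq> {}" using B(1) by (auto simp: \<C>_def intro: countable_subset)
  define c where "c n = T closure_of (from_nat_into \<C> n)" for n
  have cU: "c n \<subseteq> U" for n using from_nat_into[OF C(2), of n] by (auto simp: c_def \<C>_def)
  define D where "D n = (\<Union>i\<le>n. c i)" for n
  have D: "closedin T (D n)" "D n \<subseteq> U" for n
    unfolding D_def using cU by (auto simp: c_def intro!: closedin_Union)
  have cover: "\<exists>m. x \<in> c m" if x: "x \<in> U" for x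
  proof -
    have "neighbourhood_base_of (closedin T) T" using reg by (simp add: neighbourhood_base_of_closedin)
    from this[unfolded neighbourhood_base_of, rule_format, of U x] U x
    obtain V Z where V: "openin T V" "closedin T Z" "x \<in> V" "V \<subseteq> Z" "Z \<subseteq> U" by blast
    obtain W where W: "W \<in> \<B>" "x \<in> W" "W \<subseteq> V" using B(3)[OF V(1,3)] by blast
    have "T closure_of W \<subseteq> Z" using W(3) V(2,4) by (intro closure_of_minimal) auto
    then have "W \<in> \<C>" using W(1) V(5) by (auto simp: \<C>_def)
    then obtain m where "from_nat_into \<C> m = W" using from_nat_into_surj[OF C(1)] by blast
    moreover have "x \<in> T closure_of W"
      using W(2) closure_of_subset[OF openin_subset[OF B(2)[OF W(1)]]] by blast
    ultimately show ?thesis by (auto simp: c_def)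
  qed
  have "\<exists>f. continuous_map T (top_of_set {0..1::real}) f \<and> f ` (topspace T - U) \<subseteq> {0} \<and> f ` D n \<subseteq> {1}" for n
  proof -
    have cl: "closedin T (topspace T - U)" using U by blast
    have disj: "disjnt (topspace T - U) (D n)" using D(2)[of n] by (auto simp: disjnt_iff)
    obtain f where "continuous_map T (top_of_set {0..1::real}) f" "f ` (topspace T - U) \<subseteq> {0}" "f ` D n \<subseteq> {1}"
      by (rule Urysohn_lemma[OF normal cl D(1) disj zero_le_one]) (rule that)
    then show ?thesis by blast
  qed
  then obtain f where f: "\<And>n. continuous_map T (top_of_set {0..1::real}) (f n)"
    "\<And>n. f n ` (topspace T - U) \<subseteq> {0}" "\<And>n. f n ` D n \<subseteq> {1}"
    by metis
  show thesis
  proof (rule that[of f])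
    show "continuous_map T euclideanreal (f n)" for n
      using f(1)[of n] by (simp add: continuous_map_in_subtopology)
    show "0 \<le> f n x \<and> f n x \<le> 1" if "x \<in> carrier G" for n x
      using f(1)[of n] that by (auto simp: continuous_map_in_subtopology topspace_T)
    fix x assume x: "x \<in> carrier G"
    show "(\<lambda>n. f n x) \<longlonglongrightarrow> indicator U x"
    proof (cases "x \<in> U")
      case True
      then obtain m where "x \<in> c m" using cover by blast
      then have "x \<in> D n" if "m \<le> n" for n using that by (auto simp: D_def)
      then have "f n x = 1" if "m \<le> n" for n using f(3)[of n] that by blast
      then have "\<forall>\<^sub>F n in sequentially. f n x = 1" by (auto simp: eventually_sequentially)
      then show ?thesis using True by (simp add: tendsto_eventually)
    next
      case False
      then have "f n x = 0" for n using f(2)[of n] x by (auto simp: topspace_T)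
      then show ?thesis using False by simp
    qed
  qed
qed

text \<open>Indicators of open sets are limits of continuous functions; Dynkin's theorem extends this to all measurable sets,
  and simple functions approximate the rest under domination.\<close>

lemma continuous_functions_total:
  assumes S: "closed_l2_subspace M S" and cS: "\<And>f. cont f \<Longrightarrow> f \<in> S"
  shows "l2 M \<subseteq> S"
proof
  note sub = closed_l2_subspace_imp_subspace[OF S] and lim = closed_l2_subspace_limit[OF S]
  have ind_l2: "(\<lambda>x. of_real (indicator B x)) \<in> l2 M" if "B \<in> sets M" for B
  proof (rule bounded_imp_l2(1)[of _ 1])
    show "(\<lambda>x. complex_of_real (indicator B x)) \<in> borel_measurable M" using that by simp
    show "cmod (of_real (indicator B x)) \<le> 1" for x by (simp add: indicator_def)
  qed
  have domlim: "f \<in> S" if f: "f \<in> borel_measurable M" and s: "\<And>n::nat. s n \<in> S"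
    and b: "\<And>n x. x \<in> carrier G \<Longrightarrow> cmod (s n x) \<le> 1" "\<And>x. x \<in> carrier G \<Longrightarrow> cmod (f x) \<le> 1"
    and l: "\<And>x. x \<in> carrier G \<Longrightarrow> (\<lambda>n. s n x) \<longlonglongrightarrow> f x" for s f
  proof (rule lim[of s f, OF s])
    show "f \<in> l2 M" using f b(2) by (intro bounded_imp_l2(1)[of f 1]) auto
    show "(\<lambda>n. l2_norm M (\<lambda>x. s n x - f x)) \<longlonglongrightarrow> 0"
    proof (rule l2_dominated_limit[OF f, where w = "\<lambda>_. 4"])
      show "s n \<in> borel_measurable M" for n by (rule l2_measurable[OF l2_subspace_l2[OF sub s]])
      show "(\<lambda>n. s n x) \<longlonglongrightarrow> f x" if "x \<in> space M" for x using l that by simp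
      fix n x assume "x \<in> space M"
      then have "cmod (s n x - f x) \<le> 2" using b(1)[of x n] b(2)[of x] norm_triangle_ineq4[of "s n x" "f x"] by simp
      then have "(cmod (s n x - f x))\<^sup>2 \<le> 2\<^sup>2" by (intro power_mono) auto
      then show "(cmod (s n x - f x))\<^sup>2 \<le> 4" by simp
    qed simp
  qed
  have ind: "(\<lambda>x. of_real (indicator B x)) \<in> S" if "B \<in> sets M" for B
  proof -
    have stable: "Int_stable {U. openin T U}" by (auto simp: Int_stable_def)
    have pow: "{U. openin T U} \<subseteq> Pow (topspace T)" using openin_subset by auto
    have "B \<in> sigma_sets (topspace T) {U. openin T U}" using that by (simp add: sets_M)
    with stable pow show ?thesis
    proof (induction rule: sigma_sets_induct_disjoint)
      case (basic U)
      then have U: "openin T U" by simp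
      obtain f where f: "\<And>n. continuous_map T euclideanreal (f n)"
        "\<And>n x. x \<in> carrier G \<Longrightarrow> 0 \<le> f n x \<and> f n x \<le> 1"
        "\<And>x. x \<in> carrier G \<Longrightarrow> (\<lambda>n. f n x) \<longlonglongrightarrow> indicator U x"
        by (rule indicator_open_limit[OF U]) (rule that)
      show ?case
      proof (rule domlim[of _ "\<lambda>n x. of_real (f n x)"])
        show "(\<lambda>x. of_real (f n x)) \<in> S" for n by (intro cS cont_of_real f)
        show "(\<lambda>x. complex_of_real (indicator U x)) \<in> borel_measurable M"
          by (rule l2_measurable[OF ind_l2[OF open_sets_M[OF U]]])
        show "cmod (of_real (f n x)) \<le> 1" if "x \<in> carrier G" for n x using f(2)[OF that] by simp
        show "cmod (of_real (indicator U x)) \<le> 1" for x by (simp add: indicator_def)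
        show "(\<lambda>n. complex_of_real (f n x)) \<longlonglongrightarrow> of_real (indicator U x)" if "x \<in> carrier G" for x
          by (intro tendsto_of_real f that)
      qed
    next
      case empty
      show ?case using sub by (simp add: l2_subspace_def)
    next
      case (compl B)
      then have B: "B \<in> sets M" by (simp add: sets_M)
      have "(\<lambda>x. 1) \<in> S" by (intro cS) simp
      then have d: "(\<lambda>x. 1 - of_real (indicator B x)) \<in> S" using compl by (intro l2_subspace_diff[OF sub])
      show ?case
      proof (rule closed_l2_subspace_null[OF S d])
        have "topspace T - B \<in> sets M" using B by (simp add: topspace_T flip: space_M)
        then show "(\<lambda>x. of_real (indicator (topspace T - B) x)) \<in> l2 M" by (rule ind_l2)
        have "1 - complex_of_real (indicator B x) - of_real (indicator (topspace T - B) x) = 0" if "x \<in> carrier G" for x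
          using that by (simp add: indicator_def topspace_T)
        then show "l2_norm M (\<lambda>x. 1 - of_real (indicator B x) - of_real (indicator (topspace T - B) x)) = 0"
          by (intro l2_norm_eq_0_space) simp
      qed
    next
      case (union B)
      have B: "B i \<in> sets M" for i using union(2) by (auto simp: sets_M)
      have partial: "(\<Sum>i<n. indicator (B i) x) = (indicator (\<Union>i<n. B i) x :: real)" for n x
        by (rule indicator_UN_disjoint[symmetric]) (use union(1) in \<open>auto simp: disjoint_family_on_def\<close>)
      show ?case
      proof (rule domlim[of _ "\<lambda>n x. \<Sum>i<n. of_real (indicator (B i) x)"])
        show "(\<lambda>x. \<Sum>i<n. of_real (indicator (B i) x)) \<in> S" for n
          by (intro l2_subspace_sum[OF sub] union(3))
        have "(\<Union>i. B i) \<in> sets M" using B by blast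
        then show "(\<lambda>x. complex_of_real (indicator (\<Union>i. B i) x)) \<in> borel_measurable M"
          by (rule l2_measurable[OF ind_l2])
        have eq: "(\<Sum>i<n. complex_of_real (indicator (B i) x)) = of_real (indicator (\<Union>i<n. B i) x)" for n x
          unfolding partial[symmetric] by simp
        show "cmod (\<Sum>i<n. of_real (indicator (B i) x)) \<le> 1" for n x
          unfolding eq by (simp add: indicator_def)
        show "cmod (of_real (indicator (\<Union>i. B i) x)) \<le> 1" for x by (simp add: indicator_def)
        show "(\<lambda>n. \<Sum>i<n. complex_of_real (indicator (B i) x)) \<longlonglongrightarrow> of_real (indicator (\<Union>i. B i) x)" for x
          unfolding eq by (intro tendsto_of_real LIMSEQ_indicator_UN)
      qed
    qed
  qed
  fix f assume f: "f \<in> l2 M"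
  obtain s where s: "\<And>i::nat. simple_function M (s i)" "\<And>x. x \<in> space M \<Longrightarrow> (\<lambda>i. s i x) \<longlonglongrightarrow> f x"
    "\<And>i x. x \<in> space M \<Longrightarrow> dist (s i x) 0 \<le> 2 * dist (f x) 0"
    using borel_measurable_implies_sequence_metric[OF l2_measurable[OF f], of 0] by blast
  have bnd: "cmod (s i x) \<le> 2 * cmod (f x)" if "x \<in> space M" for i x using s(3)[OF that] by simp
  have int9: "integrable M (\<lambda>x. 9 * (cmod (f x))\<^sup>2)" using f by (simp add: l2_iff)
  have sS: "s i \<in> S" for i
  proof -
    let ?V = "s i ` space M"
    have fin: "finite ?V" by (rule simple_functionD(1)[OF s(1)])
    have level: "s i -` {v} \<inter> space M \<in> sets M" for v by (rule simple_functionD(2)[OF s(1)])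
    have sumS: "(\<lambda>x. \<Sum>v\<in>?V. v * of_real (indicator (s i -` {v} \<inter> space M) x)) \<in> S"
      by (intro l2_subspace_sum[OF sub] l2_subspace_scale[OF sub] ind level)
    have "(\<Sum>v\<in>?V. v * of_real (indicator (s i -` {v} \<inter> space M) x)) - s i x = 0" if "x \<in> space M" for x
    proof -
      have "(\<Sum>v\<in>?V. v * of_real (indicator (s i -` {v} \<inter> space M) x)) = (\<Sum>v\<in>?V. if v = s i x then v else 0)"
        using that by (intro sum.cong refl) (auto simp: indicator_def)
      also have "\<dots> = s i x" using fin that by simp
      finally show ?thesis by simp
    qed
    then have null: "l2_norm M (\<lambda>x. (\<Sum>v\<in>?V. v * of_real (indicator (s i -` {v} \<inter> space M) x)) - s i x) = 0"
      by (intro l2_norm_eq_0_space) simp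
    have "s i \<in> l2 M"
    proof -
      obtain K where K: "\<forall>v\<in>?V. cmod v \<le> K" using finite_imp_bounded[OF fin] unfolding bounded_iff by (rule exE)
      show ?thesis
      proof (rule bounded_imp_l2(1)[of _ K])
        show "s i \<in> borel_measurable M" by (rule borel_measurable_simple_function[OF s(1)])
        show "cmod (s i x) \<le> K" if "x \<in> space M" for x by (rule bspec[OF K imageI[OF that]])
      qed
    qed
    then show ?thesis by (rule closed_l2_subspace_null[OF S sumS _ null])
  qed
  show "f \<in> S"
  proof (rule lim[of s f, OF sS f])
    show "(\<lambda>n. l2_norm M (\<lambda>x. s n x - f x)) \<longlonglongrightarrow> 0"
    proof (rule l2_dominated_limit[OF l2_measurable[OF f] _ int9 s(2)])
      show "s n \<in> borel_measurable M" for n by (rule borel_measurable_simple_function[OF s(1)])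
      fix n x assume x: "x \<in> space M"
      have "cmod (s n x - f x) \<le> 3 * cmod (f x)" using bnd[OF x, of n] norm_triangle_ineq4[of "s n x" "f x"] by simp
      then have "(cmod (s n x - f x))\<^sup>2 \<le> (3 * cmod (f x))\<^sup>2" by (intro power_mono) auto
      then show "(cmod (s n x - f x))\<^sup>2 \<le> 9 * (cmod (f x))\<^sup>2" by (simp add: power_mult_distrib)
    qed
  qed
qed

end

section \<open>The unitary dual and nuclear expansions\<close>

lemma mat_adjoint_adjoint:
  fixes A :: "complex mat"
  assumes A: "A \<in> carrier_mat m n"
  shows "mat_adjoint (mat_adjoint A) = A"
proof (rule eq_matI)
  fix i j assume "i < dim_row A" "j < dim_col A"
  then have "i < m" "j < n" using A by auto
  then show "mat_adjoint (mat_adjoint A) $$ (i, j) = A $$ (i, j)"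
    using mat_adjoint_index[OF mat_adjoint_carrier[OF A], of i j] mat_adjoint_index[OF A, of j i] by simp
qed simp_all

context compact_haar_group
begin

lemma rep_equiv_sym:
  assumes \<xi>: "\<xi> \<in> unitary_irreps G T" and \<eta>: "\<eta> \<in> unitary_irreps G T" and eq: "rep_equiv G \<xi> \<eta>"
  shows "rep_equiv G \<eta> \<xi>"
proof -
  let ?d = "rep_dim G \<xi>"
  obtain U where d: "?d = rep_dim G \<eta>" and U: "unitary_mat ?d U"
    and comm: "\<And>x. x \<in> carrier G \<Longrightarrow> U * \<xi> x = \<eta> x * U"
    using eq unfolding rep_equiv_def by blast
  note Uc = unitary_mat_carrier[OF U]
  note Ua = mat_adjoint_carrier[OF Uc]
  have "unitary_mat ?d (mat_adjoint U)"
    using unitary_mat_right[OF U] Ua by (simp add: unitary_mat_def mat_adjoint_adjoint[OF Uc])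
  moreover have "mat_adjoint U * \<eta> x = \<xi> x * mat_adjoint U" if x: "x \<in> carrier G" for x
  proof -
    note X = irrep_carrier[OF \<xi> x] and Y = irrep_carrier[OF \<eta> x, folded d]
    have "mat_adjoint U * \<eta> x = mat_adjoint U * (\<eta> x * (U * mat_adjoint U))"
      by (simp add: unitary_mat_right[OF U] right_mult_one_mat[OF Y])
    also have "\<dots> = mat_adjoint U * ((U * \<xi> x) * mat_adjoint U)"
      by (simp add: comm[OF x] assoc_mult_mat[OF Y Uc Ua])
    also have "\<dots> = (mat_adjoint U * U) * (\<xi> x * mat_adjoint U)"
      by (simp add: assoc_mult_mat[OF Uc X Ua] assoc_mult_mat[OF Ua Uc mult_carrier_mat[OF X Ua]])
    also have "\<dots> = \<xi> x * mat_adjoint U"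
      using U by (simp add: unitary_mat_def left_mult_one_mat[OF mult_carrier_mat[OF X Ua]])
    finally show ?thesis .
  qed
  ultimately show ?thesis using d by (auto simp: rep_equiv_def)
qed

lemma rep_equiv_trans:
  assumes \<xi>: "\<xi> \<in> unitary_irreps G T" and \<eta>: "\<eta> \<in> unitary_irreps G T" and \<zeta>: "\<zeta> \<in> unitary_irreps G T"
    and eq: "rep_equiv G \<xi> \<eta>" "rep_equiv G \<eta> \<zeta>"
  shows "rep_equiv G \<xi> \<zeta>"
proof -
  let ?d = "rep_dim G \<xi>"
  obtain U where d: "?d = rep_dim G \<eta>" and U: "unitary_mat ?d U"
    and commU: "\<And>x. x \<in> carrier G \<Longrightarrow> U * \<xi> x = \<eta> x * U"
    using eq(1) unfolding rep_equiv_def by blast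
  obtain V where d': "?d = rep_dim G \<zeta>" and V: "unitary_mat ?d V"
    and commV: "\<And>x. x \<in> carrier G \<Longrightarrow> V * \<eta> x = \<zeta> x * V"
    using eq(2) d unfolding rep_equiv_def by auto
  note Uc = unitary_mat_carrier[OF U] and Vc = unitary_mat_carrier[OF V]
  note Ua = mat_adjoint_carrier[OF Uc] and Va = mat_adjoint_carrier[OF Vc]
  have "mat_adjoint (V * U) * (V * U) = mat_adjoint U * ((mat_adjoint V * V) * U)"
    by (simp add: mat_adjoint_mult[OF Vc Uc] assoc_mult_mat[OF Ua Va mult_carrier_mat[OF Vc Uc]] assoc_mult_mat[OF Va Vc Uc])
  also have "\<dots> = 1\<^sub>m ?d" using U V by (simp add: unitary_mat_def left_mult_one_mat[OF Uc])
  finally have "unitary_mat ?d (V * U)" using mult_carrier_mat[OF Vc Uc] by (simp add: unitary_mat_def)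
  moreover have "(V * U) * \<xi> x = \<zeta> x * (V * U)" if x: "x \<in> carrier G" for x
  proof -
    note X = irrep_carrier[OF \<xi> x] and Y = irrep_carrier[OF \<eta> x, folded d] and Z = irrep_carrier[OF \<zeta> x, folded d']
    have "(V * U) * \<xi> x = V * (\<eta> x * U)" by (simp add: assoc_mult_mat[OF Vc Uc X] commU[OF x])
    also have "\<dots> = (\<zeta> x * V) * U" by (simp add: assoc_mult_mat[OF Vc Y Uc, symmetric] commV[OF x])
    also have "\<dots> = \<zeta> x * (V * U)" by (rule assoc_mult_mat[OF Z Vc Uc])
    finally show ?thesis .
  qed
  ultimately show ?thesis using d' by (auto simp: rep_equiv_def)
qed

lemma rep_equiv_refl:
  assumes \<xi>: "\<xi> \<in> unitary_irreps G T" shows "rep_equiv G \<xi> \<xi>"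
proof -
  have "mat_adjoint (1\<^sub>m d) = (1\<^sub>m d :: complex mat)" for d
    by (rule eq_matI) (auto simp: mat_adjoint_index[of _ d d])
  then have "unitary_mat (rep_dim G \<xi>) (1\<^sub>m (rep_dim G \<xi>))" by (simp add: unitary_mat_def)
  moreover have "1\<^sub>m (rep_dim G \<xi>) * \<xi> x = \<xi> x * 1\<^sub>m (rep_dim G \<xi>)" if "x \<in> carrier G" for x
    by (simp add: left_mult_one_mat[OF irrep_carrier[OF \<xi> that]] right_mult_one_mat[OF irrep_carrier[OF \<xi> that]])
  ultimately show ?thesis unfolding rep_equiv_def by blast
qed

abbreviation equiv_rel :: "(('a \<Rightarrow> complex mat) \<times> ('a \<Rightarrow> complex mat)) set" where
  "equiv_rel \<equiv> {(\<xi>, \<eta>) \<in> unitary_irreps G T \<times> unitary_irreps G T. rep_equiv G \<xi> \<eta>}"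

lemma equiv_equiv_rel: "equiv (unitary_irreps G T) equiv_rel"
proof (rule equivI)
  show "equiv_rel \<subseteq> unitary_irreps G T \<times> unitary_irreps G T" by blast
  show "refl_on (unitary_irreps G T) equiv_rel" by (auto simp: refl_on_def intro: rep_equiv_refl)
  show "sym equiv_rel" by (auto intro!: symI intro: rep_equiv_sym)
  show "trans equiv_rel" by (auto intro!: transI intro: rep_equiv_trans)
qed

lemma unitary_dual_irreps: "c \<in> unitary_dual G T \<Longrightarrow> \<xi> \<in> c \<Longrightarrow> \<xi> \<in> unitary_irreps G T"
  unfolding unitary_dual_def by (rule subsetD[OF in_quotient_imp_subset[OF equiv_equiv_rel]])

lemma unitary_dual_inequiv:
  assumes c: "c \<in> unitary_dual G T" "\<xi> \<in> c" and c': "c' \<in> unitary_dual G T" "\<eta> \<in> c'" and ne: "c \<noteq> c'"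
  shows "\<not> rep_equiv G \<xi> \<eta>"
proof
  assume "rep_equiv G \<xi> \<eta>"
  then have "(\<xi>, \<eta>) \<in> equiv_rel"
    using unitary_dual_irreps[OF c] unitary_dual_irreps[OF c'] by simp
  moreover have "c = c' \<longleftrightarrow> (\<xi>, \<eta>) \<in> equiv_rel"
    by (rule quotient_eq_iff[OF equiv_equiv_rel c(1)[unfolded unitary_dual_def] c'(1)[unfolded unitary_dual_def] c(2) c'(2)])
  ultimately show False using ne by simp
qed

lemma unitary_dual_exhausts:
  assumes \<xi>: "\<xi> \<in> unitary_irreps G T" and rep: "\<And>c. c \<in> unitary_dual G T \<Longrightarrow> rep c \<in> c"
  shows "\<exists>c\<in>unitary_dual G T. rep_equiv G \<xi> (rep c)"
proof -
  let ?c = "equiv_rel `` {\<xi>}"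
  have c: "?c \<in> unitary_dual G T" unfolding unitary_dual_def by (rule quotientI[OF \<xi>])
  then have "rep ?c \<in> ?c" by (rule rep)
  then have "rep_equiv G \<xi> (rep ?c)" by blast
  with c show ?thesis by (rule bexI[rotated])
qed

text \<open>By the Peter--Weyl theorem; coefficients of equivalent representations span the same space.\<close>

lemma coefficients_total:
  assumes rep: "\<And>c. c \<in> unitary_dual G T \<Longrightarrow> rep c \<in> c"
    and S: "closed_l2_subspace M S"
    and coeff: "\<And>c i j. c \<in> unitary_dual G T \<Longrightarrow> i < rep_dim G (rep c) \<Longrightarrow> j < rep_dim G (rep c) \<Longrightarrow>
      (\<lambda>x. rep c x $$ (i, j)) \<in> S"
  shows "l2 M \<subseteq> S"
proof (rule continuous_functions_total[OF S])
  note sub = closed_l2_subspace_imp_subspace[OF S]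
  have irrep_coeff: "(\<lambda>x. \<xi> x $$ (i, j)) \<in> S"
    if \<xi>: "\<xi> \<in> unitary_irreps G T" and ij: "i < rep_dim G \<xi>" "j < rep_dim G \<xi>" for \<xi> i j
  proof -
    let ?d = "rep_dim G \<xi>"
    have "\<exists>c\<in>unitary_dual G T. rep_equiv G \<xi> (rep c)" by (rule unitary_dual_exhausts[OF \<xi> rep])
    then obtain c where c: "c \<in> unitary_dual G T" "rep_equiv G \<xi> (rep c)" by blast
    obtain U where d: "?d = rep_dim G (rep c)" and U: "unitary_mat ?d U"
      and comm: "\<And>x. x \<in> carrier G \<Longrightarrow> U * \<xi> x = rep c x * U"
      using c(2) unfolding rep_equiv_def by blast
    note Uc = unitary_mat_carrier[OF U]
    note Ua = mat_adjoint_carrier[OF Uc]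
    have \<eta>: "rep c \<in> unitary_irreps G T" by (rule unitary_dual_irreps[OF c(1) rep[OF c(1)]])
    let ?h = "\<lambda>x. \<Sum>a<?d. cnj (U $$ (a, i)) * (\<Sum>b<?d. U $$ (b, j) * rep c x $$ (a, b))"
    have h: "?h \<in> S"
      using coeff[OF c(1)] by (intro l2_subspace_sum[OF sub] l2_subspace_scale[OF sub]) (simp add: d)
    have eq: "?h x - \<xi> x $$ (i, j) = 0" if "x \<in> space M" for x
    proof -
      have x: "x \<in> carrier G" using that by simp
      note X = irrep_carrier[OF \<xi> x] and Y = irrep_carrier[OF \<eta> x, folded d]
      have "\<xi> x = (mat_adjoint U * U) * \<xi> x" using U by (simp add: unitary_mat_def left_mult_one_mat[OF X])
      also have "\<dots> = mat_adjoint U * (rep c x * U)" by (simp add: assoc_mult_mat[OF Ua Uc X] comm[OF x])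
      finally have "\<xi> x $$ (i, j) = (mat_adjoint U * (rep c x * U)) $$ (i, j)" by simp
      also have "\<dots> = ?h x"
        unfolding mat_mult_index[OF Ua mult_carrier_mat[OF Y Uc] ij]
        using ij by (intro sum.cong refl) (simp add: mat_adjoint_index[OF Uc] mat_mult_index[OF Y Uc] mult.commute)
      finally show ?thesis by simp
    qed
    show ?thesis
      by (rule closed_l2_subspace_null[OF S h cont_l2[OF irrep_cont[OF \<xi> ij]] l2_norm_eq_0_space[OF eq]])
  qed
  have span: "f \<in> S" if "f \<in> coeff_span" for f
    using that
  proof (induction rule: coeff_span.induct)
    case zero
    then show ?case using sub by (simp add: l2_subspace_def)
  next
    case (step f \<xi> i j c)
    show ?case
      using l2_subspace_lincomb[OF sub step.IH irrep_coeff[OF step.hyps(2-4)], of 1 c] by simp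
  next
    case (agree f g)
    have g: "g \<in> l2 M" by (rule cont_l2[OF cont_cong[OF coeff_span_cont[OF agree.hyps(1)] agree.hyps(2)]])
    show ?case
      by (rule closed_l2_subspace_null[OF S agree.IH g l2_norm_eq_0_space]) (simp add: agree.hyps(2))
  qed
  fix f assume f: "cont f"
  have "\<exists>h\<in>coeff_span. l2_norm M (\<lambda>x. f x - h x) < 1 / Suc n" for n :: nat
  proof -
    obtain h where "h \<in> coeff_span" "l2_norm M (\<lambda>x. f x - h x) < 1 / Suc n"
      by (rule Peter_Weyl_density[OF f, of "1 / Suc n"]) (simp, rule that)
    then show ?thesis by blast
  qed
  then obtain h where h: "\<And>n::nat. h n \<in> coeff_span" "\<And>n. l2_norm M (\<lambda>x. f x - h n x) < 1 / Suc n"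
    by metis
  show "f \<in> S"
  proof (rule closed_l2_subspace_limit[OF S span[OF h(1)] cont_l2[OF f]])
    show "(\<lambda>n. l2_norm M (\<lambda>x. h n x - f x)) \<longlonglongrightarrow> 0"
    proof (rule Lim_null_comparison[OF _ LIMSEQ_inverse_real_of_nat])
      show "\<forall>\<^sub>F n in sequentially. norm (l2_norm M (\<lambda>x. h n x - f x)) \<le> inverse (real (Suc n))"
        using h(2) by (intro always_eventually allI)
          (simp add: l2_norm_minus_commute[of M _ f] inverse_eq_divide less_imp_le)
    qed
  qed
qed

text \<open>The definition \<open>\<sigma> = \<xi>\<^sup>* (A \<xi>)\<close> is solved for \<open>A \<xi> = \<xi> \<sigma>\<close> by unitarity of \<open>\<xi> x\<close>. The size of
  \<open>s\<close> is that of the symbol at any one point where the two agree.\<close>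

lemma symbol_determines:
  assumes A: "\<And>f. f \<in> l2 M \<Longrightarrow> A f \<in> l2 M" and \<xi>: "\<xi> \<in> unitary_irreps G T"
    and sym: "AE x in M. symbol G A x \<xi> = s"
  shows "s \<in> carrier_mat (rep_dim G \<xi>) (rep_dim G \<xi>)"
    and "a < rep_dim G \<xi> \<Longrightarrow> b < rep_dim G \<xi> \<Longrightarrow>
      l2_norm M (\<lambda>x. A (\<lambda>y. \<xi> y $$ (a, b)) x - (\<Sum>k<rep_dim G \<xi>. \<xi> x $$ (a, k) * s $$ (k, b))) = 0"
proof -
  let ?d = "rep_dim G \<xi>"
  define N where "N x = Matrix.mat ?d ?d (\<lambda>(i, j). A (\<lambda>y. \<xi> y $$ (i, j)) x)" for x
  have Nc: "N x \<in> carrier_mat ?d ?d" for x by (simp add: N_def)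
  have symN: "symbol G A x \<xi> = mat_adjoint (\<xi> x) * N x" for x by (simp add: symbol_def N_def)
  have "\<exists>x\<in>carrier G. symbol G A x \<xi> = s"
  proof (rule ccontr)
    assume neg: "\<not> ?thesis"
    have "AE x in M. \<not> True"
      by (rule AE_mp[OF sym AE_I2]) (use neg in auto)
    from emeasure_eq_0_AE[OF this] show False by (simp add: emeasure_total)
  qed
  then obtain x where "x \<in> carrier G" "symbol G A x \<xi> = s" by blast
  then show s: "s \<in> carrier_mat ?d ?d"
    using mult_carrier_mat[OF mat_adjoint_carrier[OF irrep_carrier[OF \<xi>]] Nc] symN by metis
  assume ab: "a < ?d" "b < ?d"
  let ?h = "\<lambda>x. \<Sum>k<?d. \<xi> x $$ (a, k) * s $$ (k, b)"
  have h: "?h \<in> l2 M"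
  proof (rule l2_sum)
    fix k assume "k \<in> {..<?d}"
    then have "(\<lambda>x. s $$ (k, b) * \<xi> x $$ (a, k)) \<in> l2 M"
      using ab by (intro l2_scale cont_l2 irrep_cont[OF \<xi>]) auto
    then show "(\<lambda>x. \<xi> x $$ (a, k) * s $$ (k, b)) \<in> l2 M" by (simp add: mult.commute)
  qed
  have Al: "A (\<lambda>y. \<xi> y $$ (a, b)) \<in> l2 M" by (intro A cont_l2 irrep_cont[OF \<xi> ab])
  from AE_space sym have "AE x in M. A (\<lambda>y. \<xi> y $$ (a, b)) x - ?h x = 0"
  proof eventually_elim
    case (elim x)
    then have x: "x \<in> carrier G" by simp
    note X = irrep_carrier[OF \<xi> x]
    note Xa = mat_adjoint_carrier[OF X]
    have "N x = (\<xi> x * mat_adjoint (\<xi> x)) * N x"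
      by (simp add: unitary_mat_right[OF irrep_unitary[OF \<xi> x]] left_mult_one_mat[OF Nc])
    also have "\<dots> = \<xi> x * s" using elim(2) by (simp add: assoc_mult_mat[OF X Xa Nc] symN)
    finally have "N x $$ (a, b) = (\<xi> x * s) $$ (a, b)" by simp
    then show ?case using ab by (simp add: N_def mat_mult_index[OF X s ab])
  qed
  then show "l2_norm M (\<lambda>x. A (\<lambda>y. \<xi> y $$ (a, b)) x - ?h x) = 0"
    using l2_norm_eq_0_iff[OF l2_diff[OF Al h]] by simp
qed

lemma row_l2:
  assumes "\<xi> \<in> unitary_irreps G T" "i < rep_dim G \<xi>"
  shows "(\<lambda>x. \<Sum>k<rep_dim G \<xi>. v k * \<xi> x $$ (i, k)) \<in> l2 M"
  using assms by (intro l2_sum l2_scale cont_l2 irrep_cont) auto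

text \<open>For vectors \<open>v\<close> and \<open>w\<close> these are the entries of \<open>\<xi> v\<close> and \<open>\<xi> w\<close>; the sums are expanded and
  Schur orthogonality is applied to each pair of matrix coefficients.\<close>

lemma row_inner:
  assumes \<xi>: "\<xi> \<in> unitary_irreps G T" and i: "i < rep_dim G \<xi>" and j: "j < rep_dim G \<xi>"
  shows "l2_inner M (\<lambda>x. \<Sum>k<rep_dim G \<xi>. v k * \<xi> x $$ (i, k)) (\<lambda>x. \<Sum>k<rep_dim G \<xi>. w k * \<xi> x $$ (j, k)) =
    (if i = j then (\<Sum>k<rep_dim G \<xi>. v k * cnj (w k)) / of_nat (rep_dim G \<xi>) else 0)"
proof -
  let ?d = "rep_dim G \<xi>"
  have l: "(\<lambda>x. \<xi> x $$ (m, k)) \<in> l2 M" if "m < ?d" "k < ?d" for m k by (rule cont_l2[OF irrep_cont[OF \<xi> that]])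
  have "l2_inner M (\<lambda>x. \<Sum>k<?d. v k * \<xi> x $$ (i, k)) (\<lambda>x. \<Sum>k<?d. w k * \<xi> x $$ (j, k)) =
    (\<Sum>k<?d. l2_inner M (\<lambda>x. v k * \<xi> x $$ (i, k)) (\<lambda>x. \<Sum>k<?d. w k * \<xi> x $$ (j, k)))"
    using i by (intro l2_inner_sum_left l2_scale l row_l2[OF \<xi> j]) auto
  also have "\<dots> = (\<Sum>k<?d. \<Sum>m<?d. l2_inner M (\<lambda>x. v k * \<xi> x $$ (i, k)) (\<lambda>x. w m * \<xi> x $$ (j, m)))"
    using i j by (intro sum.cong refl l2_inner_sum_right l2_scale l) auto
  also have "\<dots> = (\<Sum>k<?d. \<Sum>m<?d. if k = m then (if i = j then v k * cnj (w k) / of_nat ?d else 0) else 0)"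
    using i j by (intro sum.cong refl) (auto simp: Schur_orthogonality[OF \<xi>])
  also have "\<dots> = (\<Sum>k<?d. if i = j then v k * cnj (w k) / of_nat ?d else 0)"
    by (intro sum.cong refl) simp
  finally show ?thesis by (simp add: sum_divide_distrib)
qed

lemma row_norm:
  assumes \<xi>: "\<xi> \<in> unitary_irreps G T" and i: "i < rep_dim G \<xi>"
  shows "l2_norm M (\<lambda>x. \<Sum>k<rep_dim G \<xi>. v k * \<xi> x $$ (i, k)) =
    sqrt ((\<Sum>k<rep_dim G \<xi>. (cmod (v k))\<^sup>2) / real (rep_dim G \<xi>))"
proof -
  have "complex_of_real ((l2_norm M (\<lambda>x. \<Sum>k<rep_dim G \<xi>. v k * \<xi> x $$ (i, k)))\<^sup>2) =
      (\<Sum>k<rep_dim G \<xi>. v k * cnj (v k)) / of_nat (rep_dim G \<xi>)"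
    unfolding l2_inner_self[symmetric] using row_inner[OF \<xi> i i] by simp
  also have "\<dots> = complex_of_real ((\<Sum>k<rep_dim G \<xi>. (cmod (v k))\<^sup>2) / real (rep_dim G \<xi>))"
    unfolding of_real_divide of_real_sum complex_norm_square by simp
  finally have "(l2_norm M (\<lambda>x. \<Sum>k<rep_dim G \<xi>. v k * \<xi> x $$ (i, k)))\<^sup>2 =
      (\<Sum>k<rep_dim G \<xi>. (cmod (v k))\<^sup>2) / real (rep_dim G \<xi>)"
    by (simp only: of_real_eq_iff)
  then show ?thesis by (rule real_sqrt_unique[OF _ l2_norm_nonneg, symmetric])
qed

lemma inner_in_sn_dual:
  assumes \<psi>: "\<psi> \<in> l2 M"
  shows "(\<lambda>f. a * l2_inner M f \<psi>) \<in> sn_dual (L2 M)"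
proof -
  have "a * l2_inner M (f + g) \<psi> = a * l2_inner M f \<psi> + a * l2_inner M g \<psi>" if "f \<in> l2 M" "g \<in> l2 M" for f g
    using l2_inner_add_left[OF that \<psi>] by (simp add: plus_fun_def distrib_left)
  moreover have "a * l2_inner M (sn_scale (L2 M) c f) \<psi> = c * (a * l2_inner M f \<psi>)" for c f
    by (simp add: L2_def)
  moreover have "cmod (a * l2_inner M f \<psi>) \<le> (cmod a * l2_norm M \<psi>) * l2_norm M f" if "f \<in> l2 M" for f
    using mult_left_mono[OF l2_Cauchy_Schwarz[OF that \<psi>] norm_ge_zero[of a]] by (simp add: norm_mult mult_ac)
  ultimately show ?thesis unfolding sn_dual_def by blast
qed

text \<open>In the proof \<open>V c\<close> has the eigenvectors \<open>v\<^sub>j\<close> as columns, \<open>\<psi> (c, i, j)\<close> and \<open>y (c, i, j)\<close> are the \<open>i\<close>-th entries of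
  \<open>\<xi> v\<^sub>j\<close> and \<open>\<xi> \<sigma> v\<^sub>j\<close>, and \<open>S c j\<close> is the square of the singular value \<open>s\<^sub>j\<close>.\<close>

theorem r_nuclear_of_summable_symbol:
  assumes rep: "\<And>c. c \<in> unitary_dual G T \<Longrightarrow> rep c \<in> c"
    and r: "0 < r" "r \<le> 1" and A: "bounded_operator (L2 M) (L2 M) A"
    and sym: "\<And>c. c \<in> unitary_dual G T \<Longrightarrow> AE x in M. symbol G A x (rep c) = \<sigma> c"
    and sum: "(\<lambda>c. real (rep_dim G (rep c)) * schatten_norm r (\<sigma> c) powr r) summable_on unitary_dual G T"
  shows "r_nuclear r (L2 M) (L2 M) A"
proof -
  let ?D = "unitary_dual G T" and ?d = "\<lambda>c. rep_dim G (rep c)"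
  have irr: "rep c \<in> unitary_irreps G T" if "c \<in> ?D" for c by (rule unitary_dual_irreps[OF that rep[OF that]])
  have Al: "A f \<in> l2 M" if "f \<in> l2 M" for f using A that by (simp add: bounded_operator_def linear_operator_def)
  have \<sigma>c: "\<sigma> c \<in> carrier_mat (?d c) (?d c)" if "c \<in> ?D" for c
    by (rule symbol_determines(1)[OF Al irr[OF that] sym[OF that]])
  define s where "s V c j = (\<Sum>k<?d c. (cmod ((\<sigma> c * V) $$ (k, j)))\<^sup>2)" for V c j
  have "\<forall>c\<in>?D. \<exists>V. unitary_mat (?d c) V \<and> mat_adjoint (\<sigma> c) * \<sigma> c =
      V * mat_diag (?d c) (\<lambda>j. complex_of_real (s V c j)) * mat_adjoint V"
  proof
    fix c assume c: "c \<in> ?D"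
    obtain V where "unitary_mat (?d c) V" "mat_adjoint (\<sigma> c) * \<sigma> c =
      V * mat_diag (?d c) (\<lambda>j. complex_of_real (s V c j)) * mat_adjoint V"
      by (rule gram_matrix_diagonalisation[OF \<sigma>c[OF c]]) (rule that[unfolded s_def])
    then show "\<exists>V. unitary_mat (?d c) V \<and> mat_adjoint (\<sigma> c) * \<sigma> c =
      V * mat_diag (?d c) (\<lambda>j. complex_of_real (s V c j)) * mat_adjoint V" by blast
  qed
  from bchoice[OF this] obtain V where
    V: "\<forall>c\<in>?D. unitary_mat (?d c) (V c) \<and> mat_adjoint (\<sigma> c) * \<sigma> c =
      V c * mat_diag (?d c) (\<lambda>j. complex_of_real (s (V c) c j)) * mat_adjoint (V c)" ..
  have Vu: "unitary_mat (?d c) (V c)" if "c \<in> ?D" for c using V that by blast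
  have \<sigma>V: "\<sigma> c * V c \<in> carrier_mat (?d c) (?d c)" if "c \<in> ?D" for c
    by (rule mult_carrier_mat[OF \<sigma>c[OF that] unitary_mat_carrier[OF Vu[OF that]]])
  define S where "S c j = s (V c) c j" for c j
  have S0: "0 \<le> S c j" for c j by (simp add: S_def s_def sum_nonneg)
  have schatten: "schatten_norm r (\<sigma> c) powr r = (\<Sum>j<?d c. S c j powr (r / 2))" if c: "c \<in> ?D" for c
    by (rule schatten_norm_powr[OF r(1) Vu[OF c] S0]) (use V c in \<open>simp add: S_def\<close>)
  define I where "I = (SIGMA c:?D. {..<?d c} \<times> {..<?d c})"
  define \<psi> where "\<psi> = (\<lambda>(c, i, j) x. \<Sum>k<?d c. V c $$ (k, j) * rep c x $$ (i, k))"
  define y where "y = (\<lambda>(c, i, j) x. \<Sum>k<?d c. (\<sigma> c * V c) $$ (k, j) * rep c x $$ (i, k))"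
  define \<phi> where "\<phi> = (\<lambda>p f. of_nat (?d (fst p)) * l2_inner M f (\<psi> p))"
  define b where "b = (\<lambda>p. real (?d (fst p)) * l2_norm M (\<psi> p))"
  have \<psi>l: "\<psi> p \<in> l2 M" and yl: "y p \<in> l2 M" if "p \<in> I" for p
    using that by (auto simp: I_def \<psi>_def y_def intro!: row_l2 irr)
  have product: "b (c, i, j) * l2_norm M (y (c, i, j)) = sqrt (S c j)"
    if c: "c \<in> ?D" and i: "i < ?d c" and j: "j < ?d c" for c i j
  proof -
    have d: "0 < real (?d c)" using irrep_dim_pos[OF irr[OF c]] by simp
    have "(\<Sum>k<?d c. (cmod (V c $$ (k, j)))\<^sup>2) = 1"
    proof -
      have "complex_of_real (\<Sum>k<?d c. (cmod (V c $$ (k, j)))\<^sup>2) = (\<Sum>k<?d c. cnj (V c $$ (k, j)) * V c $$ (k, j))"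
        unfolding of_real_sum complex_norm_square by (simp add: mult.commute)
      then show ?thesis using unitary_mat_cols[OF Vu[OF c] j j] by (metis of_real_eq_1_iff)
    qed
    then have "b (c, i, j) = real (?d c) * sqrt (1 / real (?d c))"
      using row_norm[OF irr[OF c] i, of "\<lambda>k. V c $$ (k, j)"] by (simp add: b_def \<psi>_def)
    moreover have "l2_norm M (y (c, i, j)) = sqrt (S c j / real (?d c))"
      using row_norm[OF irr[OF c] i, of "\<lambda>k. (\<sigma> c * V c) $$ (k, j)"] by (simp add: y_def S_def s_def)
    ultimately have "b (c, i, j) * l2_norm M (y (c, i, j)) = real (?d c) * (sqrt (1 / real (?d c)) * sqrt (S c j / real (?d c)))"
      by simp
    also have "sqrt (1 / real (?d c)) * sqrt (S c j / real (?d c)) = sqrt (S c j) / real (?d c)"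
      using d by (simp add: real_sqrt_divide)
    finally show ?thesis using d by simp
  qed
  show ?thesis
  proof (rule r_nuclear_criterion[OF r A, where I = I and \<phi> = \<phi> and b = b and y = y
        and D = "{\<lambda>x. rep c x $$ (i, j) | c i j. c \<in> ?D \<and> i < ?d c \<and> j < ?d c}"])
    fix p assume p: "p \<in> I"
    show "\<phi> p \<in> sn_dual (L2 M)" unfolding \<phi>_def by (rule inner_in_sn_dual[OF \<psi>l[OF p]])
    show "0 \<le> b p" by (simp add: b_def)
    show "y p \<in> l2 M" by (rule yl[OF p])
    fix f assume f: "f \<in> l2 M"
    show "cmod (\<phi> p f) \<le> b p * l2_norm M f"
      using mult_left_mono[OF l2_Cauchy_Schwarz[OF f \<psi>l[OF p]], of "real (?d (fst p))"]
      by (simp add: \<phi>_def b_def norm_mult mult_ac)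
  next
    show "(\<lambda>p. (b p * l2_norm M (y p)) powr r) summable_on I"
      unfolding I_def
    proof (rule summable_on_SigmaI[OF _ sum])
      fix c assume c: "c \<in> ?D"
      let ?g = "\<lambda>p. (b (c, p) * l2_norm M (y (c, p))) powr r"
      have "(\<Sum>p\<in>{..<?d c} \<times> {..<?d c}. ?g p) = (\<Sum>i<?d c. \<Sum>j<?d c. ?g (i, j))"
        by (simp add: sum.cartesian_product)
      also have "\<dots> = (\<Sum>i<?d c. \<Sum>j<?d c. S c j powr (r / 2))"
        by (intro sum.cong refl) (simp add: product[OF c] S0 powr_powr flip: powr_half_sqrt)
      also have "\<dots> = real (?d c) * schatten_norm r (\<sigma> c) powr r"
        by (simp add: schatten[OF c])
      finally show "(?g has_sum real (?d c) * schatten_norm r (\<sigma> c) powr r) ({..<?d c} \<times> {..<?d c})"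
        by (intro has_sum_finiteI) auto
    qed simp
  next
    fix X assume "closed_l2_subspace M X"
      "{\<lambda>x. rep c x $$ (i, j) | c i j. c \<in> ?D \<and> i < ?d c \<and> j < ?d c} \<subseteq> X"
    then show "l2 M \<subseteq> X" by (intro coefficients_total[OF rep]) auto
  next
    fix f assume "f \<in> {\<lambda>x. rep c x $$ (i, j) | c i j. c \<in> ?D \<and> i < ?d c \<and> j < ?d c}"
    then obtain c a m where c: "c \<in> ?D" and a: "a < ?d c" and m: "m < ?d c"
      and f: "f = (\<lambda>x. rep c x $$ (a, m))" by blast
    note \<xi> = irr[OF c]
    have fl: "f \<in> l2 M" unfolding f by (rule cont_l2[OF irrep_cont[OF \<xi> a m]])
    have f_row: "f = (\<lambda>x. \<Sum>k<?d c. (if k = m then 1 else 0) * rep c x $$ (a, k))"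
      using m by (simp add: f if_distrib[of "\<lambda>u. u * _"] sum.delta cong: if_cong)
    have same: "\<phi> (c, i, j) f = (if a = i then cnj (V c $$ (m, j)) else 0)" if i: "i < ?d c" for i j
    proof -
      have "l2_inner M f (\<psi> (c, i, j)) =
          (if a = i then (\<Sum>k<?d c. (if k = m then 1 else 0) * cnj (V c $$ (k, j))) / of_nat (?d c) else 0)"
        unfolding f_row \<psi>_def using row_inner[OF \<xi> a i] by simp
      also have "(\<Sum>k<?d c. (if k = m then 1 else 0) * cnj (V c $$ (k, j))) = cnj (V c $$ (m, j))"
        using m by (simp add: if_distrib[of "\<lambda>u. u * _"] sum.delta cong: if_cong)
      finally show ?thesis using irrep_dim_pos[OF \<xi>] by (simp add: \<phi>_def)
    qed
    have other: "\<phi> (c', i, j) f = 0" if c': "c' \<in> ?D" "c' \<noteq> c" and i: "i < ?d c'" for c' i j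
    proof -
      note \<eta> = irr[OF c'(1)]
      have ne: "\<not> rep_equiv G (rep c') (rep c)"
        by (rule unitary_dual_inequiv[OF c'(1) rep[OF c'(1)] c rep[OF c] c'(2)])
      have "l2_inner M f (\<psi> (c', i, j)) = (\<Sum>k<?d c'. l2_inner M f (\<lambda>x. V c' $$ (k, j) * rep c' x $$ (i, k)))"
        unfolding \<psi>_def prod.case using i
        by (intro l2_inner_sum_right l2_scale cont_l2[OF irrep_cont[OF \<eta>]] fl) auto
      also have "\<dots> = 0"
        using Schur_orthogonality_inequivalent[OF \<xi> \<eta> ne a m i] by (intro sum.neutral) (simp add: f)
      finally show ?thesis by (simp add: \<phi>_def)
    qed
    let ?F = "(\<lambda>j. (c, a, j)) ` {..<?d c}"
    have "finite ?F" "?F \<subseteq> I" using c a by (auto simp: I_def)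
    moreover have "\<phi> p f = 0" if p: "p \<in> I - ?F" for p
    proof -
      obtain c' i j where p': "p = (c', i, j)" "c' \<in> ?D" "i < ?d c'" "j < ?d c'" using p by (auto simp: I_def)
      show ?thesis
      proof (cases "c' = c")
        case True
        then have "a \<noteq> i" using p p' by auto
        then show ?thesis using same[of i j] p' True by simp
      qed (use other p' in simp)
    qed
    moreover have "l2_norm M (\<lambda>x. A f x - (\<Sum>p\<in>?F. \<phi> p f * y p x)) = 0"
    proof -
      note Vc = unitary_mat_carrier[OF Vu[OF c]]
      have row: "(\<Sum>j<?d c. (\<sigma> c * V c) $$ (k, j) * cnj (V c $$ (m, j))) = \<sigma> c $$ (k, m)" if k: "k < ?d c" for k
      proof -
        have "\<sigma> c * V c * mat_adjoint (V c) = \<sigma> c"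
          by (simp add: assoc_mult_mat[OF \<sigma>c[OF c] Vc mat_adjoint_carrier[OF Vc]] unitary_mat_right[OF Vu[OF c]]
              right_mult_one_mat[OF \<sigma>c[OF c]])
        moreover have "(\<sigma> c * V c * mat_adjoint (V c)) $$ (k, m) = (\<Sum>j<?d c. (\<sigma> c * V c) $$ (k, j) * cnj (V c $$ (m, j)))"
          unfolding mat_mult_index[OF \<sigma>V[OF c] mat_adjoint_carrier[OF Vc] k m]
          using m by (intro sum.cong refl) (simp add: mat_adjoint_index[OF Vc])
        ultimately show ?thesis by simp
      qed
      have "(\<Sum>p\<in>?F. \<phi> p f * y p x) = (\<Sum>k<?d c. rep c x $$ (a, k) * \<sigma> c $$ (k, m))" for x
      proof -
        have "(\<Sum>p\<in>?F. \<phi> p f * y p x) = (\<Sum>j<?d c. \<phi> (c, a, j) f * y (c, a, j) x)"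
          by (subst sum.reindex) (auto simp: inj_on_def)
        also have "\<dots> = (\<Sum>j<?d c. \<Sum>k<?d c. rep c x $$ (a, k) * ((\<sigma> c * V c) $$ (k, j) * cnj (V c $$ (m, j))))"
          by (simp add: same[OF a] y_def sum_distrib_left mult_ac del: index_mult_mat)
        also have "\<dots> = (\<Sum>k<?d c. \<Sum>j<?d c. rep c x $$ (a, k) * ((\<sigma> c * V c) $$ (k, j) * cnj (V c $$ (m, j))))"
          by (rule sum.swap)
        also have "\<dots> = (\<Sum>k<?d c. rep c x $$ (a, k) * \<sigma> c $$ (k, m))"
          by (intro sum.cong refl) (simp add: row sum_distrib_left[symmetric] del: index_mult_mat)
        finally show ?thesis .
      qed
      then show ?thesis using symbol_determines(2)[OF Al \<xi> sym[OF c] a m] by (simp add: f)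
    qed
    ultimately show "f \<in> l2 M \<and> (\<exists>F. finite F \<and> F \<subseteq> I \<and> (\<forall>p\<in>I - F. \<phi> p f = 0) \<and>
      l2_norm M (\<lambda>x. A f x - (\<Sum>p\<in>F. \<phi> p f * y p x)) = 0)"
      using fl by blast
  qed
qed

end

lemma smooth_map_continuous: "smooth_map n S \<A> m T \<B> f \<Longrightarrow> continuous_map S T f"
  unfolding smooth_map_def by (rule conjunct1)

lemma compact_lie_group_haar_group:
  assumes "compact_lie_group G T n \<A>" "normalised_haar G T M"
  shows "compact_haar_group G T M"
proof -
  note lie = assms(1)[unfolded compact_lie_group_def, THEN conjunct1, unfolded lie_group_def]
  note comp = assms(1)[unfolded compact_lie_group_def, THEN conjunct2]
  note group = lie[THEN conjunct1] and top = lie[THEN conjunct2, THEN conjunct1]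
  note manifold = lie[THEN conjunct2, THEN conjunct2, THEN conjunct1, unfolded smooth_manifold_def]
  note mult = lie[THEN conjunct2, THEN conjunct2, THEN conjunct2, THEN conjunct1]
  note inv = lie[THEN conjunct2, THEN conjunct2, THEN conjunct2, THEN conjunct2]
  show ?thesis
    by (intro compact_haar_group.intro compact_haar_group_axioms.intro)
      (rule group top comp manifold[THEN conjunct1] manifold[THEN conjunct2, THEN conjunct1]
        smooth_map_continuous[OF mult] smooth_map_continuous[OF inv] assms(2))+
qed

theorem theorem3p1:
  fixes G :: "('a, 'b) monoid_scheme"
    and T :: "'a topology"
    and n :: nat
    and \<A> :: "'a chart set"
    and M :: "'a measure"
    and rep :: "('a \<Rightarrow> complex mat) set \<Rightarrow> 'a \<Rightarrow> complex mat"
    and A :: "('a \<Rightarrow> complex) \<Rightarrow> 'a \<Rightarrow> complex"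
    and \<sigma> :: "('a \<Rightarrow> complex mat) set \<Rightarrow> complex mat"
    and r :: real
  assumes "compact_lie_group G T n \<A>"
    and "normalised_haar G T M"
    and "\<And>c. c \<in> unitary_dual G T \<Longrightarrow> rep c \<in> c"
    and "0 < r" and "r \<le> 1"
    and "bounded_operator (L2 M) (L2 M) A"
    and "\<And>c. c \<in> unitary_dual G T \<Longrightarrow> AE x in M. symbol G A x (rep c) = \<sigma> c"
    and "(\<lambda>c. real (rep_dim G (rep c)) * schatten_norm r (\<sigma> c) powr r) summable_on unitary_dual G T"
  shows "r_nuclear r (L2 M) (L2 M) A"
proof -
  have "compact_haar_group G T M" by (rule compact_lie_group_haar_group[OF assms(1,2)])
  from compact_haar_group.r_nuclear_of_summable_symbol[OF this, of rep r A \<sigma>]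
  show ?thesis using assms(3-8) by blast
qed

end
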